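(* Fix $\alpha'\in[0,1)$. There exists a constant $C(\alpha')$ such that for every $n$, every angular function $\omega$, every canonical state $\hat K\in\mathbb K_n$ satisfying $\alpha^a+\alpha^p\le\alpha'$, where $\alpha^\sigma=K^\sigma/|B_n|$, and every $f\in T^\omega_n$ with $\mathbb E_{n,\hat K}[f]=0$, $$\mathbb E_{n,\hat K}[f^2]\le C(\alpha')\,n^2\,\mathscr D_{n,\hat K}(f).$$
   Context: $B_n=\{-n,\dots,n\}^2\subset\mathbb Z^2$, $\mathbb S=[0,2\pi)$ (the circle), $\sigma\in\{a,p\}$. Configurations: $\hat\eta_x=((\eta^a_x,\eta^p_x),\theta_x)$ with $(\eta^a_x,\eta^p_x)\in\{(1,0),(0,1),(0,0)\}$, $\theta_x\in\mathbb S$, $\theta_x=0$ if the site is empty; $\eta_x=\eta^a_x+\eta^p_x$ and $\eta^{\sigma,\omega}_x=\omega(\theta_x)\eta^\sigma_x$ for an angular function $\omega:\mathbb S\to\mathbb R$. A canonical state on $B_n$ is $\hat K=(K^a,\Theta^a,K^p,\Theta^p)$ with $K^a+K^p\le|B_n|$ and $\Theta^\sigma=\{\theta^\sigma_1,\dots,\theta^\sigma_{K^\sigma}\}$ the angles of the type-$\sigma$ particles; $\mathbb K_n$ is the set of these states. The canonical measure $\mu_{n,\hat K}$ (expectation $\mathbb E_{n,\hat K}$, inner product $\langle\cdot,\cdot\rangle_{n,\hat K}$) is the law of the configuration on $B_n$ obtained by placing the prescribed particles (with their types and angles) at uniformly chosen distinct sites. A cylinder function depends on finitely many sites and is $C^2$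 in the angles. $T^\omega$ is the linear span of cylinder functions of the form $\sum_{x\in\mathbb Z^2}(a\eta^a_x+b\eta^p_x+c\eta^{a,\omega}_x+d\eta^{p,\omega}_x)F_x(\eta)$, where $a,b,c,d\in\mathbb R$ and each $F_x$ depends on the configuration only through the occupation variables $\eta=(\eta_y)_y$ (neither types nor angles). $T^\omega_n$ is the set of functions in $T^\omega$ with support contained in $B_n$. The Dirichlet form is $\mathscr D_{n,\hat K}(f)=\langle f,-\mathcal L_nf\rangle_{n,\hat K}$, with $\mathcal L_nf(\hat\eta)=\sum_{x,x+z\in B_n,\,|z|=1}\eta_x(1-\eta_{x+z})\big(f(\hat\eta^{x,x+z})-f(\hat\eta)\big)$, $\hat\eta^{x,y}$ being $\hat\eta$ with $\hat\eta_x,\hat\eta_y$ swapped ($|\cdot|$ on $\mathbb Z^2$ is the $\ell^1$ norm). *)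

theory Defs
  imports "HOL-Probability.Probability" "HOL-Library.Real_Mod"
begin

type_synonym site = "int \<times> int"

definition square :: "nat \<Rightarrow> site set" where
  "square n = {- int n..int n} \<times> {- int n..int n}"

definition l1_norm :: "site \<Rightarrow> int" where
  "l1_norm z = \<bar>fst z\<bar> + \<bar>snd z\<bar>"

typedef angle = "{0..<2 * pi}"
  by (rule exI[of _ 0]) simp

definition angle_of_real :: "real \<Rightarrow> angle" where
  "angle_of_real t = Abs_angle (t rmod (2 * pi))"

datatype ptype = Active | Passive

text \<open>
  An empty site is \<open>None\<close>; a site occupied by a particle of type \<open>\<sigma>\<close> with angle \<open>t\<close> is
  \<open>Some (\<sigma>, t)\<close>. Thus the pair of occupation numbers of a site is automatically
  one of \<open>(1,0)\<close>, \<open>(0,1)\<close>, \<open>(0,0)\<close>.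
\<close>

type_synonym particle = "ptype \<times> angle"
type_synonym config = "site \<Rightarrow> particle option"

definition eta_type :: "ptype \<Rightarrow> config \<Rightarrow> site \<Rightarrow> real" where
  "eta_type \<sigma> \<xi> x = of_bool (\<exists>t. \<xi> x = Some (\<sigma>, t))"

definition theta :: "config \<Rightarrow> site \<Rightarrow> angle" where
  "theta \<xi> x = (case \<xi> x of None \<Rightarrow> angle_of_real 0 | Some p \<Rightarrow> snd p)"

definition eta :: "config \<Rightarrow> site \<Rightarrow> real" where
  "eta \<xi> x = eta_type Active \<xi> x + eta_type Passive \<xi> x"

definition eta_ang :: "ptype \<Rightarrow> (angle \<Rightarrow> real) \<Rightarrow> config \<Rightarrow> site \<Rightarrow> real" where
  "eta_ang \<sigma> \<omega> \<xi> x = \<omega> (theta \<xi> x) * eta_type \<sigma> \<xi> x"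

definition supported_in :: "(config \<Rightarrow> real) \<Rightarrow> site set \<Rightarrow> bool" where
  "supported_in f A \<longleftrightarrow> (\<forall>\<xi> \<zeta>. (\<forall>x\<in>A. \<xi> x = \<zeta> x) \<longrightarrow> f \<xi> = f \<zeta>)"

text \<open>
  Continuous partial derivatives up to order two. This is used only for functions of
  finitely many coordinates, where continuity for the product topology on
  \<open>site \<Rightarrow> real\<close> is ordinary joint continuity.
\<close>

definition C2_coords :: "((site \<Rightarrow> real) \<Rightarrow> real) \<Rightarrow> bool" where
  "C2_coords G \<longleftrightarrow>
     continuous_on UNIV G \<and>
     (\<exists>D1 D2.
        (\<forall>x. continuous_on UNIV (D1 x)) \<and>
        (\<forall>x y. continuous_on UNIV (D2 x y)) \<and>
        (\<forall>x \<phi>. ((\<lambda>t. G (\<phi>(x := t))) has_real_derivative D1 x \<phi>) (at (\<phi> x))) \<and>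
        (\<forall>x y \<phi>. ((\<lambda>t. D1 x (\<phi>(y := t))) has_real_derivative D2 x y \<phi>) (at (\<phi> y))))"

text \<open>
  Smoothness on the circle is smoothness of the \<open>2\<pi>\<close>-periodic extension. The types
  \<open>\<tau>\<close> of the particles are held fixed, and the coordinates \<open>\<phi>\<close> at empty sites are ignored.
\<close>

definition with_angles :: "(site \<Rightarrow> ptype option) \<Rightarrow> (site \<Rightarrow> real) \<Rightarrow> config" where
  "with_angles \<tau> \<phi> = (\<lambda>x. map_option (\<lambda>\<sigma>. (\<sigma>, angle_of_real (\<phi> x))) (\<tau> x))"

definition cylinder :: "(config \<Rightarrow> real) \<Rightarrow> bool" where
  "cylinder f \<longleftrightarrow> (\<exists>A. finite A \<and> supported_in f A) \<and>
                  (\<forall>\<tau>. C2_coords (\<lambda>\<phi>. f (with_angles \<tau> \<phi>)))"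

text \<open>
  The sum over all sites is an unconditional pointwise sum; the \<open>F x\<close> need not have
  finite support individually, only the resulting function \<open>g\<close> has to be cylindrical.
\<close>

definition T_gen :: "(angle \<Rightarrow> real) \<Rightarrow> (config \<Rightarrow> real) set" where
  "T_gen \<omega> = {g. cylinder g \<and>
     (\<exists>a b c d :: real. \<exists>F :: site \<Rightarrow> (site \<Rightarrow> real) \<Rightarrow> real.
        \<forall>\<xi>. ((\<lambda>x. (a * eta_type Active \<xi> x + b * eta_type Passive \<xi> x
                   + c * eta_ang Active \<omega> \<xi> x + d * eta_ang Passive \<omega> \<xi> x) * F x (eta \<xi>))
             has_sum g \<xi>) UNIV)}"

definition T_space :: "(angle \<Rightarrow> real) \<Rightarrow> (config \<Rightarrow> real) set" where
  "T_space \<omega> = {f. \<exists>(m::nat) (r :: nat \<Rightarrow> real) g.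
     (\<forall>i<m. g i \<in> T_gen \<omega>) \<and> f = (\<lambda>\<xi>. \<Sum>i<m. r i * g i \<xi>)}"

definition T_box :: "(angle \<Rightarrow> real) \<Rightarrow> nat \<Rightarrow> (config \<Rightarrow> real) set" where
  "T_box \<omega> n = {f \<in> T_space \<omega>. supported_in f (square n)}"

text \<open>
  A canonical state \<open>(K\<^sup>a, \<Theta>\<^sup>a, K\<^sup>p, \<Theta>\<^sup>p)\<close>. Distinct particles may have the same angle,
  so the collections of angles are multisets.
\<close>

type_synonym canonical_state = "nat \<times> angle multiset \<times> nat \<times> angle multiset"

definition canonical_states :: "nat \<Rightarrow> canonical_state set" where
  "canonical_states n =
     {(Ka, \<Theta>a, Kp, \<Theta>p). size \<Theta>a = Ka \<and> size \<Theta>p = Kp \<and> Ka + Kp \<le> card (square n)}"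

fun particles :: "canonical_state \<Rightarrow> particle multiset" where
  "particles (Ka, \<Theta>a, Kp, \<Theta>p) =
     image_mset (Pair Active) \<Theta>a + image_mset (Pair Passive) \<Theta>p"

text \<open>
  The particles are enumerated in some order (the law does not depend on it), and put
  on a uniformly chosen list of distinct sites of the square. Configurations on the square are
  extended by empty sites outside of it.
\<close>

definition canonical_measure :: "nat \<Rightarrow> canonical_state \<Rightarrow> config pmf" where
  "canonical_measure n K =
     (let ps = (SOME ps. mset ps = particles K) in
      map_pmf (\<lambda>xs. map_of (zip xs ps))
        (pmf_of_set {xs. length xs = length ps \<and> distinct xs \<and> set xs \<subseteq> square n}))"

definition canonical_expectation ::
    "nat \<Rightarrow> canonical_state \<Rightarrow> (config \<Rightarrow> real) \<Rightarrow> real" where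
  "canonical_expectation n K f = measure_pmf.expectation (canonical_measure n K) f"

definition canonical_inner ::
    "nat \<Rightarrow> canonical_state \<Rightarrow> (config \<Rightarrow> real) \<Rightarrow> (config \<Rightarrow> real) \<Rightarrow> real" where
  "canonical_inner n K f g = canonical_expectation n K (\<lambda>\<xi>. f \<xi> * g \<xi>)"

definition swap_sites :: "site \<Rightarrow> site \<Rightarrow> config \<Rightarrow> config" where
  "swap_sites x y \<xi> = \<xi>(x := \<xi> y, y := \<xi> x)"

definition generator :: "nat \<Rightarrow> (config \<Rightarrow> real) \<Rightarrow> config \<Rightarrow> real" where
  "generator n f \<xi> =
     (\<Sum>(x, z) \<in> {(x, z). x \<in> square n \<and> x + z \<in> square n \<and> l1_norm z = 1}.
        eta \<xi> x * (1 - eta \<xi> (x + z)) * (f (swap_sites x (x + z) \<xi>) - f \<xi>))"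

definition dirichlet_form :: "nat \<Rightarrow> canonical_state \<Rightarrow> (config \<Rightarrow> real) \<Rightarrow> real" where
  "dirichlet_form n K f = canonical_inner n K f (\<lambda>\<xi>. - generator n f \<xi>)"

end

theory Submission
  imports Defs "HOL-Combinatorics.Permutations"
begin

text \<open>
  Give every particle its own label, and label the holes too, so that a configuration on the
  square is \<open>\<kappa> \<circ> q\<close>, where \<open>q\<close> is a permutation of the square that sends each site to the
  label it carries and \<open>\<kappa>\<close> tells which particle (if any) a label denotes. The canonical measure
  is the image of the uniform distribution on permutations, jumps are compositions with
  transpositions, and a function in \<open>T_box \<omega> n\<close> becomes a sum over the particles of functions
  of the position of that one particle and of the set of occupied sites.

  Such a sum can be centred both in the label and in the position. This splits it into
  a function of the occupied set alone and one centred function for each particle, and these parts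
  are orthogonal in \<open>L\<^sup>2\<close> as well as for the Dirichlet form, with the same weights in both
  (\<open>centered_orthogonality\<close>, \<open>hop_energy_decomposition\<close>). The weights do not see the angles,
  which is why the constant does not depend on \<open>\<omega>\<close>. What remains is a spectral gap of order
  \<open>n\<^sup>-\<^sup>2\<close> for exclusion with a single tagged particle, all other particles being
  indistinguishable (\<open>tagged_gap\<close>).

  The tagged gap is proved by comparison with the random transposition walk on permutations, whose
  gap is elementary (\<open>random_transposition_gap\<close>). Each transposition must be imitated by
  nearest-neighbour swaps that are legal or change nothing. If the tagged particle does not take
  part, two straight lines around it suffice, and a random intermediate site
  spreads the load evenly over the bonds (\<open>sum_swap_norm_untagged\<close>). If it does take part, a hole
  is brought next to it and the pair walks along a line, the hole stepping around the
  tagged particle at each step (\<open>walk_total\<close>). There is no need to count how often a bond is used on this walk: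
  each of its \<open>O(n)\<close> steps is an injective image of the uniform distribution, hence has an \<open>L\<^sup>2\<close>
  norm of at most a constant times the square root of the Dirichlet form, and Minkowski's
  inequality gives the factor \<open>n\<^sup>2\<close>. The hole that helps is chosen uniformly among all holes; this is
  the place where the density of particles has to stay away from 1 (\<open>axis_move\<close>).
\<close>

\<comment> \<open>\<open>transpose\<close> is the transposition of two points throughout\<close>
hide_const (open) Finite_Cartesian_Product.transpose

section \<open>The spectral gap of the random transposition walk\<close>

definition swap_energy :: "'a set \<Rightarrow> (('a \<Rightarrow> 'a) \<Rightarrow> real) \<Rightarrow> 'a \<Rightarrow> 'a \<Rightarrow> real" where
  "swap_energy S f x y = (\<Sum>p | p permutes S. (f (p \<circ> transpose x y) - f p)\<^sup>2)"

lemma sum_permutes_fiber: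
  assumes "x \<in> S" "b \<in> S"
  shows "(\<Sum>p | p permutes S \<and> p x = b. f p) = (\<Sum>q | q permutes S - {x}. f (transpose x b \<circ> q))"
proof (rule sum.reindex_bij_witness[where i = "\<lambda>q. transpose x b \<circ> q" and j = "\<lambda>p. transpose x b \<circ> p"])
  fix p assume p: "p \<in> {p. p permutes S \<and> p x = b}"
  have 1: "(transpose x b \<circ> p) permutes S"
    using p assms by (auto intro: permutes_compose permutes_swap_id)
  have "(transpose x b \<circ> p) x = x" using p by simp
  with 1 show "transpose x b \<circ> p \<in> {q. q permutes S - {x}}"
    by (auto intro: permutes_superset)
  show "transpose x b \<circ> (transpose x b \<circ> p) = p" by (simp add: fun_eq_iff)
  then show "f (transpose x b \<circ> (transpose x b \<circ> p)) = f p" by simp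
next
  fix q assume q: "q \<in> {q. q permutes S - {x}}"
  have "q permutes S" using q by (auto intro: permutes_subset)
  then have 1: "(transpose x b \<circ> q) permutes S"
    using assms by (auto intro: permutes_compose permutes_swap_id)
  have "q x = x" using q by (auto intro: permutes_not_in)
  with 1 show "transpose x b \<circ> q \<in> {p. p permutes S \<and> p x = b}" by simp
  show "transpose x b \<circ> (transpose x b \<circ> q) = q" by (simp add: fun_eq_iff)
qed

lemma sum_permutes_split:
  assumes "finite S" "x \<in> S"
  shows "(\<Sum>p | p permutes S. f p) = (\<Sum>b\<in>S. \<Sum>p | p permutes S \<and> p x = b. f p)"
proof -
  have "(\<Sum>b\<in>S. sum f {p \<in> {p. p permutes S}. p x = b}) = sum f {p. p permutes S}"
    using assms by (intro sum.group) (auto simp: finite_permutations permutes_in_image)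
  then show ?thesis by simp
qed

lemma card_permutes_fiber:
  assumes "finite S" "x \<in> S" "b \<in> S"
  shows "card {p. p permutes S \<and> p x = b} = fact (card S - 1)"
proof -
  have "(\<Sum>p | p permutes S \<and> p x = b. 1::nat) = (\<Sum>q | q permutes S - {x}. 1)"
    using assms by (intro sum_permutes_fiber)
  then show ?thesis using assms
    by (simp add: card_permutations[of "S - {x}" "card S - 1"])
qed

lemma swap_energy_nonneg: "swap_energy S f x y \<ge> 0"
  by (simp add: swap_energy_def sum_nonneg)

lemma swap_energy_self [simp]: "swap_energy S f x x = 0"
  by (simp add: swap_energy_def)

lemma sum_square_diff:
  fixes s :: "'a \<Rightarrow> real"
  shows "(\<Sum>b\<in>S. \<Sum>c\<in>S. (s b - s c)\<^sup>2) = 2 * (card S * (\<Sum>b\<in>S. (s b)\<^sup>2) - (\<Sum>b\<in>S. s b)\<^sup>2)"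
proof -
  have "(\<Sum>b\<in>S. \<Sum>c\<in>S. (s b - s c)\<^sup>2)
      = (\<Sum>b\<in>S. \<Sum>c\<in>S. (s b)\<^sup>2 + (s c)\<^sup>2 - 2 * (s b * s c))"
    by (simp add: power2_diff mult.assoc)
  also have "\<dots> = card S * (\<Sum>b\<in>S. (s b)\<^sup>2) + card S * (\<Sum>b\<in>S. (s b)\<^sup>2) - 2 * (\<Sum>b\<in>S. \<Sum>c\<in>S. s b * s c)"
    by (simp add: sum.distrib sum_subtractf sum_distrib_left)
  also have "(\<Sum>b\<in>S. \<Sum>c\<in>S. s b * s c) = (\<Sum>b\<in>S. s b)\<^sup>2"
    by (simp add: sum_product power2_eq_square)
  finally show ?thesis by simp
qed

lemma fiber_transpose:
  assumes p: "p permutes S" "p x = b" and "c \<in> S"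
  shows "transpose b c \<circ> p = p \<circ> transpose x (inv p c)"
proof -
  have bi: "bij p" using p by (simp add: permutes_bij)
  have "inv p b = x" using p by (simp add: permutes_inverses permutes_inv_eq)
  then show ?thesis by (simp add: fun_eq_iff transpose_apply_commute[OF bi])
qed

text \<open>
  Variance of the conditional mean given \<open>p x\<close>. On the fibre \<open>p x = b\<close>, replacing the value \<open>b\<close>
  by \<open>c\<close> amounts to swapping \<open>x\<close> with the site where \<open>p\<close> takes the value \<open>c\<close>, so the
  difference of two fibre sums is a sum of swap differences and Cauchy-Schwarz applies.
\<close>

lemma fiber_means_variance:
  fixes f :: "('a \<Rightarrow> 'a) \<Rightarrow> real" and s :: "'a \<Rightarrow> real"
  assumes S: "finite S" "x \<in> S"
  defines "s \<equiv> \<lambda>b. \<Sum>p | p permutes S \<and> p x = b. f p"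
  shows "card S * (\<Sum>b\<in>S. (s b)\<^sup>2) - (\<Sum>p | p permutes S. f p)\<^sup>2
    \<le> fact (card S - 1) / 2 * (\<Sum>y\<in>S. swap_energy S f x y)"
proof -
  let ?P = "\<lambda>b. {p. p permutes S \<and> p x = b}"
  let ?M = "fact (card S - 1) :: real"
  have key: "(s b - s c)\<^sup>2 \<le> ?M * (\<Sum>p\<in>?P b. (f p - f (p \<circ> transpose x (inv p c)))\<^sup>2)"
    if bc: "b \<in> S" "c \<in> S" for b c
  proof -
    have tt: "transpose b c \<circ> (transpose b c \<circ> p) = p" for p :: "'a \<Rightarrow> 'a"
      by (simp add: fun_eq_iff)
    have im: "transpose b c \<circ> p \<in> ?P c" if "p \<in> ?P b" for p
      using that bc permutes_compose[OF _ permutes_swap_id[of b S c], of p] by simp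
    have im': "transpose b c \<circ> p \<in> ?P b" if "p \<in> ?P c" for p
      using that bc permutes_compose[OF _ permutes_swap_id[of b S c], of p] by simp
    have "bij_betw ((\<circ>) (transpose b c)) (?P b) (?P c)"
      by (rule bij_betw_byWitness[where f' = "(\<circ>) (transpose b c)"])
         (rule ballI, rule tt, rule ballI, rule tt, rule image_subsetI, erule im, rule image_subsetI, erule im')
    then have "s c = (\<Sum>p\<in>?P b. f (transpose b c \<circ> p))"
      unfolding s_def by (rule sum.reindex_bij_betw[symmetric])
    also have "\<dots> = (\<Sum>p\<in>?P b. f (p \<circ> transpose x (inv p c)))"
    proof (rule sum.cong[OF refl])
      fix p assume "p \<in> ?P b"
      then show "f (transpose b c \<circ> p) = f (p \<circ> transpose x (inv p c))"
        using fiber_transpose[of p S x b c] bc by simp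
    qed
    finally have sc: "s c = (\<Sum>p\<in>?P b. f (p \<circ> transpose x (inv p c)))" .
    define h where "h p = f p - f (p \<circ> transpose x (inv p c))" for p
    have "s b - s c = (\<Sum>p\<in>?P b. 1 * h p)"
      unfolding sc unfolding s_def h_def by (simp only: sum_subtractf mult_1)
    then show ?thesis
      using Cauchy_Schwarz_ineq_sum[of "\<lambda>_. 1" h "?P b"] card_permutes_fiber[OF S bc(1)]
      by (simp add: h_def[symmetric])
  qed
  have "2 * (card S * (\<Sum>b\<in>S. (s b)\<^sup>2) - (\<Sum>p | p permutes S. f p)\<^sup>2)
     = (\<Sum>b\<in>S. \<Sum>c\<in>S. (s b - s c)\<^sup>2)"
    by (simp add: sum_square_diff sum_permutes_split[OF S] s_def)
  also have "\<dots> \<le> (\<Sum>b\<in>S. \<Sum>c\<in>S. ?M * (\<Sum>p\<in>?P b. (f p - f (p \<circ> transpose x (inv p c)))\<^sup>2))"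
    by (intro sum_mono key)
  also have "\<dots> = ?M * (\<Sum>b\<in>S. \<Sum>p\<in>?P b. \<Sum>c\<in>S. (f p - f (p \<circ> transpose x (inv p c)))\<^sup>2)"
    unfolding sum_distrib_left
    by (intro sum.cong refl, subst sum.swap) simp
  also have "\<dots> = ?M * (\<Sum>p | p permutes S. \<Sum>c\<in>S. (f p - f (p \<circ> transpose x (inv p c)))\<^sup>2)"
    unfolding sum_permutes_split[OF S] by (rule refl)
  also have "(\<Sum>p | p permutes S. \<Sum>c\<in>S. (f p - f (p \<circ> transpose x (inv p c)))\<^sup>2)
      = (\<Sum>p | p permutes S. \<Sum>y\<in>S. (f p - f (p \<circ> transpose x y))\<^sup>2)"
  proof (rule sum.cong[OF refl])
    fix p assume p: "p \<in> {p. p permutes S}"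
    then have "bij_betw (inv p) S S" by (auto intro: permutes_imp_bij permutes_inv)
    then show "(\<Sum>c\<in>S. (f p - f (p \<circ> transpose x (inv p c)))\<^sup>2) = (\<Sum>y\<in>S. (f p - f (p \<circ> transpose x y))\<^sup>2)"
      by (rule sum.reindex_bij_betw)
  qed
  also have "\<dots> = (\<Sum>y\<in>S. swap_energy S f x y)"
    by (subst sum.swap) (simp add: swap_energy_def power2_commute)
  finally show ?thesis by simp
qed

lemma sum_pairs_avoiding:
  assumes "finite S" and sym: "\<And>y. e y y = (0::real)"
  shows "(\<Sum>x\<in>S. \<Sum>y\<in>S-{x}. \<Sum>z\<in>S-{x}. e y z) = (real (card S) - 2) * (\<Sum>y\<in>S. \<Sum>z\<in>S. e y z)"
proof -
  have "(\<Sum>y\<in>S-{x}. \<Sum>z\<in>S-{x}. e y z) = (\<Sum>y\<in>S. \<Sum>z\<in>S. e y z) - (\<Sum>z\<in>S. e x z) - (\<Sum>y\<in>S. e y x)"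
    if "x \<in> S" for x
    using that assms by (simp add: sum_diff1 sum_subtractf)
  then have "(\<Sum>x\<in>S. \<Sum>y\<in>S-{x}. \<Sum>z\<in>S-{x}. e y z)
     = (\<Sum>x\<in>S. (\<Sum>y\<in>S. \<Sum>z\<in>S. e y z) - (\<Sum>z\<in>S. e x z) - (\<Sum>y\<in>S. e y x))"
    by (intro sum.cong) auto
  also have "\<dots> = card S * (\<Sum>y\<in>S. \<Sum>z\<in>S. e y z) - (\<Sum>x\<in>S. \<Sum>z\<in>S. e x z) - (\<Sum>x\<in>S. \<Sum>y\<in>S. e y x)"
    by (simp add: sum_subtractf)
  also have "(\<Sum>x\<in>S. \<Sum>y\<in>S. e y x) = (\<Sum>x\<in>S. \<Sum>z\<in>S. e x z)" by (rule sum.swap)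
  finally show ?thesis by (simp add: algebra_simps)
qed

lemma sum_swap3: "(\<Sum>b\<in>S. \<Sum>y\<in>Y. \<Sum>z\<in>Z. g b y z) = (\<Sum>y\<in>Y. \<Sum>z\<in>Z. \<Sum>b\<in>S. g b y z)"
  by (subst sum.swap, rule sum.cong, rule refl, rule sum.swap)

text \<open>
  Induction on the size of \<open>S\<close>: given \<open>p x\<close>, what remains is a permutation of \<open>S - {x}\<close>, to
  which the induction hypothesis applies, and the conditional mean is controlled by the previous
  estimate. The resulting bound charges the swaps with \<open>x\<close> differently from the others; averaging
  over \<open>x\<close> gives all pairs the same weight, and the induction closes because
  \<open>(N - 2) / (N - 1) + 1 / N \<le> 1\<close>.
\<close>

theorem random_transposition_gap:
  fixes f :: "('a \<Rightarrow> 'a) \<Rightarrow> real"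
  assumes "finite S" "S \<noteq> {}"
  shows "fact (card S) * (\<Sum>p | p permutes S. (f p)\<^sup>2) - (\<Sum>p | p permutes S. f p)\<^sup>2
    \<le> fact (card S) / (2 * card S) * (\<Sum>x\<in>S. \<Sum>y\<in>S. swap_energy S f x y)"
  using assms
proof (induction "card S" arbitrary: S f)
  case 0
  then show ?case by simp
next
  case (Suc k S f)
  show ?case
  proof (cases "k = 0")
    case True
    then obtain a where "S = {a}" using Suc.hyps(2) by (metis One_nat_def card_1_singletonE)
    then show ?thesis by simp
  next
    case False
    let ?N = "card S" let ?M = "fact k :: real" and ?T = "\<Sum>y\<in>S. \<Sum>z\<in>S. swap_energy S f y z"
    let ?V = "\<Sum>p | p permutes S. (f p)\<^sup>2" and ?E = "\<Sum>p | p permutes S. f p"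
    have N: "?N = Suc k" and fN: "fact ?N = real ?N * ?M" using Suc.hyps(2)[symmetric] by auto
    have T0: "?T \<ge> 0" by (intro sum_nonneg swap_energy_nonneg)
    have one: "fact ?N * ?V - ?E\<^sup>2 \<le> ?N * ?M / (2 * k) * (\<Sum>y\<in>S-{x}. \<Sum>z\<in>S-{x}. swap_energy S f y z)
        + ?M / 2 * (\<Sum>y\<in>S. swap_energy S f x y)" if x: "x \<in> S" for x
    proof -
      let ?s = "\<lambda>b. \<Sum>p | p permutes S \<and> p x = b. f p"
      have Sx: "k = card (S - {x})" "finite (S - {x})" using N x Suc.prems by auto
      have ne: "S - {x} \<noteq> {}" using Sx False by (metis card.empty)
      have "?M * (\<Sum>p | p permutes S \<and> p x = b. (f p)\<^sup>2) - (?s b)\<^sup>2 \<le> ?M / (2 * k) *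
          (\<Sum>y\<in>S-{x}. \<Sum>z\<in>S-{x}. \<Sum>p | p permutes S \<and> p x = b. (f (p \<circ> transpose y z) - f p)\<^sup>2)"
        if b: "b \<in> S" for b
        using Suc.hyps(1)[OF Sx ne, of "\<lambda>q. f (transpose x b \<circ> q)"]
        by (simp add: sum_permutes_fiber[OF x b] Sx(1)[symmetric] swap_energy_def comp_assoc)
      then have "(\<Sum>b\<in>S. ?M * (\<Sum>p | p permutes S \<and> p x = b. (f p)\<^sup>2) - (?s b)\<^sup>2) \<le> (\<Sum>b\<in>S. ?M / (2 * k) *
          (\<Sum>y\<in>S-{x}. \<Sum>z\<in>S-{x}. \<Sum>p | p permutes S \<and> p x = b. (f (p \<circ> transpose y z) - f p)\<^sup>2))"
        by (rule sum_mono)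
      also have "\<dots> = ?M / (2 * k) * (\<Sum>y\<in>S-{x}. \<Sum>z\<in>S-{x}. \<Sum>b\<in>S. \<Sum>p | p permutes S \<and> p x = b. (f (p \<circ> transpose y z) - f p)\<^sup>2)"
        unfolding sum_distrib_left[symmetric]
        by (rule arg_cong[OF sum_swap3])
      also have "\<dots> = ?M / (2 * k) * (\<Sum>y\<in>S-{x}. \<Sum>z\<in>S-{x}. swap_energy S f y z)"
        by (simp add: swap_energy_def sum_permutes_split[OF Suc.prems(1) x])
      finally have "?M * ?V - (\<Sum>b\<in>S. (?s b)\<^sup>2) \<le> ?M / (2 * k) * (\<Sum>y\<in>S-{x}. \<Sum>z\<in>S-{x}. swap_energy S f y z)"
        by (simp add: sum_subtractf sum_distrib_left[symmetric] sum_permutes_split[OF Suc.prems(1) x])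
      then have "?N * (?M * ?V - (\<Sum>b\<in>S. (?s b)\<^sup>2)) \<le> ?N * (?M / (2 * k) * (\<Sum>y\<in>S-{x}. \<Sum>z\<in>S-{x}. swap_energy S f y z))"
        by (intro mult_left_mono) auto
      moreover have "?N * (\<Sum>b\<in>S. (?s b)\<^sup>2) - ?E\<^sup>2 \<le> ?M / 2 * (\<Sum>y\<in>S. swap_energy S f x y)"
        using fiber_means_variance[OF Suc.prems(1) x, of f] N by simp
      ultimately show ?thesis unfolding fN by (simp add: algebra_simps)
    qed
    have "?N * (fact ?N * ?V - ?E\<^sup>2) = (\<Sum>x\<in>S. fact ?N * ?V - ?E\<^sup>2)" by simp
    also have "\<dots> \<le> (\<Sum>x\<in>S. ?N * ?M / (2 * k) * (\<Sum>y\<in>S-{x}. \<Sum>z\<in>S-{x}. swap_energy S f y z)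
        + ?M / 2 * (\<Sum>y\<in>S. swap_energy S f x y))"
      by (intro sum_mono one)
    also have "\<dots> = ?N * ?M / (2 * k) * ((real ?N - 2) * ?T) + ?M / 2 * ?T"
      unfolding sum.distrib sum_distrib_left[symmetric]
      by (subst sum_pairs_avoiding[OF Suc.prems(1)]) simp_all
    also have "\<dots> = ?M * ?T / 2 * (?N * (real ?N - 2) / k + 1)" using False by (simp add: field_simps)
    also have "?N * (real ?N - 2) / k + 1 \<le> ?N"
      using False by (simp add: N field_simps)
    then have "?M * ?T / 2 * (?N * (real ?N - 2) / k + 1) \<le> ?M * ?T / 2 * ?N"
      using T0 by (intro mult_left_mono) auto
    finally have "?N * (fact ?N * ?V - ?E\<^sup>2) \<le> ?N * (?M * ?T / 2)" by (simp add: mult_ac)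
    then have "fact ?N * ?V - ?E\<^sup>2 \<le> ?M * ?T / 2"
      by (rule mult_left_le_imp_le) (simp add: N)
    also have "\<dots> = fact ?N / (2 * ?N) * ?T" unfolding fN N
      by (simp add: field_simps)
    finally show ?thesis .
  qed
qed

section \<open>Exclusion with one tagged particle: swaps that avoid it\<close>

text \<open>
  Bonds are oriented, so each pair of neighbours occurs twice, as in the generator.
\<close>

definition bonds :: "nat \<Rightarrow> (site \<times> site) set" where
  "bonds n = {(x, y). x \<in> square n \<and> y \<in> square n \<and> l1_norm (y - x) = 1}"

lemma finite_square [simp]: "finite (square n)" by (simp add: square_def)

lemma card_square: "card (square n) = (2 * n + 1)\<^sup>2"
proof -
  have "card {- int n..int n} = 2 * n + 1" by simp
  then show ?thesis by (simp only: square_def card_cartesian_product power2_eq_square)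
qed

lemma finite_bonds [simp]: "finite (bonds n)"
  by (rule finite_subset[of _ "square n \<times> square n"]) (auto simp: bonds_def)

lemma bonds_sym: "(x, y) \<in> bonds n \<longleftrightarrow> (y, x) \<in> bonds n"
  by (auto simp: bonds_def l1_norm_def)

lemma L2_set_square: "(L2_set f A)\<^sup>2 = (\<Sum>i\<in>A. (f i)\<^sup>2)"
  by (simp add: L2_set_def sum_nonneg)

lemma L2_set_inj_le:
  assumes "finite Q'" "inj_on g Q" "\<And>q. q \<in> Q \<Longrightarrow> g q \<in> Q'"
  shows "L2_set (\<lambda>q. f (g q)) Q \<le> L2_set f Q'"
proof -
  have "(\<Sum>q\<in>Q. (f (g q))\<^sup>2) = (\<Sum>q\<in>g ` Q. (f q)\<^sup>2)"
    using assms(2) by (simp add: sum.reindex)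
  also have "\<dots> \<le> (\<Sum>q\<in>Q'. (f q)\<^sup>2)"
    using assms by (intro sum_mono2) auto
  finally show ?thesis by (simp add: L2_set_def)
qed

lemma L2_set_triangle3:
  "L2_set (\<lambda>q. f q + g q + h q) Q \<le> L2_set f Q + L2_set g Q + L2_set h Q"
  using L2_set_triangle_ineq[of "\<lambda>q. f q + g q" h Q] L2_set_triangle_ineq[of f g Q] by linarith

lemma transpose_conjugate:
  assumes "x \<noteq> y" "y \<noteq> z" "x \<noteq> z"
  shows "transpose x y \<circ> transpose y z \<circ> transpose x y = transpose x z"
  using assms by (auto simp: fun_eq_iff Transposition.transpose_def)

lemma inj_on_compose_right: "inj_on (\<lambda>q. q \<circ> transpose x y) Q"
  by (rule inj_on_inverseI[of _ "\<lambda>q. q \<circ> transpose x y"]) (simp add: comp_assoc)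

text \<open>
  An arrangement \<open>q\<close> sends a site to the label it carries; the labels in \<open>A\<close> are particles, the
  others are holes, and \<open>t\<close> is the tagged particle. The two invariance assumptions say that
  \<open>F q\<close> depends only on the position of \<open>t\<close> and on the set of occupied sites.
\<close>

locale tagged_exclusion =
  fixes n :: nat and A :: "site set" and t :: site and F :: "(site \<Rightarrow> site) \<Rightarrow> real"
  assumes n: "1 \<le> n" and A: "A \<subseteq> square n" and t: "t \<in> A"
    and swap_particles: "\<And>q x y. q permutes square n \<Longrightarrow> q x \<in> A - {t} \<Longrightarrow> q y \<in> A - {t} \<Longrightarrow>
      F (q \<circ> transpose x y) = F q"
    and swap_holes: "\<And>q x y. q permutes square n \<Longrightarrow> q x \<in> square n - A \<Longrightarrow> q y \<in> square n - A \<Longrightarrow>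
      F (q \<circ> transpose x y) = F q"
begin

abbreviation "B \<equiv> square n"

text \<open>
  The contribution of one arrangement to the Dirichlet form: only a particle facing a hole may
  move, so swaps of two particles are not charged, even if one of them is tagged.
\<close>

definition local_energy :: "(site \<Rightarrow> site) \<Rightarrow> real" where
  "local_energy q = (\<Sum>(x, y)\<in>bonds n. of_bool (q x \<in> A \<and> q y \<notin> A) * (F (q \<circ> transpose x y) - F q)\<^sup>2)"

definition tag_at :: "site \<Rightarrow> (site \<Rightarrow> site) set" where
  "tag_at u = {q. q permutes B \<and> q u = t}"

definition energy_at :: "site \<Rightarrow> real" where
  "energy_at u = (\<Sum>q\<in>tag_at u. local_energy q)"

text \<open>
  The cost in \<open>L\<^sup>2\<close> of a swap while the tagged particle sits at \<open>u\<close>. Working with norms rather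
  than their squares lets compositions of swaps be handled by the triangle inequality.
\<close>

definition swap_norm :: "site \<Rightarrow> site \<Rightarrow> site \<Rightarrow> real" where
  "swap_norm u x y = L2_set (\<lambda>q. F (q \<circ> transpose x y) - F q) (tag_at u)"

lemma finite_tag_at [simp]: "finite (tag_at u)"
  unfolding tag_at_def by (rule finite_subset[OF _ finite_permutations[OF finite_square]]) auto

lemma local_energy_nonneg: "local_energy q \<ge> 0"
  unfolding local_energy_def by (intro sum_nonneg) auto

lemma energy_at_nonneg: "energy_at u \<ge> 0"
  unfolding energy_at_def by (intro sum_nonneg local_energy_nonneg)

lemma swap_norm_self [simp]: "swap_norm u x x = 0"
  by (simp add: swap_norm_def L2_set_def)

lemma swap_norm_commute: "swap_norm u x y = swap_norm u y x"
  by (simp add: swap_norm_def transpose_commute)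

lemma swap_norm_nonneg: "swap_norm u x y \<ge> 0"
  by (simp add: swap_norm_def)

lemma swap_norm_square: "(swap_norm u x y)\<^sup>2 = (\<Sum>q\<in>tag_at u. (F (q \<circ> transpose x y) - F q)\<^sup>2)"
  by (simp add: swap_norm_def L2_set_square)

lemma tag_at_swap:
  assumes "q \<in> tag_at u" "x \<in> B - {u}" "y \<in> B - {u}"
  shows "q \<circ> transpose x y \<in> tag_at u"
  using assms by (auto simp: tag_at_def intro: permutes_compose permutes_swap_id)

text \<open>
  The swap of \<open>x\<close> and \<open>z\<close> is that of \<open>y\<close> and \<open>z\<close> conjugated by that of \<open>x\<close> and \<open>y\<close>, and
  none of these swaps moves the tagged particle, so the intermediate arrangements are again
  uniformly distributed over \<open>tag_at u\<close>.
\<close>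

lemma swap_norm_triangle:
  assumes x: "x \<in> B - {u}" and y: "y \<in> B - {u}" and z: "z \<in> B - {u}"
  shows "swap_norm u x z \<le> 2 * swap_norm u x y + swap_norm u y z"
proof (cases "x = y \<or> y = z \<or> x = z")
  case True
  then show ?thesis using swap_norm_nonneg[of u x z] swap_norm_nonneg[of u y z] by (auto simp: swap_norm_commute)
next
  case False
  have xz: "q \<circ> transpose x z = q \<circ> transpose x y \<circ> transpose y z \<circ> transpose x y" for q :: "site \<Rightarrow> site"
    using transpose_conjugate[of x y z] False by (metis comp_assoc)
  have "swap_norm u x z = L2_set (\<lambda>q.
      (F (q \<circ> transpose x y \<circ> transpose y z \<circ> transpose x y) - F (q \<circ> transpose x y \<circ> transpose y z))
    + (F (q \<circ> transpose x y \<circ> transpose y z) - F (q \<circ> transpose x y))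
    + (F (q \<circ> transpose x y) - F q)) (tag_at u)"
    by (simp add: swap_norm_def xz)
  also have "\<dots> \<le> L2_set (\<lambda>q. F (q \<circ> transpose x y \<circ> transpose y z \<circ> transpose x y) - F (q \<circ> transpose x y \<circ> transpose y z)) (tag_at u)
    + L2_set (\<lambda>q. F (q \<circ> transpose x y \<circ> transpose y z) - F (q \<circ> transpose x y)) (tag_at u)
    + L2_set (\<lambda>q. F (q \<circ> transpose x y) - F q) (tag_at u)"
    by (rule L2_set_triangle3)
  also have "L2_set (\<lambda>q. F (q \<circ> transpose x y \<circ> transpose y z \<circ> transpose x y) - F (q \<circ> transpose x y \<circ> transpose y z)) (tag_at u)
      \<le> swap_norm u x y"
    unfolding swap_norm_def
    by (rule L2_set_inj_le[where f = "\<lambda>q. F (q \<circ> transpose x y) - F q" and g = "\<lambda>q. q \<circ> transpose x y \<circ> transpose y z"])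
       (use x y z tag_at_swap inj_on_compose_right in
         \<open>auto intro!: inj_on_compose_right comp_inj_on[of "\<lambda>q. q \<circ> transpose x y" _ "\<lambda>q. q \<circ> transpose y z", unfolded comp_def[of "\<lambda>q. q \<circ> transpose y z"]]\<close>)
  also have "L2_set (\<lambda>q. F (q \<circ> transpose x y \<circ> transpose y z) - F (q \<circ> transpose x y)) (tag_at u)
      \<le> swap_norm u y z"
    unfolding swap_norm_def
    by (rule L2_set_inj_le[where f = "\<lambda>q. F (q \<circ> transpose y z) - F q" and g = "\<lambda>q. q \<circ> transpose x y"])
       (use x y in \<open>auto intro!: tag_at_swap inj_on_compose_right\<close>)
  finally show ?thesis unfolding swap_norm_def o_def by linarith
qed

lemma swap_norm_triangle_square:
  assumes "x \<in> B - {u}" "y \<in> B - {u}" "z \<in> B - {u}"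
  shows "(swap_norm u x z)\<^sup>2 \<le> 8 * (swap_norm u x y)\<^sup>2 + 2 * (swap_norm u y z)\<^sup>2"
proof -
  have "(swap_norm u x z)\<^sup>2 \<le> (2 * swap_norm u x y + swap_norm u y z)\<^sup>2"
    using swap_norm_triangle[OF assms] swap_norm_nonneg by (intro power_mono)
  also have "\<dots> \<le> 2 * (2 * swap_norm u x y)\<^sup>2 + 2 * (swap_norm u y z)\<^sup>2"
    by (smt (verit) sum_squares_bound power2_sum)
  finally show ?thesis by (simp add: power_mult_distrib)
qed

text \<open>
  The path is shortened at its far end, one bond at a time: then the factor 2 of the triangle
  inequality falls on that single bond and does not accumulate.
\<close>

lemma swap_norm_path:
  assumes "\<And>i. i \<le> k \<Longrightarrow> s i \<in> B - {u}"
  shows "swap_norm u (s 0) (s k) \<le> 2 * (\<Sum>l<k. swap_norm u (s l) (s (Suc l)))"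
  using assms
proof (induction k)
  case 0
  then show ?case by simp
next
  case (Suc k)
  have "swap_norm u (s (Suc k)) (s 0) \<le> 2 * swap_norm u (s (Suc k)) (s k) + swap_norm u (s k) (s 0)"
    by (intro swap_norm_triangle Suc.prems) auto
  moreover have "swap_norm u (s 0) (s k) \<le> 2 * (\<Sum>l<k. swap_norm u (s l) (s (Suc l)))"
    using Suc by simp
  ultimately show ?case by (simp add: swap_norm_commute)
qed

text \<open>
  The swap is a legal jump for exactly one of the two orientations of the bond.
\<close>

lemma bond_change_le_local_energy:
  assumes q: "q permutes B" and xy: "(x, y) \<in> bonds n" "q x \<in> A \<longleftrightarrow> q y \<notin> A"
  shows "(F (q \<circ> transpose x y) - F q)\<^sup>2 \<le> local_energy q"
proof -
  have *: "(F (q \<circ> transpose v w) - F q)\<^sup>2 \<le> local_energy q"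
    if "(v, w) \<in> bonds n" "q v \<in> A" "q w \<notin> A" for v w
  proof -
    have "(case (v, w) of (x, y) \<Rightarrow> of_bool (q x \<in> A \<and> q y \<notin> A) * (F (q \<circ> transpose x y) - F q)\<^sup>2) \<le> local_energy q"
      unfolding local_energy_def using that by (intro member_le_sum) auto
    with that show ?thesis by simp
  qed
  show ?thesis
  proof (cases "q x \<in> A")
    case True then show ?thesis using * xy by simp
  next
    case False
    then have "(F (q \<circ> transpose y x) - F q)\<^sup>2 \<le> local_energy q"
      using * xy bonds_sym by simp
    then show ?thesis by (simp add: transpose_commute)
  qed
qed

lemma untagged_trivial:
  assumes q: "q \<in> tag_at u" and xy: "x \<in> B - {u}" "y \<in> B - {u}" "q x \<in> A \<longleftrightarrow> q y \<in> A"
  shows "F (q \<circ> transpose x y) = F q"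
proof -
  have p: "q permutes B" and u: "q u = t" using q by (auto simp: tag_at_def)
  have "q x \<noteq> t" "q y \<noteq> t" using u xy permutes_inj[OF p] by (auto dest: injD)
  moreover have "q x \<in> B" "q y \<in> B" using xy permutes_in_image[OF p] by auto
  ultimately show ?thesis using xy(3) swap_particles[OF p, of x y] swap_holes[OF p, of x y] by blast
qed

lemma untagged_bond_le_local_energy:
  assumes "q \<in> tag_at u" "(x, y) \<in> bonds n" "x \<noteq> u" "y \<noteq> u"
  shows "(F (q \<circ> transpose x y) - F q)\<^sup>2 \<le> local_energy q"
proof (cases "q x \<in> A \<longleftrightarrow> q y \<in> A")
  case True
  then have "F (q \<circ> transpose x y) = F q"
    using assms by (intro untagged_trivial[of q u]) (auto simp: bonds_def)
  then show ?thesis by (simp add: local_energy_nonneg)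
next
  case False
  then show ?thesis using assms by (intro bond_change_le_local_energy) (auto simp: tag_at_def)
qed

lemma swap_norm_bond:
  assumes "(x, y) \<in> bonds n" "x \<noteq> u" "y \<noteq> u"
  shows "swap_norm u x y \<le> sqrt (energy_at u)"
  unfolding swap_norm_def L2_set_def energy_at_def
  using assms by (intro real_sqrt_le_mono sum_mono untagged_bond_le_local_energy) auto

definition untagged_bonds :: "site \<Rightarrow> (site \<times> site) set" where
  "untagged_bonds u = {(x, y) \<in> bonds n. x \<noteq> u \<and> y \<noteq> u}"

text \<open>
  The factor 2 is due to the two orientations of a bond, of which only one is charged by
  \<open>local_energy\<close>.
\<close>

lemma untagged_bonds_energy:
  "(\<Sum>(x, y)\<in>untagged_bonds u. (swap_norm u x y)\<^sup>2) \<le> 2 * energy_at u"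
proof -
  define g where "g q e = (case e of (x, y) \<Rightarrow> of_bool (q x \<in> A \<and> q y \<notin> A) * (F (q \<circ> transpose x y) - F q)\<^sup>2)"
    for q :: "site \<Rightarrow> site" and e :: "site \<times> site"
  have "(\<Sum>(x, y)\<in>untagged_bonds u. (F (q \<circ> transpose x y) - F q)\<^sup>2) \<le> 2 * local_energy q" if q: "q \<in> tag_at u" for q
  proof -
    have "(\<Sum>(x, y)\<in>untagged_bonds u. (F (q \<circ> transpose x y) - F q)\<^sup>2)
        = (\<Sum>e\<in>untagged_bonds u. g q e + g q (prod.swap e))"
    proof (rule sum.cong[OF refl])
      fix e assume e: "e \<in> untagged_bonds u"
      obtain x y where xy: "e = (x, y)" by (cases e)
      show "(case e of (x, y) \<Rightarrow> (F (q \<circ> transpose x y) - F q)\<^sup>2) = g q e + g q (prod.swap e)"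
      proof (cases "q x \<in> A \<longleftrightarrow> q y \<in> A")
        case True
        then have "F (q \<circ> transpose x y) = F q"
          using e xy by (intro untagged_trivial[OF q]) (auto simp: bonds_def untagged_bonds_def)
        then show ?thesis by (simp add: xy g_def transpose_commute)
      next
        case False
        then show ?thesis by (auto simp: xy g_def transpose_commute)
      qed
    qed
    also have "\<dots> \<le> (\<Sum>e\<in>bonds n. g q e + g q (prod.swap e))"
      by (rule sum_mono2) (auto simp: untagged_bonds_def g_def split: prod.split)
    also have "\<dots> = (\<Sum>e\<in>bonds n. g q e) + (\<Sum>e\<in>bonds n. g q (prod.swap e))"
      by (rule sum.distrib)
    also have "(\<Sum>e\<in>bonds n. g q (prod.swap e)) = (\<Sum>e\<in>bonds n. g q e)"
      by (rule sum.reindex_bij_witness[where i = prod.swap and j = prod.swap]) (auto simp: bonds_sym)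
    also have "(\<Sum>e\<in>bonds n. g q e) = local_energy q"
      by (simp add: local_energy_def g_def)
    finally show ?thesis by (simp only: mult_2)
  qed
  then have "(\<Sum>q\<in>tag_at u. \<Sum>(x, y)\<in>untagged_bonds u. (F (q \<circ> transpose x y) - F q)\<^sup>2) \<le> (\<Sum>q\<in>tag_at u. 2 * local_energy q)"
    by (rule sum_mono)
  moreover have "(\<Sum>(x, y)\<in>untagged_bonds u. (swap_norm u x y)\<^sup>2)
      = (\<Sum>q\<in>tag_at u. \<Sum>(x, y)\<in>untagged_bonds u. (F (q \<circ> transpose x y) - F q)\<^sup>2)"
    by (subst sum.swap) (simp add: swap_norm_square case_prod_unfold)
  ultimately show ?thesis by (simp add: energy_at_def sum_distrib_left)
qed

text \<open>
  The energy carried by a line of the square. Lines through the tagged particle are never used;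
  giving them the value 0 allows sums over all lines.
\<close>

definition column_energy :: "site \<Rightarrow> int \<Rightarrow> real" where
  "column_energy u i = (if i = fst u then 0
     else \<Sum>j\<in>{- int n..<int n}. (swap_norm u (i, j) (i, j + 1))\<^sup>2)"

definition row_energy :: "site \<Rightarrow> int \<Rightarrow> real" where
  "row_energy u j = (if j = snd u then 0
     else \<Sum>i\<in>{- int n..<int n}. (swap_norm u (i, j) (i + 1, j))\<^sup>2)"

lemma column_energy_nonneg: "column_energy u i \<ge> 0" and row_energy_nonneg: "row_energy u i \<ge> 0"
  by (auto simp: column_energy_def row_energy_def intro: sum_nonneg)

text \<open>
  Bounding the bonds between \<open>g i\<close> and \<open>g i'\<close> by all bonds of the line is affordable,
  since in the end all pairs of sites are summed anyway.
\<close>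

lemma swap_norm_line:
  assumes g: "\<And>i. - int n \<le> i \<Longrightarrow> i \<le> int n \<Longrightarrow> g i \<in> B - {u}"
    and i: "- int n \<le> i" "i \<le> int n" and i': "- int n \<le> i'" "i' \<le> int n"
  shows "(swap_norm u (g i) (g i'))\<^sup>2 \<le> 8 * n * (\<Sum>l\<in>{- int n..<int n}. (swap_norm u (g l) (g (l + 1)))\<^sup>2)"
  using i i'
proof (induction i i' rule: linorder_wlog)
  case (le i i')
  define k where "k = nat (i' - i)"
  define s where "s l = g (i + int l)" for l
  have k: "i' = i + int k" using le by (simp add: k_def)
  let ?E = "\<Sum>l\<in>{- int n..<int n}. (swap_norm u (g l) (g (l + 1)))\<^sup>2"
  have E: "?E \<ge> 0" by (intro sum_nonneg) auto
  have "swap_norm u (g i) (g i') \<le> 2 * (\<Sum>l<k. swap_norm u (s l) (s (Suc l)))"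
    using swap_norm_path[of k s u] g le k by (simp add: s_def)
  then have "(swap_norm u (g i) (g i'))\<^sup>2 \<le> (2 * (\<Sum>l<k. swap_norm u (s l) (s (Suc l))))\<^sup>2"
    using swap_norm_nonneg by (intro power_mono)
  also have "\<dots> = 4 * (\<Sum>l<k. 1 * swap_norm u (s l) (s (Suc l)))\<^sup>2"
    by (simp add: power_mult_distrib)
  also have "\<dots> \<le> 4 * ((\<Sum>l<k. 1\<^sup>2) * (\<Sum>l<k. (swap_norm u (s l) (s (Suc l)))\<^sup>2))"
    by (intro mult_left_mono Cauchy_Schwarz_ineq_sum) simp
  also have "(\<Sum>l<k. (swap_norm u (s l) (s (Suc l)))\<^sup>2) = (\<Sum>l\<in>(\<lambda>l. i + int l) ` {..<k}. (swap_norm u (g l) (g (l + 1)))\<^sup>2)"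
    by (subst sum.reindex) (auto simp: inj_on_def s_def algebra_simps)
  also have "4 * ((\<Sum>l<k. 1\<^sup>2) * \<dots>) \<le> 4 * (real (2 * n) * ?E)"
    using le k by (intro mult_left_mono mult_mono sum_mono2) (auto intro: sum_nonneg)
  finally show ?case by simp
next
  case (sym i i')
  then show ?case by (simp add: swap_norm_commute)
qed

lemma swap_norm_column:
  assumes "i \<noteq> fst u" "(i, j) \<in> B" "(i, j') \<in> B"
  shows "(swap_norm u (i, j) (i, j'))\<^sup>2 \<le> 8 * n * column_energy u i"
  using swap_norm_line[of "\<lambda>j. (i, j)" u j j'] assms by (force simp: column_energy_def square_def)

lemma swap_norm_row:
  assumes "j \<noteq> snd u" "(i, j) \<in> B" "(i', j) \<in> B"
  shows "(swap_norm u (i, j) (i', j))\<^sup>2 \<le> 8 * n * row_energy u j"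
  using swap_norm_line[of "\<lambda>i. (i, j)" u i i'] assms by (force simp: row_energy_def square_def)

text \<open>
  Two straight lines join \<open>x\<close> to \<open>z\<close>. As \<open>z\<close> is neither in the row nor in the column of \<open>u\<close>, and
  \<open>x\<close> misses at least one of them, one of the two possible corners yields lines that both avoid
  \<open>u\<close>.
\<close>

lemma swap_norm_off_cross:
  assumes x: "x \<in> B - {u}" and z: "z \<in> B" "fst z \<noteq> fst u" "snd z \<noteq> snd u"
  shows "(swap_norm u x z)\<^sup>2 \<le> 64 * n * (column_energy u (fst x) + row_energy u (snd x)
     + column_energy u (fst z) + row_energy u (snd z))"
proof -
  obtain i j k l where xz: "x = (i, j)" "z = (k, l)" by (cases x, cases z)
  note nn = mult_left_mono[OF column_energy_nonneg[of u], of "real n", simplified]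
    mult_left_mono[OF row_energy_nonneg[of u], of "real n", simplified]
  show ?thesis
  proof (cases "i = fst u")
    case False
    have c: "(i, l) \<in> B - {u}" using xz x z by (auto simp: square_def)
    have "(swap_norm u x z)\<^sup>2 \<le> 8 * (swap_norm u x (i, l))\<^sup>2 + 2 * (swap_norm u (i, l) z)\<^sup>2"
      using x c z by (intro swap_norm_triangle_square) auto
    moreover have "(swap_norm u x (i, l))\<^sup>2 \<le> 8 * n * column_energy u i"
      using swap_norm_column[of i u j l] False x c xz by auto
    moreover have "(swap_norm u (i, l) z)\<^sup>2 \<le> 8 * n * row_energy u l"
      using swap_norm_row[of l u i k] z c xz by auto
    ultimately show ?thesis using nn[of i] nn[of j] nn[of k] nn[of l] xz by (simp add: algebra_simps)
  next
    case True
    then have j: "j \<noteq> snd u" using x xz by auto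
    have c: "(k, j) \<in> B - {u}" using xz x z by (auto simp: square_def)
    have "(swap_norm u x z)\<^sup>2 \<le> 8 * (swap_norm u x (k, j))\<^sup>2 + 2 * (swap_norm u (k, j) z)\<^sup>2"
      using x c z by (intro swap_norm_triangle_square) auto
    moreover have "(swap_norm u x (k, j))\<^sup>2 \<le> 8 * n * row_energy u j"
      using swap_norm_row[of j u i k] j x c xz by auto
    moreover have "(swap_norm u (k, j) z)\<^sup>2 \<le> 8 * n * column_energy u k"
      using swap_norm_column[of k u j l] z c xz by auto
    ultimately show ?thesis using nn[of i] nn[of j] nn[of k] nn[of l] xz by (simp add: algebra_simps)
  qed
qed

lemma swap_norm_via:
  assumes x: "x \<in> B - {u}" and y: "y \<in> B - {u}" and z: "z \<in> B" "fst z \<noteq> fst u" "snd z \<noteq> snd u"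
  shows "(swap_norm u x y)\<^sup>2 \<le> 512 * n * (column_energy u (fst x) + row_energy u (snd x)
     + column_energy u (fst y) + row_energy u (snd y) + 2 * column_energy u (fst z) + 2 * row_energy u (snd z))"
proof -
  note nn = mult_left_mono[OF column_energy_nonneg[of u], of "real n", simplified]
    mult_left_mono[OF row_energy_nonneg[of u], of "real n", simplified]
  have "(swap_norm u x y)\<^sup>2 \<le> 8 * (swap_norm u x z)\<^sup>2 + 2 * (swap_norm u z y)\<^sup>2"
    using x y z by (intro swap_norm_triangle_square) auto
  moreover have "(swap_norm u z y)\<^sup>2 \<le> 64 * n * (column_energy u (fst y) + row_energy u (snd y)
     + column_energy u (fst z) + row_energy u (snd z))"
    using swap_norm_off_cross[OF y z] by (simp add: swap_norm_commute)
  ultimately show ?thesis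
    using swap_norm_off_cross[OF x z] nn[of "fst y"] nn[of "snd y"] nn[of "fst z"] nn[of "snd z"]
    by (simp add: algebra_simps)
qed

lemma sum_column_energy: "(\<Sum>i\<in>{- int n..int n}. column_energy u i) \<le> 2 * energy_at u"
proof -
  let ?S = "({- int n..int n} - {fst u}) \<times> {- int n..<int n}"
  let ?h = "\<lambda>(i, j). ((i, j), (i, j + 1 :: int)) :: site \<times> site"
  have "(\<Sum>i\<in>{- int n..int n}. column_energy u i) = (\<Sum>i\<in>{- int n..int n} - {fst u}. column_energy u i)"
    by (rule sum.mono_neutral_right) (auto simp: column_energy_def)
  also have "\<dots> = (\<Sum>i\<in>{- int n..int n} - {fst u}. \<Sum>j\<in>{- int n..<int n}. (swap_norm u (i, j) (i, j + 1))\<^sup>2)"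
    by (rule sum.cong[OF refl]) (auto simp: column_energy_def)
  also have "\<dots> = (\<Sum>e\<in>?S. case ?h e of (x, y) \<Rightarrow> (swap_norm u x y)\<^sup>2)"
    by (subst sum.cartesian_product) (simp add: case_prod_unfold)
  also have "\<dots> = (\<Sum>(x, y)\<in>?h ` ?S. (swap_norm u x y)\<^sup>2)"
    by (subst sum.reindex) (auto simp: inj_on_def)
  also have "\<dots> \<le> (\<Sum>(x, y)\<in>untagged_bonds u. (swap_norm u x y)\<^sup>2)"
    by (rule sum_mono2) (auto simp: untagged_bonds_def bonds_def square_def l1_norm_def
       intro: finite_subset[OF _ finite_bonds[of n]])
  finally show ?thesis using untagged_bonds_energy[of u] by linarith
qed

lemma sum_row_energy: "(\<Sum>j\<in>{- int n..int n}. row_energy u j) \<le> 2 * energy_at u"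
proof -
  let ?S = "({- int n..int n} - {snd u}) \<times> {- int n..<int n}"
  let ?h = "\<lambda>(j, i). ((i, j), (i + 1 :: int, j)) :: site \<times> site"
  have "(\<Sum>i\<in>{- int n..int n}. row_energy u i) = (\<Sum>i\<in>{- int n..int n} - {snd u}. row_energy u i)"
    by (rule sum.mono_neutral_right) (auto simp: row_energy_def)
  also have "\<dots> = (\<Sum>j\<in>{- int n..int n} - {snd u}. \<Sum>i\<in>{- int n..<int n}. (swap_norm u (i, j) (i + 1, j))\<^sup>2)"
    by (rule sum.cong[OF refl]) (auto simp: row_energy_def)
  also have "\<dots> = (\<Sum>e\<in>?S. case ?h e of (x, y) \<Rightarrow> (swap_norm u x y)\<^sup>2)"
    by (subst sum.cartesian_product) (simp add: case_prod_unfold)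
  also have "\<dots> = (\<Sum>(x, y)\<in>?h ` ?S. (swap_norm u x y)\<^sup>2)"
    by (subst sum.reindex) (auto simp: inj_on_def)
  also have "\<dots> \<le> (\<Sum>(x, y)\<in>untagged_bonds u. (swap_norm u x y)\<^sup>2)"
    by (rule sum_mono2) (auto simp: untagged_bonds_def bonds_def square_def l1_norm_def
       intro: finite_subset[OF _ finite_bonds[of n]])
  finally show ?thesis using untagged_bonds_energy[of u] by linarith
qed

lemma column_energy_le:
  assumes "- int n \<le> i" "i \<le> int n" shows "column_energy u i \<le> 2 * energy_at u"
proof -
  have "column_energy u i \<le> (\<Sum>i\<in>{- int n..int n}. column_energy u i)"
    using assms by (intro member_le_sum column_energy_nonneg) auto
  then show ?thesis using sum_column_energy[of u] by linarith
qed

lemma row_energy_le: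
  assumes "- int n \<le> i" "i \<le> int n" shows "row_energy u i \<le> 2 * energy_at u"
proof -
  have "row_energy u i \<le> (\<Sum>i\<in>{- int n..int n}. row_energy u i)"
    using assms by (intro member_le_sum row_energy_nonneg) auto
  then show ?thesis using sum_row_energy[of u] by linarith
qed

text \<open>
  For a single pair the load on the bonds is irrelevant and every line energy may be bounded by that of
  all lines together.
\<close>

lemma swap_norm_le:
  assumes x: "x \<in> B - {u}" and y: "y \<in> B - {u}"
  shows "(swap_norm u x y)\<^sup>2 \<le> 8192 * n * energy_at u"
proof -
  \<comment> \<open>any site off the row and the column of the tagged particle will do\<close>
  define z :: site where "z = (if fst u = int n then 0 else int n, if snd u = int n then 0 else int n)"
  have z: "z \<in> B" "fst z \<noteq> fst u" "snd z \<noteq> snd u" using n by (auto simp: z_def square_def)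
  have "column_energy u (fst x) + row_energy u (snd x) + column_energy u (fst y) + row_energy u (snd y)
      + 2 * column_energy u (fst z) + 2 * row_energy u (snd z) \<le> 16 * energy_at u"
    using column_energy_le[of "fst x" u] row_energy_le[of "snd x" u] column_energy_le[of "fst y" u] row_energy_le[of "snd y" u]
      column_energy_le[of "fst z" u] row_energy_le[of "snd z" u] x y z by (auto simp: square_def)
  then have "512 * n * (column_energy u (fst x) + row_energy u (snd x) + column_energy u (fst y) + row_energy u (snd y)
      + 2 * column_energy u (fst z) + 2 * row_energy u (snd z)) \<le> 512 * n * (16 * energy_at u)"
    by (rule mult_left_mono) simp
  then show ?thesis using swap_norm_via[OF x y z] by simp
qed

lemma sum_square_fst: "(\<Sum>x\<in>B. h (fst x)) = (2 * n + 1) * (\<Sum>i\<in>{- int n..int n}. h i :: real)"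
proof -
  have "(\<Sum>x\<in>B. h (fst x)) = (\<Sum>i\<in>{- int n..int n}. \<Sum>j\<in>{- int n..int n}. h i)"
    by (simp only: square_def sum.cartesian_product case_prod_unfold)
  also have "\<dots> = (2 * n + 1) * (\<Sum>i\<in>{- int n..int n}. h i)"
    by (simp add: sum_distrib_left add.commute)
  finally show ?thesis .
qed

lemma sum_square_snd: "(\<Sum>x\<in>B. h (snd x)) = (2 * n + 1) * (\<Sum>i\<in>{- int n..int n}. h i :: real)"
proof -
  have "(\<Sum>x\<in>B. h (snd x)) = (\<Sum>i\<in>{- int n..int n}. \<Sum>j\<in>{- int n..int n}. h j)"
    by (simp only: square_def sum.cartesian_product case_prod_unfold)
  then show ?thesis by simp
qed

text \<open>
  The intermediate site is averaged over all sites off the cross of \<open>u\<close>. In this way every row and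
  every column carries its share of the paths, which is where the correct power of \<open>n\<close> comes from:
  after division by the number of sites, as in the random transposition bound, what remains
  is of order \<open>n\<^sup>2\<close>.
\<close>

lemma sum_swap_norm_untagged:
  "(\<Sum>x\<in>B - {u}. \<Sum>y\<in>B - {u}. (swap_norm u x y)\<^sup>2) \<le> 6144 * (2 * n + 1) ^ 4 * energy_at u"
  if u: "u \<in> B"
proof -
  define m :: real where "m = 2 * n + 1"
  define Z where "Z = ({- int n..int n} - {fst u}) \<times> ({- int n..int n} - {snd u})"
  define w where "w x = column_energy u (fst x) + row_energy u (snd x)" for x
  have w0: "w x \<ge> 0" for x by (simp add: w_def column_energy_nonneg row_energy_nonneg)
  have ZB: "Z \<subseteq> B" and finZ: "finite Z" by (auto simp: Z_def square_def)
  have cZ: "real (card Z) = 4 * (real n)\<^sup>2"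
  proof -
    have "card ({- int n..int n} - {fst u}) = 2 * n" "card ({- int n..int n} - {snd u}) = 2 * n"
      using u by (auto simp: square_def card_Diff_subset)
    then show ?thesis by (simp add: Z_def card_cartesian_product power2_eq_square)
  qed
  have cB: "real (card B) = m\<^sup>2" by (simp add: card_square m_def)
  have sw: "(\<Sum>x\<in>B. w x) \<le> 4 * m * energy_at u"
  proof -
    have "(\<Sum>x\<in>B. w x) = m * ((\<Sum>i\<in>{- int n..int n}. column_energy u i) + (\<Sum>i\<in>{- int n..int n}. row_energy u i))"
      by (simp add: w_def sum.distrib sum_square_fst sum_square_snd m_def algebra_simps)
    also have "\<dots> \<le> m * (4 * energy_at u)"
      using sum_column_energy[of u] sum_row_energy[of u] by (intro mult_left_mono) (auto simp: m_def)
    finally show ?thesis by simp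
  qed
  let ?T = "\<Sum>x\<in>B - {u}. \<Sum>y\<in>B - {u}. (swap_norm u x y)\<^sup>2"
  have "4 * (real n)\<^sup>2 * ?T = (\<Sum>x\<in>B - {u}. \<Sum>y\<in>B - {u}. \<Sum>z\<in>Z. (swap_norm u x y)\<^sup>2)"
    by (simp add: cZ sum_distrib_left)
  also have "\<dots> \<le> (\<Sum>x\<in>B - {u}. \<Sum>y\<in>B - {u}. \<Sum>z\<in>Z. 512 * n * (w x + w y + 2 * w z))"
  proof (intro sum_mono)
    fix x y z assume xyz: "x \<in> B - {u}" "y \<in> B - {u}" "z \<in> Z"
    then have "z \<in> B" "fst z \<noteq> fst u" "snd z \<noteq> snd u" by (auto simp: Z_def square_def)
    from swap_norm_via[OF xyz(1,2) this]
    show "(swap_norm u x y)\<^sup>2 \<le> 512 * n * (w x + w y + 2 * w z)" by (simp add: w_def algebra_simps)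
  qed
  also have "\<dots> \<le> (\<Sum>x\<in>B. \<Sum>y\<in>B. \<Sum>z\<in>B. 512 * n * (w x + w y + 2 * w z))"
  proof -
    have "(\<Sum>x\<in>B - {u}. \<Sum>y\<in>B - {u}. \<Sum>z\<in>Z. 512 * n * (w x + w y + 2 * w z))
      = (\<Sum>(x, y, z)\<in>(B - {u}) \<times> (B - {u}) \<times> Z. 512 * n * (w x + w y + 2 * w z))"
      by (simp add: sum.cartesian_product finZ)
    also have "\<dots> \<le> (\<Sum>(x, y, z)\<in>B \<times> B \<times> B. 512 * n * (w x + w y + 2 * w z))"
      using ZB by (intro sum_mono2) (auto simp: w0)
    also have "\<dots> = (\<Sum>x\<in>B. \<Sum>y\<in>B. \<Sum>z\<in>B. 512 * n * (w x + w y + 2 * w z))"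
      by (simp add: sum.cartesian_product)
    finally show ?thesis .
  qed
  also have "\<dots> = 512 * n * (4 * m ^ 4 * (\<Sum>x\<in>B. w x))"
  proof -
    have "(\<Sum>x\<in>B. \<Sum>y\<in>B. \<Sum>z\<in>B. w x + w y + 2 * w z) = 4 * m ^ 4 * (\<Sum>x\<in>B. w x)"
      by (simp add: sum_distrib_left[symmetric] sum.distrib cB power4_eq_xxxx power2_eq_square)
    then show ?thesis by (simp only: sum_distrib_left[symmetric])
  qed
  also have "\<dots> \<le> 512 * n * (4 * m ^ 4 * (4 * m * energy_at u))"
    using sw by (intro mult_left_mono) (auto simp: m_def)
  also have "\<dots> = (2 * n) * (2048 * 2 * m ^ 4) * (m * energy_at u)" by simp
  also have "\<dots> \<le> (2 * n) * (2048 * 2 * m ^ 4) * ((3 * n) * energy_at u)"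
    using n energy_at_nonneg[of u] by (intro mult_left_mono mult_right_mono) (auto simp: m_def)
  also have "\<dots> = 4 * (real n)\<^sup>2 * (6144 * m ^ 4 * energy_at u)"
    by (simp add: power2_eq_square)
  finally have "?T \<le> 6144 * m ^ 4 * energy_at u"
    by (rule mult_left_le_imp_le) (use n in simp)
  then show ?thesis by (simp add: m_def add.commute)
qed

end

section \<open>Walking the tagged particle along a line\<close>

definition ray :: "site \<Rightarrow> site \<Rightarrow> int \<Rightarrow> site" where
  "ray d v i = (fst v + i * fst d, snd v + i * snd d)"

text \<open>
  A permutation \<open>\<phi>\<close> of indices acts on the points \<open>v + i d\<close> of a ray, all other sites being
  fixed. For a unit vector \<open>d\<close>, the index of a point is its inner product with \<open>d\<close> relative
  to \<open>v\<close>.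
\<close>

definition along :: "site \<Rightarrow> site \<Rightarrow> (nat \<Rightarrow> nat) \<Rightarrow> site \<Rightarrow> site" where
  "along d v \<phi> x = (let i = (fst x - fst v) * fst d + (snd x - snd v) * snd d in
     if 0 \<le> i \<and> x = ray d v i then ray d v (int (\<phi> (nat i))) else x)"

lemma l1_norm_1_cases:
  assumes "l1_norm d = 1"
  shows "d = (1, 0) \<or> d = (-1, 0) \<or> d = (0, 1) \<or> d = (0, -1)"
  using assms by (cases d) (auto simp: l1_norm_def abs_if split: if_splits)

lemma ray_0 [simp]: "ray d v 0 = v"
  by (simp add: ray_def)

lemma ray_ray: "ray d (ray d v i) j = ray d v (i + j)"
  by (simp add: ray_def algebra_simps)

lemma ray_eq_iff:
  assumes "l1_norm d = 1" shows "ray d v i = ray d v j \<longleftrightarrow> i = j"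
  using l1_norm_1_cases[OF assms] by (auto simp: ray_def)

lemma ray_inj_base: "ray d v i = ray d w i \<longleftrightarrow> v = w"
  by (auto simp: ray_def prod_eq_iff)

lemma ray_step: "ray d v j - ray d v i = ray d 0 (j - i)"
  by (simp add: ray_def algebra_simps)

lemma along_ray:
  assumes "l1_norm d = 1" shows "along d v \<phi> (ray d v (int i)) = ray d v (int (\<phi> i))"
proof -
  have "(fst (ray d v (int i)) - fst v) * fst d + (snd (ray d v (int i)) - snd v) * snd d = int i"
    using l1_norm_1_cases[OF assms] by (auto simp: ray_def)
  then show ?thesis by (simp add: along_def)
qed

lemma along_other: "(\<And>i. x \<noteq> ray d v (int i)) \<Longrightarrow> along d v \<phi> x = x"
  by (auto simp: along_def Let_def dest: nonneg_int_cases)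

lemma along_id [simp]: "along d v id = id"
proof
  fix x show "along d v id x = id x"
    by (auto simp: along_def Let_def)
qed

lemma along_comp:
  assumes "l1_norm d = 1" shows "along d v (\<phi> \<circ> \<psi>) = along d v \<phi> \<circ> along d v \<psi>"
proof
  fix x show "along d v (\<phi> \<circ> \<psi>) x = (along d v \<phi> \<circ> along d v \<psi>) x"
  proof (cases "\<exists>i. x = ray d v (int i)")
    case True then show ?thesis using along_ray[OF assms, of v] by auto
  next
    case False then show ?thesis by (simp add: along_other)
  qed
qed

lemma along_transpose:
  assumes "l1_norm d = 1"
  shows "along d v (transpose i j) = transpose (ray d v (int i)) (ray d v (int j))"
proof
  fix x show "along d v (transpose i j) x = transpose (ray d v (int i)) (ray d v (int j)) x"
  proof (cases "\<exists>k. x = ray d v (int k)")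
    case True then show ?thesis using along_ray[OF assms, of v] ray_eq_iff[OF assms, of v]
      by (auto simp: Transposition.transpose_def)
  next
    case False then show ?thesis by (auto simp: along_other Transposition.transpose_def)
  qed
qed

lemma along_permutes:
  assumes d: "l1_norm d = 1" and \<phi>: "\<phi> permutes {..m}" and S: "\<And>i. i \<le> m \<Longrightarrow> ray d v (int i) \<in> S"
  shows "along d v \<phi> permutes S"
proof -
  have inv: "along d v \<phi> \<circ> along d v (inv \<phi>) = id" "along d v (inv \<phi>) \<circ> along d v \<phi> = id"
    using permutes_inv_o[OF \<phi>] by (simp_all flip: along_comp[OF d])
  then have "bij (along d v \<phi>)" by (rule o_bij[rotated])
  moreover have "along d v \<phi> x = x" if "x \<notin> S" for x
  proof (cases "\<exists>i. x = ray d v (int i)")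
    case True
    then obtain i where i: "x = ray d v (int i)" by auto
    with that S have "\<not> i \<le> m" by auto
    then show ?thesis using i along_ray[OF d] permutes_not_in[OF \<phi>] by simp
  next
    case False then show ?thesis by (simp add: along_other)
  qed
  ultimately show ?thesis unfolding permutes_def by (metis bij_def bij_pointE)
qed

text \<open>
  The contents of the line \<open>v, v + d, \<dots>, v + m d\<close> during the walk, as functions that send a
  place to the original place of what is now there; 0 stands for the tagged particle and \<open>m\<close> for
  the hole. In \<open>hole_in m k\<close> the hole has advanced towards the tagged particle, to place \<open>k\<close>; in
  \<open>pair_at m j\<close> the tagged particle is at place \<open>j\<close> with the hole just ahead; in \<open>hole_out m k\<close> the
  tagged particle has arrived at place \<open>m\<close> and the hole travels back, through place \<open>k\<close>.
  The incoming hole shifts the contents in between by one place away from \<open>v\<close>, the passing pair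
  shifts them back by two, and the returning hole by one in the first direction again, so that the
  net effect is the transposition of the two end points.
\<close>

definition hole_in :: "nat \<Rightarrow> nat \<Rightarrow> nat \<Rightarrow> nat" where
  "hole_in m k i = (if i = k then m else if k < i \<and> i \<le> m then i - 1 else i)"

definition pair_at :: "nat \<Rightarrow> nat \<Rightarrow> nat \<Rightarrow> nat" where
  "pair_at m j i = (if i < j then i + 1 else if i = j then 0 else if i = j + 1 then m
     else if i \<le> m then i - 1 else i)"

definition hole_out :: "nat \<Rightarrow> nat \<Rightarrow> nat \<Rightarrow> nat" where
  "hole_out m k i = (if i < k then i + 1 else if i = k then m else if i = m then 0 else i)"

lemma hole_in_start: "hole_in m m = id"
  by (auto simp: hole_in_def fun_eq_iff)

lemma hole_in_step: "k < m \<Longrightarrow> hole_in m k = hole_in m (Suc k) \<circ> transpose k (Suc k)"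
  by (auto simp: hole_in_def fun_eq_iff Transposition.transpose_def)

lemma pair_at_start: "1 \<le> m \<Longrightarrow> pair_at m 0 = hole_in m 1"
  by (auto simp: hole_in_def pair_at_def fun_eq_iff)

lemma pair_at_step: "Suc (Suc j) \<le> m \<Longrightarrow>
    pair_at m (Suc j) = pair_at m j \<circ> transpose j (Suc j) \<circ> transpose j (Suc (Suc j))"
  by (auto simp: pair_at_def fun_eq_iff Transposition.transpose_def)

lemma hole_out_start: "1 \<le> m \<Longrightarrow> hole_out m (m - 1) = pair_at m (m - 1) \<circ> transpose (m - 1) m"
  by (auto simp: pair_at_def hole_out_def fun_eq_iff Transposition.transpose_def)

lemma hole_out_step: "Suc (Suc k) \<le> m \<Longrightarrow> hole_out m k = hole_out m (Suc k) \<circ> transpose k (Suc k)"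
  by (auto simp: hole_out_def fun_eq_iff Transposition.transpose_def)

lemma hole_out_end: "1 \<le> m \<Longrightarrow> hole_out m 0 = transpose 0 m"
  by (auto simp: hole_out_def fun_eq_iff Transposition.transpose_def)

context tagged_exclusion
begin

definition perms :: "(site \<Rightarrow> site) set" where "perms = {q. q permutes B}"

definition tag :: "(site \<Rightarrow> site) \<Rightarrow> site" where "tag q = inv q t"

definition total_energy :: real where "total_energy = (\<Sum>q\<in>perms. local_energy q)"

lemma tag_eq_iff: "q \<in> perms \<Longrightarrow> tag q = u \<longleftrightarrow> q u = t"
  by (simp add: perms_def tag_def permutes_inv_eq)

lemma q_tag: "q \<in> perms \<Longrightarrow> q (tag q) = t"
  using tag_eq_iff by blast

lemma tag_at_eq: "tag_at u = {q \<in> perms. tag q = u}"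
  by (auto simp: tag_at_def perms_def tag_def permutes_inverses)

lemma finite_perms [simp]: "finite perms"
  by (simp add: perms_def finite_permutations)

lemma tag_in_B: "q \<in> perms \<Longrightarrow> tag q \<in> B"
  using A t permutes_in_image[of "inv q" B t] by (auto simp: perms_def tag_def permutes_inv)

lemma tag_swap:
  assumes q: "q \<in> perms" and \<pi>: "\<pi> permutes B" "\<pi> v = tag q"
  shows "q \<circ> \<pi> \<in> perms" "tag (q \<circ> \<pi>) = v"
proof -
  show 1: "q \<circ> \<pi> \<in> perms" using q \<pi> by (auto simp: perms_def intro: permutes_compose)
  show "tag (q \<circ> \<pi>) = v" using \<pi> q_tag[OF q] by (simp add: tag_eq_iff[OF 1])
qed

lemma total_energy_eq: "total_energy = (\<Sum>u\<in>B. energy_at u)"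
  unfolding total_energy_def energy_at_def tag_at_eq
  by (rule sum.group[symmetric]) (auto simp: tag_in_B)

lemma total_energy_nonneg: "total_energy \<ge> 0"
  unfolding total_energy_def by (intro sum_nonneg local_energy_nonneg)

text \<open>
  If a step finds the tagged particle at \<open>r v\<close> when it started at \<open>v\<close>, with \<open>r\<close> injective, then
  every \<open>energy_at\<close> is used at most once. Thus a step costs the same no matter how many
  steps precede it.
\<close>

lemma L2_by_tag:
  assumes X: "X \<subseteq> perms" "\<And>q. q \<in> X \<Longrightarrow> tag q \<in> U" and U: "U \<subseteq> B" and r: "inj_on r U" "r ` U \<subseteq> B"
    and h: "\<And>v. v \<in> U \<Longrightarrow> (\<Sum>q | q \<in> X \<and> tag q = v. (h q)\<^sup>2) \<le> c\<^sup>2 * energy_at (r v)" and c: "c \<ge> 0"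
  shows "L2_set h X \<le> c * sqrt total_energy"
proof -
  have fin: "finite X" "finite U" using finite_subset[OF X(1)] finite_subset[OF U] by auto
  have "(\<Sum>q\<in>X. (h q)\<^sup>2) = (\<Sum>v\<in>U. \<Sum>q | q \<in> X \<and> tag q = v. (h q)\<^sup>2)"
    using X fin by (intro sum.group[symmetric]) auto
  also have "\<dots> \<le> (\<Sum>v\<in>U. c\<^sup>2 * energy_at (r v))"
    by (intro sum_mono h)
  also have "\<dots> = c\<^sup>2 * (\<Sum>u\<in>r ` U. energy_at u)"
    by (simp add: sum.reindex[OF r(1)] sum_distrib_left)
  also have "\<dots> \<le> c\<^sup>2 * total_energy"
    unfolding total_energy_eq using r by (intro mult_left_mono sum_mono2) (auto simp: energy_at_nonneg)
  finally have "sqrt (\<Sum>q\<in>X. (h q)\<^sup>2) \<le> sqrt (c\<^sup>2 * total_energy)" by (rule real_sqrt_le_mono)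
  then show ?thesis using c by (simp add: L2_set_def real_sqrt_mult)
qed

text \<open>
  A step made after the rearrangement \<open>\<pi> v\<close>, which has brought the tagged particle from \<open>v\<close> to
  \<open>r v\<close>: exchange the contents of two other sites.
\<close>

lemma untagged_step:
  assumes X: "X \<subseteq> perms" "\<And>q. q \<in> X \<Longrightarrow> tag q \<in> U" and U: "U \<subseteq> B" and r: "inj_on r U" "r ` U \<subseteq> B"
    and \<pi>: "\<And>v. v \<in> U \<Longrightarrow> \<pi> v permutes B" "\<And>v. v \<in> U \<Longrightarrow> \<pi> v (r v) = v"
    and h: "\<And>v. v \<in> U \<Longrightarrow> swap_norm (r v) (x v) (z v) \<le> c * sqrt (energy_at (r v))" and c: "c \<ge> 0"
  shows "L2_set (\<lambda>q. F (q \<circ> \<pi> (tag q) \<circ> transpose (x (tag q)) (z (tag q))) - F (q \<circ> \<pi> (tag q))) X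
    \<le> c * sqrt total_energy"
proof (rule L2_by_tag[OF X U r _ c])
  fix v assume v: "v \<in> U"
  let ?f = "\<lambda>q. F (q \<circ> transpose (x v) (z v)) - F q"
  have "L2_set (\<lambda>q. ?f (q \<circ> \<pi> v)) {q \<in> X. tag q = v} \<le> L2_set ?f (tag_at (r v))"
  proof (rule L2_set_inj_le)
    show "inj_on (\<lambda>q. q \<circ> \<pi> v) {q \<in> X. tag q = v}"
      by (rule inj_on_inverseI[of _ "\<lambda>q. q \<circ> inv (\<pi> v)"])
         (simp add: comp_assoc permutes_inv_o[OF \<pi>(1)[OF v]])
    show "q \<circ> \<pi> v \<in> tag_at (r v)" if "q \<in> {q \<in> X. tag q = v}" for q
      using that X(1) tag_swap[of q "\<pi> v" "r v"] \<pi>[OF v] by (auto simp: tag_at_eq)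
  qed simp
  also have "\<dots> \<le> c * sqrt (energy_at (r v))" using h[OF v] by (simp add: swap_norm_def)
  finally have "(L2_set (\<lambda>q. ?f (q \<circ> \<pi> v)) {q \<in> X. tag q = v})\<^sup>2 \<le> (c * sqrt (energy_at (r v)))\<^sup>2"
    by (intro power_mono) auto
  then have "(\<Sum>q | q \<in> X \<and> tag q = v. (?f (q \<circ> \<pi> v))\<^sup>2) \<le> c\<^sup>2 * energy_at (r v)"
    by (simp add: L2_set_square power_mult_distrib energy_at_nonneg)
  then show "(\<Sum>q | q \<in> X \<and> tag q = v. (F (q \<circ> \<pi> (tag q) \<circ> transpose (x (tag q)) (z (tag q))) - F (q \<circ> \<pi> (tag q)))\<^sup>2)
     \<le> c\<^sup>2 * energy_at (r v)"
    by (smt (verit, best) mem_Collect_eq sum.cong)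
qed

text \<open>
  A step made after the rearrangement \<open>\<pi> v\<close>: the tagged particle jumps to an adjacent hole.
\<close>

lemma tagged_step:
  assumes X: "X \<subseteq> perms" "\<And>q. q \<in> X \<Longrightarrow> tag q \<in> U" and U: "U \<subseteq> B" and r: "inj_on r U" "r ` U \<subseteq> B"
    and \<pi>: "\<And>v. v \<in> U \<Longrightarrow> \<pi> v permutes B" "\<And>v. v \<in> U \<Longrightarrow> \<pi> v (r v) = v"
    and bond: "\<And>v. v \<in> U \<Longrightarrow> (r v, z v) \<in> bonds n"
    and hole: "\<And>q. q \<in> X \<Longrightarrow> q (\<pi> (tag q) (z (tag q))) \<notin> A"
  shows "L2_set (\<lambda>q. F (q \<circ> \<pi> (tag q) \<circ> transpose (r (tag q)) (z (tag q))) - F (q \<circ> \<pi> (tag q))) X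
    \<le> sqrt total_energy"
proof -
  have "L2_set (\<lambda>q. F (q \<circ> \<pi> (tag q) \<circ> transpose (r (tag q)) (z (tag q))) - F (q \<circ> \<pi> (tag q))) X
    \<le> 1 * sqrt total_energy"
  proof (rule L2_by_tag[OF X U r _ zero_le_one])
    fix v assume v: "v \<in> U"
    let ?X = "{q \<in> X. tag q = v}"
    have "(\<Sum>q\<in>?X. (F (q \<circ> \<pi> (tag q) \<circ> transpose (r (tag q)) (z (tag q))) - F (q \<circ> \<pi> (tag q)))\<^sup>2)
       \<le> (\<Sum>q\<in>?X. local_energy (q \<circ> \<pi> v))"
    proof (rule sum_mono)
      fix q assume q: "q \<in> ?X"
      then have "q \<circ> \<pi> v \<in> perms" using X(1) tag_swap[of q "\<pi> v" "r v"] \<pi>[OF v] by auto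
      moreover have "(q \<circ> \<pi> v) (r v) = t" using q X(1) q_tag[of q] \<pi>(2)[OF v] by auto
      moreover have "(q \<circ> \<pi> v) (z v) \<notin> A" using hole[of q] q by auto
      ultimately show "(F (q \<circ> \<pi> (tag q) \<circ> transpose (r (tag q)) (z (tag q))) - F (q \<circ> \<pi> (tag q)))\<^sup>2 \<le> local_energy (q \<circ> \<pi> v)"
        using bond_change_le_local_energy[OF _ bond[OF v], of "q \<circ> \<pi> v"] q t by (simp add: perms_def)
    qed
    also have "\<dots> = (\<Sum>q\<in>(\<lambda>q. q \<circ> \<pi> v) ` ?X. local_energy q)"
    proof -
      have "inj_on (\<lambda>q. q \<circ> \<pi> v) ?X"
        by (rule inj_on_inverseI[of _ "\<lambda>q. q \<circ> inv (\<pi> v)"])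
           (simp add: comp_assoc permutes_inv_o[OF \<pi>(1)[OF v]])
      then show ?thesis by (simp add: sum.reindex)
    qed
    also have "\<dots> \<le> energy_at (r v)"
      unfolding energy_at_def
    proof (rule sum_mono2)
      show "(\<lambda>q. q \<circ> \<pi> v) ` ?X \<subseteq> tag_at (r v)"
      proof (rule image_subsetI)
        fix q assume "q \<in> ?X"
        then show "q \<circ> \<pi> v \<in> tag_at (r v)"
          using X(1) tag_swap[of q "\<pi> v" "r v"] \<pi>[OF v] by (auto simp: tag_at_eq)
      qed
    qed (simp_all add: local_energy_nonneg)
    finally show "(\<Sum>q\<in>?X. (F (q \<circ> \<pi> (tag q) \<circ> transpose (r (tag q)) (z (tag q))) - F (q \<circ> \<pi> (tag q)))\<^sup>2)
       \<le> 1\<^sup>2 * energy_at (r v)" by simp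
  qed
  then show ?thesis by simp
qed

end

text \<open>
  A walk of \<open>m\<close> steps in the direction \<open>d\<close>; the neighbouring line shifted by \<open>e\<close> is used by the
  hole to get around the tagged particle.
\<close>

locale tagged_walk = tagged_exclusion +
  fixes d e :: site and m :: nat
  assumes d: "l1_norm d = 1" and e: "l1_norm e = 1" and orth: "fst d * fst e + snd d * snd e = 0"
begin

definition starts :: "site set" where
  "starts = {v. \<forall>i\<le>m. ray d v (int i) \<in> B \<and> ray d v (int i) + e \<in> B}"

definition states :: "(site \<Rightarrow> site) set" where
  "states = {q \<in> perms. tag q \<in> starts \<and> q (ray d (tag q) (int m)) \<notin> A}"

definition walk_norm :: "(nat \<Rightarrow> nat) \<Rightarrow> real" where
  "walk_norm \<phi> = L2_set (\<lambda>q. F (q \<circ> along d (tag q) \<phi>) - F q) states"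

lemma starts_B: "starts \<subseteq> B" by (auto simp: starts_def dest: spec[of _ 0])

lemma states_P: "states \<subseteq> perms" by (auto simp: states_def)

lemma ray_bond: "(ray d v i, ray d v j) \<in> bonds n" if "ray d v i \<in> B" "ray d v j \<in> B" "\<bar>i - j\<bar> = 1"
proof -
  have "j - i = 1 \<or> j - i = -1" using that by auto
  then show ?thesis using that d by (auto simp: bonds_def ray_step) (auto simp: ray_def l1_norm_def)
qed

text \<open>
  Minkowski's inequality along the walk.
\<close>

lemma walk_norm_step:
  assumes "L2_set (\<lambda>q. F (q \<circ> along d (tag q) \<phi> \<circ> transpose (ray d (tag q) (int i)) (ray d (tag q) (int j)))
      - F (q \<circ> along d (tag q) \<phi>)) states \<le> c"
  shows "walk_norm (\<phi> \<circ> transpose i j) \<le> walk_norm \<phi> + c"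
proof -
  have eq: "(\<lambda>q. F (q \<circ> along d (tag q) (\<phi> \<circ> transpose i j)) - F q)
    = (\<lambda>q. (F (q \<circ> along d (tag q) \<phi> \<circ> transpose (ray d (tag q) (int i)) (ray d (tag q) (int j)))
      - F (q \<circ> along d (tag q) \<phi>)) + (F (q \<circ> along d (tag q) \<phi>) - F q))"
    by (simp add: along_comp[OF d] along_transpose[OF d] comp_assoc)
  show ?thesis unfolding walk_norm_def eq
    by (rule order_trans[OF L2_set_triangle_ineq]) (use assms in simp)
qed

lemma ray_inj_on: "inj_on (\<lambda>v. ray d v i) Y"
  by (simp add: inj_on_def ray_inj_base)

lemma walk_norm_untagged:
  assumes \<phi>: "\<phi> permutes {..m}" "\<phi> a = 0" and a: "a \<le> m" and c: "c \<ge> 0"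
    and h: "\<And>v. v \<in> starts \<Longrightarrow> swap_norm (ray d v (int a)) (ray d v (int i)) (ray d v (int j)) \<le> c * sqrt (energy_at (ray d v (int a)))"
  shows "walk_norm (\<phi> \<circ> transpose i j) \<le> walk_norm \<phi> + c * sqrt total_energy"
proof (rule walk_norm_step, rule untagged_step[where U = starts and r = "\<lambda>v. ray d v (int a)" and \<pi> = "\<lambda>v. along d v \<phi>"
      and x = "\<lambda>v. ray d v (int i)" and z = "\<lambda>v. ray d v (int j)"])
  show "along d v \<phi> permutes B" if "v \<in> starts" for v
    using that by (intro along_permutes[OF d \<phi>(1)]) (auto simp: starts_def)
qed (use states_P starts_B ray_inj_on c h a \<phi> in \<open>auto simp: states_def starts_def along_ray[OF d]\<close>)

lemma walk_norm_tagged: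
  assumes \<phi>: "\<phi> permutes {..m}" "\<phi> a = 0" "\<phi> b = m" and a: "a \<le> m" "b \<le> m" "\<bar>int a - int b\<bar> = 1"
  shows "walk_norm (\<phi> \<circ> transpose a b) \<le> walk_norm \<phi> + sqrt total_energy"
proof (rule walk_norm_step, rule tagged_step[where U = starts and r = "\<lambda>v. ray d v (int a)" and \<pi> = "\<lambda>v. along d v \<phi>"
      and z = "\<lambda>v. ray d v (int b)"])
  show "along d v \<phi> permutes B" if "v \<in> starts" for v
    using that by (intro along_permutes[OF d \<phi>(1)]) (auto simp: starts_def)
  show "(ray d v (int a), ray d v (int b)) \<in> bonds n" if "v \<in> starts" for v
    using that a by (intro ray_bond) (auto simp: starts_def)
qed (use states_P starts_B ray_inj_on a \<phi> in \<open>auto simp: states_def starts_def along_ray[OF d]\<close>)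

lemma walk_norm_untagged_bond:
  assumes \<phi>: "\<phi> permutes {..m}" "\<phi> a = 0" and a: "a \<le> m" "i \<le> m" "j \<le> m" "i \<noteq> a" "j \<noteq> a" "\<bar>int i - int j\<bar> = 1"
  shows "walk_norm (\<phi> \<circ> transpose i j) \<le> walk_norm \<phi> + sqrt total_energy"
proof -
  have "walk_norm (\<phi> \<circ> transpose i j) \<le> walk_norm \<phi> + 1 * sqrt total_energy"
  proof (rule walk_norm_untagged[OF \<phi> a(1)])
    fix v assume "v \<in> starts"
    then show "swap_norm (ray d v (int a)) (ray d v (int i)) (ray d v (int j)) \<le> 1 * sqrt (energy_at (ray d v (int a)))"
      using a swap_norm_bond[OF ray_bond[of v "int i" "int j"], of "ray d v (int a)"]
      by (auto simp: starts_def ray_eq_iff[OF d])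
  qed simp
  then show ?thesis by simp
qed

text \<open>
  The contents immediately behind and ahead of the tagged particle are exchanged through the
  path of five sites that passes beside it.
\<close>

lemma detour:
  assumes v: "v \<in> starts" and j: "Suc (Suc j) \<le> m"
  shows "swap_norm (ray d v (int (Suc j))) (ray d v (int j)) (ray d v (int (Suc (Suc j))))
    \<le> 8 * sqrt (energy_at (ray d v (int (Suc j))))"
proof -
  let ?u = "ray d v (int (Suc j))"
  define w where "w = ray d v (int j)"
  define s where "s = (\<lambda>i::nat. if i = 0 then w else if i = 1 then w + e else if i = 2 then ray d w 1 + e
     else if i = 3 then ray d w 2 + e else ray d w 2)"
  have u: "?u = ray d w 1" and y: "ray d v (int (Suc (Suc j))) = ray d w 2"
    by (simp_all add: w_def ray_ray ac_simps)
  have w: "w \<in> B" "w + e \<in> B" "ray d w 1 + e \<in> B" "ray d w 2 + e \<in> B" "ray d w 2 \<in> B" "ray d w 1 \<in> B"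
    using v j unfolding starts_def w_def ray_ray
    by (auto dest: spec[of _ j] spec[of _ "Suc j"] spec[of _ "Suc (Suc j)"] simp: add.commute)
  note de = l1_norm_1_cases[OF d] l1_norm_1_cases[OF e] orth
  have ne: "w \<noteq> ray d w 1" "w + e \<noteq> ray d w 1" "ray d w 1 + e \<noteq> ray d w 1" "ray d w 2 + e \<noteq> ray d w 1" "ray d w 2 \<noteq> ray d w 1"
    using de by (auto simp: ray_def prod_eq_iff)
  have bonds: "(w, w + e) \<in> bonds n" "(w + e, ray d w 1 + e) \<in> bonds n" "(ray d w 1 + e, ray d w 2 + e) \<in> bonds n"
    "(ray d w 2 + e, ray d w 2) \<in> bonds n"
    using w de by (auto simp: bonds_def ray_def l1_norm_def)
  \<comment> \<open>four bonds, each counted twice by the triangle inequality\<close>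
  have "swap_norm (ray d w 1) (s 0) (s 4) \<le> 2 * (\<Sum>l<4. swap_norm (ray d w 1) (s l) (s (Suc l)))"
    by (rule swap_norm_path) (use w ne in \<open>auto simp: s_def\<close>)
  also have "\<dots> \<le> 2 * (\<Sum>l<(4::nat). sqrt (energy_at (ray d w 1)))"
  proof (intro mult_left_mono sum_mono swap_norm_bond)
    fix l :: nat assume "l \<in> {..<4}"
    then have "l = 0 \<or> l = 1 \<or> l = 2 \<or> l = 3" by auto
    then show "(s l, s (Suc l)) \<in> bonds n" "s l \<noteq> ray d w 1" "s (Suc l) \<noteq> ray d w 1"
      using bonds ne by (auto simp: s_def)
  qed simp
  finally show ?thesis unfolding u y by (simp add: s_def w_def[symmetric])
qed

lemma transpose_permutes_index: "i \<le> m \<Longrightarrow> j \<le> m \<Longrightarrow> \<phi> permutes {..m} \<Longrightarrow> \<phi> \<circ> transpose i j permutes {..m}"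
  by (intro permutes_compose permutes_swap_id) auto

lemma walk_hole_in:
  "k < m \<Longrightarrow> hole_in m (m - k) permutes {..m} \<and> walk_norm (hole_in m (m - k)) \<le> k * sqrt total_energy"
proof (induction k)
  case 0
  then show ?case by (simp add: hole_in_start permutes_id walk_norm_def L2_set_def del: id_apply)
next
  case (Suc k)
  have k: "m - k = Suc (m - Suc k)" using Suc.prems by simp
  have eq: "hole_in m (m - Suc k) = hole_in m (m - k) \<circ> transpose (m - Suc k) (m - k)"
    using hole_in_step[of "m - Suc k" m] Suc.prems k by simp
  have IH: "hole_in m (m - k) permutes {..m}" "walk_norm (hole_in m (m - k)) \<le> k * sqrt total_energy"
    using Suc by auto
  have "walk_norm (hole_in m (m - Suc k)) \<le> walk_norm (hole_in m (m - k)) + sqrt total_energy"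
    unfolding eq by (rule walk_norm_untagged_bond[OF IH(1), of 0]) (use Suc.prems in \<open>auto simp: hole_in_def\<close>)
  with IH(2) have "walk_norm (hole_in m (m - Suc k)) \<le> Suc k * sqrt total_energy"
    by (simp add: algebra_simps)
  moreover have "hole_in m (m - Suc k) permutes {..m}"
    unfolding eq by (rule transpose_permutes_index[OF _ _ IH(1)]) auto
  ultimately show ?case by blast
qed

text \<open>
  Each advance consists of a jump into the hole ahead and of an exchange that moves the hole from
  behind the tagged particle to the place ahead of it: \<open>1 + 8 = 9\<close> units.
\<close>

lemma walk_pair:
  "Suc j \<le> m \<Longrightarrow> pair_at m j permutes {..m} \<and> walk_norm (pair_at m j) \<le> (m - 1 + 9 * j) * sqrt total_energy"
proof (induction j)
  case 0
  then show ?case using walk_hole_in[of "m - 1"] pair_at_start[of m] by simp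
next
  case (Suc j)
  have IH: "pair_at m j permutes {..m}" "walk_norm (pair_at m j) \<le> (m - 1 + 9 * j) * sqrt total_energy"
    using Suc by auto
  let ?\<psi> = "pair_at m j \<circ> transpose j (Suc j)"
  have \<psi>: "?\<psi> permutes {..m}" using Suc.prems by (intro transpose_permutes_index IH) auto
  have "walk_norm ?\<psi> \<le> walk_norm (pair_at m j) + sqrt total_energy"
    by (rule walk_norm_tagged[OF IH(1)]) (use Suc.prems in \<open>auto simp: pair_at_def\<close>)
  moreover have "walk_norm (?\<psi> \<circ> transpose j (Suc (Suc j))) \<le> walk_norm ?\<psi> + 8 * sqrt total_energy"
    by (rule walk_norm_untagged[OF \<psi>, of "Suc j"]) (use Suc.prems detour in \<open>auto simp: pair_at_def\<close>)
  ultimately have "walk_norm (pair_at m (Suc j)) \<le> (m - 1 + 9 * Suc j) * sqrt total_energy"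
    unfolding pair_at_step[OF Suc.prems] using IH(2) by (simp add: algebra_simps)
  moreover have "pair_at m (Suc j) permutes {..m}"
    unfolding pair_at_step[OF Suc.prems] by (rule transpose_permutes_index[OF _ _ \<psi>]) (use Suc.prems in auto)
  ultimately show ?case by blast
qed

lemma walk_hole_out:
  "k < m \<Longrightarrow> hole_out m (m - 1 - k) permutes {..m} \<and>
     walk_norm (hole_out m (m - 1 - k)) \<le> (10 * m + k) * sqrt total_energy"
proof (induction k)
  case 0
  have pp: "pair_at m (m - 1) permutes {..m}" "walk_norm (pair_at m (m - 1)) \<le> (m - 1 + 9 * (m - 1)) * sqrt total_energy"
    using walk_pair[of "m - 1"] 0 by auto
  have "walk_norm (hole_out m (m - 1)) \<le> walk_norm (pair_at m (m - 1)) + sqrt total_energy"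
    unfolding hole_out_start[OF Suc_leI[OF 0, folded One_nat_def]]
    by (rule walk_norm_tagged[OF pp(1)]) (use 0 in \<open>auto simp: pair_at_def\<close>)
  also have "\<dots> \<le> (real (m - 1 + 9 * (m - 1)) + 1) * sqrt total_energy"
    using pp by (simp add: distrib_right)
  also have "\<dots> \<le> (10 * m + 0) * sqrt total_energy"
    using 0 total_energy_nonneg by (intro mult_right_mono) (auto simp: of_nat_diff)
  finally have "walk_norm (hole_out m (m - 1)) \<le> (10 * m + 0) * sqrt total_energy" .
  moreover have "hole_out m (m - 1) permutes {..m}"
    unfolding hole_out_start[OF Suc_leI[OF 0, folded One_nat_def]]
    by (rule transpose_permutes_index[OF _ _ pp(1)]) auto
  ultimately show ?case by simp
next
  case (Suc k)
  have k: "m - 1 - k = Suc (m - 1 - Suc k)" using Suc.prems by simp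
  have eq: "hole_out m (m - 1 - Suc k) = hole_out m (m - 1 - k) \<circ> transpose (m - 1 - Suc k) (m - 1 - k)"
    using hole_out_step[of "m - 1 - Suc k" m] Suc.prems unfolding k by simp
  have IH: "hole_out m (m - 1 - k) permutes {..m}" "walk_norm (hole_out m (m - 1 - k)) \<le> (10 * m + k) * sqrt total_energy"
    using Suc by auto
  have "walk_norm (hole_out m (m - 1 - Suc k)) \<le> walk_norm (hole_out m (m - 1 - k)) + sqrt total_energy"
    unfolding eq by (rule walk_norm_untagged_bond[OF IH(1), of m]) (use Suc.prems in \<open>auto simp: hole_out_def\<close>)
  with IH(2) have "walk_norm (hole_out m (m - 1 - Suc k)) \<le> (10 * m + Suc k) * sqrt total_energy"
    by (simp add: algebra_simps)
  moreover have "hole_out m (m - 1 - Suc k) permutes {..m}"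
    unfolding eq by (rule transpose_permutes_index[OF _ _ IH(1)]) auto
  ultimately show ?case by blast
qed

text \<open>
  Bringing the hole costs \<open>m - 1\<close> steps, the \<open>m - 1\<close> advances cost 9 each, then there is one last jump, and the return of
  the hole costs \<open>m - 1\<close> again.
\<close>

lemma walk_total:
  assumes m: "1 \<le> m"
  shows "L2_set (\<lambda>q. F (q \<circ> transpose (tag q) (ray d (tag q) (int m))) - F q) states \<le> 11 * m * sqrt total_energy"
proof -
  have "walk_norm (hole_out m 0) \<le> (10 * m + (m - 1)) * sqrt total_energy"
    using walk_hole_out[of "m - 1"] m by simp
  also have "\<dots> \<le> 11 * m * sqrt total_energy"
    using total_energy_nonneg by (intro mult_right_mono) auto
  finally show ?thesis
    by (simp add: walk_norm_def hole_out_end[OF m] along_transpose[OF d])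
qed

end

section \<open>The spectral gap of the tagged particle\<close>

lemma L2_set_Un_le:
  assumes "finite X" "finite Y" shows "L2_set f (X \<union> Y) \<le> L2_set f X + L2_set f Y"
proof -
  have "(\<Sum>i\<in>X \<union> Y. (f i)\<^sup>2) \<le> (\<Sum>i\<in>X. (f i)\<^sup>2) + (\<Sum>i\<in>Y. (f i)\<^sup>2)"
    using assms sum.union_inter[of X Y "\<lambda>i. (f i)\<^sup>2"] sum_nonneg[of "X \<inter> Y" "\<lambda>i. (f i)\<^sup>2"] by simp
  then have "L2_set f (X \<union> Y) \<le> sqrt ((\<Sum>i\<in>X. (f i)\<^sup>2) + (\<Sum>i\<in>Y. (f i)\<^sup>2))"
    unfolding L2_set_def by (rule real_sqrt_le_mono)
  also have "\<dots> \<le> L2_set f X + L2_set f Y"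
    unfolding L2_set_def by (intro sqrt_add_le_add_sqrt sum_nonneg) auto
  finally show ?thesis .
qed

lemma L2_set_subset_le: "finite Y \<Longrightarrow> X \<subseteq> Y \<Longrightarrow> L2_set f X \<le> L2_set f Y"
  by (auto simp: L2_set_def intro: real_sqrt_le_mono sum_mono2)

context tagged_exclusion
begin

text \<open>
  Square roots of the squared bound \<open>swap_norm_le\<close>: \<open>91\<^sup>2\<close> exceeds 8192, and \<open>n \<le> n\<^sup>2\<close>.
\<close>

lemma untagged_swap:
  assumes "x \<in> B - {u}" "y \<in> B - {u}"
  shows "swap_norm u x y \<le> 91 * n * sqrt (energy_at u)"
proof -
  have "8192 * n * energy_at u \<le> (91 * real n)\<^sup>2 * energy_at u"
    using n energy_at_nonneg[of u] by (intro mult_right_mono) (auto simp: power2_eq_square)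
  then have "(swap_norm u x y)\<^sup>2 \<le> (91 * n * sqrt (energy_at u))\<^sup>2"
    using swap_norm_le[OF assms] energy_at_nonneg[of u] by (simp add: power_mult_distrib)
  then show ?thesis by (rule power2_le_imp_le) (simp add: energy_at_nonneg)
qed

text \<open>
  The parallel line beside the walk has to lie in the square, and at least one of the two does.
\<close>

lemma hole_move_line:
  assumes d: "l1_norm d = 1" and m: "1 \<le> m"
  shows "L2_set (\<lambda>q. F (q \<circ> transpose (tag q) (ray d (tag q) (int m))) - F q)
    {q \<in> perms. ray d (tag q) (int m) \<in> B \<and> q (ray d (tag q) (int m)) \<notin> A} \<le> 22 * m * sqrt total_energy"
    (is "L2_set ?f ?X \<le> _")
proof -
  define e :: site where "e = (snd d, fst d)"
  note dc = l1_norm_1_cases[OF d]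
  interpret w1: tagged_walk n A t F d e m
    by unfold_locales (use d dc in \<open>auto simp: e_def l1_norm_def\<close>)
  interpret w2: tagged_walk n A t F d "- e" m
    by unfold_locales (use d dc in \<open>auto simp: e_def l1_norm_def\<close>)
  have "?X \<subseteq> w1.states \<union> w2.states"
  proof
    fix q assume q: "q \<in> ?X"
    let ?v = "tag q"
    have v: "?v \<in> B" "ray d ?v (int m) \<in> B" using q tag_in_B by auto
    have "ray d ?v (int i) \<in> B" if "i \<le> m" for i
      using v dc that by (auto simp: square_def ray_def)
    moreover have "(\<forall>i\<le>m. ray d ?v (int i) + e \<in> B) \<or> (\<forall>i\<le>m. ray d ?v (int i) + - e \<in> B)"
      using v dc n by (auto simp: square_def ray_def e_def)
    ultimately show "q \<in> w1.states \<union> w2.states" using q by (auto simp: w1.states_def w2.states_def w1.starts_def w2.starts_def)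
  qed
  then have "L2_set ?f ?X \<le> L2_set ?f (w1.states \<union> w2.states)"
    using w1.states_P w2.states_P by (intro L2_set_subset_le) (auto intro: finite_subset[OF _ finite_perms])
  also have "\<dots> \<le> L2_set ?f w1.states + L2_set ?f w2.states"
    using w1.states_P w2.states_P by (intro L2_set_Un_le) (auto intro: finite_subset[OF _ finite_perms])
  also have "\<dots> \<le> 22 * m * sqrt total_energy"
    using w1.walk_total[OF m] w2.walk_total[OF m] by simp
  finally show ?thesis by simp
qed

definition axis :: "site \<Rightarrow> bool" where
  "axis \<delta> \<longleftrightarrow> (fst \<delta> = 0 \<or> snd \<delta> = 0) \<and> \<delta> \<noteq> 0 \<and> l1_norm \<delta> \<le> 2 * int n"

lemma hole_move:
  assumes "axis \<delta>"
  shows "L2_set (\<lambda>q. F (q \<circ> transpose (tag q) (tag q + \<delta>)) - F q)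
    {q \<in> perms. tag q + \<delta> \<in> B \<and> q (tag q + \<delta>) \<notin> A} \<le> 44 * n * sqrt total_energy"
proof -
  define d :: site where "d = (sgn (fst \<delta>), sgn (snd \<delta>))"
  define m where "m = nat (l1_norm \<delta>)"
  have c: "(fst \<delta> = 0 \<and> snd \<delta> \<noteq> 0) \<or> (snd \<delta> = 0 \<and> fst \<delta> \<noteq> 0)"
    using assms by (auto simp: axis_def prod_eq_iff)
  then have d: "l1_norm d = 1" by (auto simp: d_def l1_norm_def sgn_if)
  have "l1_norm \<delta> \<ge> 1" using c by (auto simp: l1_norm_def)
  then have m: "1 \<le> m" "m \<le> 2 * n" and im: "int m = l1_norm \<delta>"
    using assms by (auto simp: m_def axis_def nat_le_iff)
  have eq: "ray d v (int m) = v + \<delta>" for v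
    unfolding im using c by (auto simp: ray_def d_def l1_norm_def abs_mult_sgn prod_eq_iff)
  have "22 * m * sqrt total_energy \<le> 44 * n * sqrt total_energy"
    using m total_energy_nonneg by (intro mult_right_mono) auto
  then show ?thesis using hole_move_line[OF d m(1)] by (simp add: eq)
qed

lemma transpose_3cycle:
  assumes "w \<noteq> s" "w \<noteq> v" "s \<noteq> v"
  shows "transpose w s \<circ> transpose v s \<circ> transpose w v = transpose v s"
  using assms by (auto simp: fun_eq_iff Transposition.transpose_def)

text \<open>
  If the target does not hold a hole, one is borrowed from \<open>w\<close>: exchange \<open>w\<close> with the target, jump,
  and exchange \<open>w\<close> with the site that the tagged particle has left. The tagged particle takes part only in the
  second of these swaps. The costs are \<open>91 + 44 + 91\<close> units, and 44 for the arrangements with \<open>w\<close> itself as the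
  target.
\<close>

lemma move_helped_by:
  assumes \<delta>: "axis \<delta>" and w: "w \<in> B"
  shows "L2_set (\<lambda>q. F (q \<circ> transpose (tag q) (tag q + \<delta>)) - F q)
    {q \<in> perms. tag q + \<delta> \<in> B \<and> q w \<notin> A} \<le> 280 * n * sqrt total_energy"
    (is "L2_set ?f ?Z \<le> _")
proof -
  define U where "U = {v \<in> B. v + \<delta> \<in> B \<and> w \<noteq> v \<and> w \<noteq> v + \<delta>}"
  define X where "X = {q \<in> perms. tag q \<in> U \<and> q w \<notin> A}"
  let ?Y = "{q \<in> perms. tag q + \<delta> \<in> B \<and> q (tag q + \<delta>) \<notin> A}"
  have \<delta>0: "v + \<delta> \<noteq> v" for v using \<delta> by (simp add: axis_def)
  have XP: "X \<subseteq> perms" by (auto simp: X_def)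
  have U: "U \<subseteq> B" by (auto simp: U_def)
  have tagw: "tag q \<noteq> w" if "q \<in> perms" "q w \<notin> A" for q using that t q_tag[of q] by auto
  have sub: "?Z \<subseteq> X \<union> ?Y" using tagw tag_in_B by (auto simp: X_def U_def)
  let ?a = "\<lambda>v. transpose w (v + \<delta>)" and ?b = "\<lambda>v. transpose v (v + \<delta>)" and ?c = "\<lambda>v. transpose w v"
  have 1: "L2_set (\<lambda>q. F (q \<circ> ?a (tag q)) - F q) X \<le> 91 * n * sqrt total_energy"
  proof -
    have "L2_set (\<lambda>q. F (q \<circ> id \<circ> ?a (tag q)) - F (q \<circ> id)) X \<le> 91 * n * sqrt total_energy"
    proof (rule untagged_step[where X = X and U = U and r = "\<lambda>v. v" and \<pi> = "\<lambda>v. id" and x = "\<lambda>v. w"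
        and z = "\<lambda>v. v + \<delta>" and c = "91 * n"])
      fix v assume v: "v \<in> U"
      show "swap_norm v w (v + \<delta>) \<le> 91 * n * sqrt (energy_at v)"
        using v w \<delta>0[of v] by (intro untagged_swap) (auto simp: U_def)
    qed (use XP U in \<open>auto simp: X_def permutes_id\<close>)
    then show ?thesis by (simp only: comp_id)
  qed
  have g: "q \<circ> ?a (tag q) \<in> perms" "tag (q \<circ> ?a (tag q)) = tag q" if "q \<in> X" for q
    using that w tag_swap[of q "?a (tag q)" "tag q"] \<delta>0[of "tag q"]
    by (auto simp: X_def U_def permutes_swap_id)
  have 2: "L2_set (\<lambda>q. F (q \<circ> ?a (tag q) \<circ> ?b (tag q)) - F (q \<circ> ?a (tag q))) X \<le> 44 * n * sqrt total_energy"
  proof -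
    have "L2_set (\<lambda>q. F (q \<circ> ?a (tag q) \<circ> ?b (tag q)) - F (q \<circ> ?a (tag q))) X
       = L2_set (\<lambda>q. ?f (q \<circ> ?a (tag q))) X"
      by (rule L2_set_cong) (simp_all add: g)
    also have "\<dots> \<le> L2_set ?f ?Y"
    proof (rule L2_set_inj_le)
      show "inj_on (\<lambda>q. q \<circ> ?a (tag q)) X"
      proof (rule inj_on_inverseI[of _ "\<lambda>q. q \<circ> ?a (tag q)"])
        fix q assume "q \<in> X"
        then show "q \<circ> ?a (tag q) \<circ> ?a (tag (q \<circ> ?a (tag q))) = q" by (simp add: g comp_assoc)
      qed
      show "q \<circ> ?a (tag q) \<in> ?Y" if "q \<in> X" for q
        using that by (simp only: mem_Collect_eq g[OF that] comp_apply transpose_apply_second)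
          (auto simp: X_def U_def)
    qed simp
    also have "\<dots> \<le> 44 * n * sqrt total_energy" by (rule hole_move[OF \<delta>])
    finally show ?thesis .
  qed
  have 3: "L2_set (\<lambda>q. F (q \<circ> (?a (tag q) \<circ> ?b (tag q)) \<circ> ?c (tag q)) - F (q \<circ> (?a (tag q) \<circ> ?b (tag q)))) X
      \<le> 91 * n * sqrt total_energy"
  proof (rule untagged_step[where X = X and U = U and r = "\<lambda>v. v + \<delta>" and \<pi> = "\<lambda>v. ?a v \<circ> ?b v" and x = "\<lambda>v. w"
        and z = "\<lambda>v. v" and c = "91 * n"])
    fix v assume v: "v \<in> U"
    show "?a v \<circ> ?b v permutes B" using v w by (intro permutes_compose permutes_swap_id) (auto simp: U_def)
    show "(?a v \<circ> ?b v) (v + \<delta>) = v"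
      using v \<delta>0[of v] by (auto simp: U_def Transposition.transpose_def)
    show "swap_norm (v + \<delta>) w v \<le> 91 * n * sqrt (energy_at (v + \<delta>))"
      using v w \<delta>0[of v] by (intro untagged_swap) (auto simp: U_def)
  qed (use XP U in \<open>auto simp: X_def U_def inj_on_def\<close>)
  have eq: "q \<circ> ?b (tag q) = q \<circ> (?a (tag q) \<circ> ?b (tag q)) \<circ> ?c (tag q)" if "q \<in> X" for q
    using that transpose_3cycle[of w "tag q + \<delta>" "tag q"] \<delta>0[of "tag q"] by (simp add: X_def U_def comp_assoc)
  have "L2_set ?f X = L2_set (\<lambda>q. (F (q \<circ> (?a (tag q) \<circ> ?b (tag q)) \<circ> ?c (tag q)) - F (q \<circ> (?a (tag q) \<circ> ?b (tag q))))
    + (F (q \<circ> ?a (tag q) \<circ> ?b (tag q)) - F (q \<circ> ?a (tag q))) + (F (q \<circ> ?a (tag q)) - F q)) X"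
    by (rule L2_set_cong) (simp_all add: eq comp_assoc[symmetric])
  also have "\<dots> \<le> 226 * n * sqrt total_energy"
    by (rule order_trans[OF L2_set_triangle3]) (use 1 2 3 in simp)
  finally have X: "L2_set ?f X \<le> 226 * n * sqrt total_energy" .
  have "L2_set ?f ?Z \<le> L2_set ?f (X \<union> ?Y)"
    using sub XP by (intro L2_set_subset_le) (auto intro: finite_subset[OF _ finite_perms])
  also have "\<dots> \<le> L2_set ?f X + L2_set ?f ?Y"
    using XP by (intro L2_set_Un_le) (auto intro: finite_subset[OF _ finite_perms])
  also have "\<dots> \<le> 226 * n * sqrt total_energy + 44 * n * sqrt total_energy"
    using X hole_move[OF \<delta>] by linarith
  also have "\<dots> = 270 * (n * sqrt total_energy)" by simp
  also have "\<dots> \<le> 280 * (n * sqrt total_energy)"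
    using total_energy_nonneg by (intro mult_right_mono) auto
  finally show ?thesis by simp
qed

text \<open>
  The price of borrowing a hole; the number of particles enters the bounds through this quotient
  alone.
\<close>

definition sites_per_hole :: real where "sites_per_hole = card B / (real (card B) - card A)"

lemma card_holes:
  assumes "q \<in> perms" shows "real (card {w \<in> B. q w \<notin> A}) = real (card B) - card A"
proof -
  have q: "q permutes B" using assms by (simp add: perms_def)
  have "{w \<in> B. q w \<notin> A} = inv q ` (B - A)"
  proof (intro set_eqI iffI)
    fix w assume "w \<in> {w \<in> B. q w \<notin> A}"
    then show "w \<in> inv q ` (B - A)"
      using permutes_in_image[OF q, of w] by (intro image_eqI[of _ _ "q w"]) (auto simp: permutes_inverses[OF q])
  next
    fix w assume "w \<in> inv q ` (B - A)"
    then show "w \<in> {w \<in> B. q w \<notin> A}"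
      using permutes_in_image[OF permutes_inv[OF q]] by (auto simp: permutes_inverses[OF q])
  qed
  then have "card {w \<in> B. q w \<notin> A} = card (B - A)"
    using permutes_inj[OF permutes_inv[OF q]] by (simp add: card_image inj_on_subset)
  then show ?thesis using A by (simp add: card_Diff_subset finite_subset card_mono of_nat_diff)
qed

text \<open>
  The hole that helps is averaged over all holes. A fixed site \<open>w\<close> costs the full Dirichlet form,
  so the sum over all sites, divided by the number of holes, costs \<open>sites_per_hole\<close> times as much.
\<close>

lemma axis_move:
  assumes \<delta>: "axis \<delta>" and hole: "card A < card B"
  shows "L2_set (\<lambda>q. F (q \<circ> transpose (tag q) (tag q + \<delta>)) - F q) {q \<in> perms. tag q + \<delta> \<in> B}
    \<le> 280 * n * sqrt sites_per_hole * sqrt total_energy"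
proof -
  let ?h = "real (card B) - card A" and ?c = "280 * n * sqrt total_energy"
  let ?g = "\<lambda>q. (F (q \<circ> transpose (tag q) (tag q + \<delta>)) - F q)\<^sup>2" and ?X = "{q \<in> perms. tag q + \<delta> \<in> B}"
  have h: "?h > 0" using hole by simp
  have "?h * (\<Sum>q\<in>?X. ?g q) = (\<Sum>q\<in>?X. \<Sum>w | w \<in> B \<and> q w \<notin> A. ?g q)"
    using card_holes by (simp add: sum_distrib_left)
  also have "\<dots> = (\<Sum>w\<in>B. \<Sum>q | q \<in> ?X \<and> q w \<notin> A. ?g q)"
    by (rule sum.swap_restrict) auto
  also have "\<dots> \<le> (\<Sum>w\<in>B. ?c\<^sup>2)"
  proof (rule sum_mono)
    fix w assume w: "w \<in> B"
    have "(L2_set (\<lambda>q. F (q \<circ> transpose (tag q) (tag q + \<delta>)) - F q) {q \<in> perms. tag q + \<delta> \<in> B \<and> q w \<notin> A})\<^sup>2 \<le> ?c\<^sup>2"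
      by (rule power_mono[OF move_helped_by[OF \<delta> w]]) simp
    then show "(\<Sum>q | q \<in> ?X \<and> q w \<notin> A. ?g q) \<le> ?c\<^sup>2" by (simp add: L2_set_square conj_assoc)
  qed
  finally have "(\<Sum>q\<in>?X. ?g q) \<le> sites_per_hole * ?c\<^sup>2"
    using h by (simp add: sites_per_hole_def field_simps)
  then have "sqrt (\<Sum>q\<in>?X. ?g q) \<le> sqrt (sites_per_hole * ?c\<^sup>2)" by (rule real_sqrt_le_mono)
  also have "\<dots> = 280 * n * sqrt sites_per_hole * sqrt total_energy"
    using total_energy_nonneg by (simp add: real_sqrt_mult)
  finally show ?thesis by (simp add: L2_set_def)
qed

lemma sites_per_hole_ge_1: "card A < card B \<Longrightarrow> sites_per_hole \<ge> 1"
  by (simp add: sites_per_hole_def field_simps)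

text \<open>
  The tagged particle turns once, at the corner \<open>tag q + d1\<close>. When it has arrived, the contents
  of its starting point and of the corner have to be exchanged to obtain a plain transposition. This adds
  up to \<open>280 + 280 + 91\<close>.
\<close>

lemma any_move:
  assumes \<delta>: "\<bar>fst \<delta>\<bar> \<le> 2 * int n" "\<bar>snd \<delta>\<bar> \<le> 2 * int n" and hole: "card A < card B"
  shows "L2_set (\<lambda>q. F (q \<circ> transpose (tag q) (tag q + \<delta>)) - F q) {q \<in> perms. tag q + \<delta> \<in> B}
    \<le> 651 * n * sqrt sites_per_hole * sqrt total_energy" (is "L2_set ?f ?X \<le> _")
proof -
  have r1: "sqrt sites_per_hole \<ge> 1" using sites_per_hole_ge_1[OF hole] by simp
  have nn: "0 \<le> n * sqrt sites_per_hole * sqrt total_energy" using r1 total_energy_nonneg by auto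
  consider "\<delta> = 0" | "axis \<delta>" | "fst \<delta> \<noteq> 0" "snd \<delta> \<noteq> 0"
    using \<delta> by (cases "fst \<delta> = 0"; cases "snd \<delta> = 0") (auto simp: axis_def l1_norm_def prod_eq_iff)
  then show ?thesis
  proof cases
    case 1
    then have "L2_set ?f ?X = 0" by (simp add: L2_set_def)
    with nn show ?thesis by simp
  next
    case 2
    then show ?thesis using axis_move[OF 2 hole] nn by simp
  next
    case 3
    define d1 d2 :: site where "d1 = (fst \<delta>, 0)" and "d2 = (0, snd \<delta>)"
    have ax: "axis d1" "axis d2" using 3 \<delta> by (auto simp: d1_def d2_def axis_def l1_norm_def zero_prod_def)
    have sum: "v + \<delta> = v + d1 + d2" for v by (simp add: d1_def d2_def prod_eq_iff)
    have ne: "v \<noteq> v + d1" "v + d1 \<noteq> v + d1 + d2" "v \<noteq> v + d1 + d2" for v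
      using 3 by (auto simp: d1_def d2_def prod_eq_iff)
    define U where "U = {v \<in> B. v + \<delta> \<in> B}"
    have corner: "v + d1 \<in> B" "v + d1 + d2 \<in> B" if "v \<in> U" for v
      using that by (cases v; cases \<delta>; auto simp: U_def d1_def d2_def square_def)+
    have XU: "tag q \<in> U" if "q \<in> ?X" for q using that tag_in_B by (simp add: U_def)
    let ?a = "\<lambda>v. transpose v (v + d1)" and ?b = "\<lambda>v. transpose (v + d1) (v + d1 + d2)"
    have 1: "L2_set (\<lambda>q. F (q \<circ> ?a (tag q)) - F q) ?X \<le> 280 * n * sqrt sites_per_hole * sqrt total_energy"
    proof (rule order_trans[OF L2_set_subset_le axis_move[OF ax(1) hole]])
      show "?X \<subseteq> {q \<in> perms. tag q + d1 \<in> B}" using corner(1)[OF XU] by blast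
    qed simp
    have g: "q \<circ> ?a (tag q) \<in> perms" "tag (q \<circ> ?a (tag q)) = tag q + d1" if "q \<in> ?X" for q
      using tag_swap[of q "?a (tag q)" "tag q + d1"] that corner(1)[OF XU[OF that]] tag_in_B
      by (auto simp: permutes_swap_id)
    have 2: "L2_set (\<lambda>q. F (q \<circ> ?a (tag q) \<circ> ?b (tag q)) - F (q \<circ> ?a (tag q))) ?X \<le> 280 * n * sqrt sites_per_hole * sqrt total_energy"
    proof -
      have "L2_set (\<lambda>q. F (q \<circ> ?a (tag q) \<circ> ?b (tag q)) - F (q \<circ> ?a (tag q))) ?X
         = L2_set (\<lambda>q. (\<lambda>q. F (q \<circ> transpose (tag q) (tag q + d2)) - F q) (q \<circ> ?a (tag q))) ?X"
        by (rule L2_set_cong[OF refl]) (simp only: g)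
      also have "\<dots> \<le> L2_set (\<lambda>q. F (q \<circ> transpose (tag q) (tag q + d2)) - F q) {q \<in> perms. tag q + d2 \<in> B}"
      proof (rule L2_set_inj_le)
        show "inj_on (\<lambda>q. q \<circ> ?a (tag q)) ?X"
        proof (rule inj_on_inverseI[of _ "\<lambda>q. q \<circ> ?a (tag q - d1)"])
          fix q assume "q \<in> ?X"
          then show "q \<circ> ?a (tag q) \<circ> ?a (tag (q \<circ> ?a (tag q)) - d1) = q" by (simp only: g) (simp add: comp_assoc)
        qed
        show "q \<circ> ?a (tag q) \<in> {q \<in> perms. tag q + d2 \<in> B}" if "q \<in> ?X" for q
          using g[OF that] corner(2)[OF XU[OF that]] by simp
      qed simp
      also have "\<dots> \<le> 280 * n * sqrt sites_per_hole * sqrt total_energy" by (rule axis_move[OF ax(2) hole])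
      finally show ?thesis .
    qed
    have 3: "L2_set (\<lambda>q. F (q \<circ> (?a (tag q) \<circ> ?b (tag q)) \<circ> ?a (tag q)) - F (q \<circ> (?a (tag q) \<circ> ?b (tag q)))) ?X
        \<le> 91 * n * sqrt total_energy"
    proof (rule untagged_step[where X = ?X and U = U and r = "\<lambda>v. v + d1 + d2" and \<pi> = "\<lambda>v. ?a v \<circ> ?b v" and x = "\<lambda>v. v"
          and z = "\<lambda>v. v + d1" and c = "91 * n"])
      fix v assume v: "v \<in> U"
      then have vB: "v \<in> B" by (simp add: U_def)
      show "?a v \<circ> ?b v permutes B" using corner[OF v] vB by (intro permutes_compose permutes_swap_id) auto
      show "(?a v \<circ> ?b v) (v + d1 + d2) = v" by simp
      show "swap_norm (v + d1 + d2) v (v + d1) \<le> 91 * n * sqrt (energy_at (v + d1 + d2))"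
        using corner[OF v] vB ne[of v] by (intro untagged_swap) auto
    qed (use XU corner in \<open>auto simp: U_def inj_on_def\<close>)
    have eq: "q \<circ> transpose (tag q) (tag q + \<delta>) = q \<circ> (?a (tag q) \<circ> ?b (tag q)) \<circ> ?a (tag q)" for q
      using transpose_conjugate[OF ne(1) ne(2) ne(3), of "tag q"] by (simp only: sum comp_assoc)
    have "L2_set ?f ?X = L2_set (\<lambda>q. (F (q \<circ> (?a (tag q) \<circ> ?b (tag q)) \<circ> ?a (tag q)) - F (q \<circ> (?a (tag q) \<circ> ?b (tag q))))
      + (F (q \<circ> ?a (tag q) \<circ> ?b (tag q)) - F (q \<circ> ?a (tag q))) + (F (q \<circ> ?a (tag q)) - F q)) ?X"
      unfolding eq by (simp add: comp_assoc[symmetric])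
    also have "\<dots> \<le> 91 * n * sqrt total_energy + 280 * n * sqrt sites_per_hole * sqrt total_energy + 280 * n * sqrt sites_per_hole * sqrt total_energy"
      by (rule order_trans[OF L2_set_triangle3]) (intro add_mono 1 2 3)
    also have "91 * n * sqrt total_energy \<le> 91 * n * sqrt sites_per_hole * sqrt total_energy"
      using r1 total_energy_nonneg mult_left_mono[OF r1, of "91 * real n"] by (intro mult_right_mono) auto
    finally show ?thesis by simp
  qed
qed

text \<open>
  Summing over displacements instead of targets makes each term an instance of the previous bound;
  there are at most four times as many displacements as sites.
\<close>

lemma sum_tagged_moves:
  assumes hole: "card A < card B"
  shows "(\<Sum>q\<in>perms. \<Sum>y\<in>B. (F (q \<circ> transpose (tag q) y) - F q)\<^sup>2)
    \<le> 4 * card B * (651 * n * sqrt sites_per_hole * sqrt total_energy)\<^sup>2"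
proof -
  define D where "D = {- 2 * int n..2 * int n} \<times> {- 2 * int n..2 * int n}"
  have finD: "finite D" by (simp add: D_def)
  have cD: "real (card D) \<le> 4 * card B"
    by (simp add: D_def card_cartesian_product card_square power2_eq_square nat_add_distrib algebra_simps)
  have "(\<Sum>y\<in>B. (F (q \<circ> transpose (tag q) y) - F q)\<^sup>2)
      = (\<Sum>\<delta> | \<delta> \<in> D \<and> tag q + \<delta> \<in> B. (F (q \<circ> transpose (tag q) (tag q + \<delta>)) - F q)\<^sup>2)" if "q \<in> perms" for q
    by (rule sum.reindex_bij_witness[where i = "\<lambda>\<delta>. tag q + \<delta>" and j = "\<lambda>y. y - tag q"])
       (use tag_in_B[OF that] in \<open>auto simp: D_def square_def\<close>)
  then have "(\<Sum>q\<in>perms. \<Sum>y\<in>B. (F (q \<circ> transpose (tag q) y) - F q)\<^sup>2)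
     = (\<Sum>q\<in>perms. \<Sum>\<delta> | \<delta> \<in> D \<and> tag q + \<delta> \<in> B. (F (q \<circ> transpose (tag q) (tag q + \<delta>)) - F q)\<^sup>2)"
    by (rule sum.cong[OF refl])
  also have "\<dots> = (\<Sum>\<delta>\<in>D. \<Sum>q | q \<in> perms \<and> tag q + \<delta> \<in> B. (F (q \<circ> transpose (tag q) (tag q + \<delta>)) - F q)\<^sup>2)"
    by (rule sum.swap_restrict) (auto simp: finD)
  also have "\<dots> \<le> (\<Sum>\<delta>\<in>D. (651 * n * sqrt sites_per_hole * sqrt total_energy)\<^sup>2)"
  proof (rule sum_mono)
    fix \<delta> assume "\<delta> \<in> D"
    then have "\<bar>fst \<delta>\<bar> \<le> 2 * int n" "\<bar>snd \<delta>\<bar> \<le> 2 * int n" by (auto simp: D_def)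
    from power_mono[OF any_move[OF this hole], of 2]
    show "(\<Sum>q | q \<in> perms \<and> tag q + \<delta> \<in> B. (F (q \<circ> transpose (tag q) (tag q + \<delta>)) - F q)\<^sup>2)
      \<le> (651 * n * sqrt sites_per_hole * sqrt total_energy)\<^sup>2"
      by (simp add: L2_set_square)
  qed
  also have "\<dots> = card D * (651 * n * sqrt sites_per_hole * sqrt total_energy)\<^sup>2" by simp
  also have "\<dots> \<le> 4 * card B * (651 * n * sqrt sites_per_hole * sqrt total_energy)\<^sup>2"
    by (rule mult_right_mono[OF cD]) simp
  finally show ?thesis .
qed

lemma sum_all_swaps:
  "(\<Sum>x\<in>B. \<Sum>y\<in>B. swap_energy B F x y)
    \<le> 2 * (\<Sum>q\<in>perms. \<Sum>y\<in>B. (F (q \<circ> transpose (tag q) y) - F q)\<^sup>2)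
     + (\<Sum>u\<in>B. \<Sum>x\<in>B - {u}. \<Sum>y\<in>B - {u}. (swap_norm u x y)\<^sup>2)"
proof -
  let ?g = "\<lambda>q x y. (F (q \<circ> transpose x y) - F q)\<^sup>2"
  have one: "(\<Sum>x\<in>B. \<Sum>y\<in>B. ?g q x y) \<le> 2 * (\<Sum>y\<in>B. ?g q (tag q) y) + (\<Sum>x\<in>B - {tag q}. \<Sum>y\<in>B - {tag q}. ?g q x y)"
    if "q \<in> perms" for q
  proof -
    let ?u = "tag q"
    have u: "?u \<in> B" using tag_in_B that by simp
    have "(\<Sum>x\<in>B. \<Sum>y\<in>B. ?g q x y) = (\<Sum>y\<in>B. ?g q ?u y) + (\<Sum>x\<in>B - {?u}. \<Sum>y\<in>B. ?g q x y)"
      by (rule sum.remove[OF _ u]) simp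
    also have "(\<Sum>x\<in>B - {?u}. \<Sum>y\<in>B. ?g q x y) = (\<Sum>x\<in>B - {?u}. ?g q x ?u + (\<Sum>y\<in>B - {?u}. ?g q x y))"
      by (rule sum.cong[OF refl], rule sum.remove[OF _ u]) simp
    also have "\<dots> = (\<Sum>x\<in>B - {?u}. ?g q ?u x) + (\<Sum>x\<in>B - {?u}. \<Sum>y\<in>B - {?u}. ?g q x y)"
      by (simp add: sum.distrib transpose_commute)
    also have "(\<Sum>x\<in>B - {?u}. ?g q ?u x) \<le> (\<Sum>x\<in>B. ?g q ?u x)"
      by (rule sum_mono2) auto
    finally show ?thesis by linarith
  qed
  have "(\<Sum>x\<in>B. \<Sum>y\<in>B. swap_energy B F x y) = (\<Sum>q\<in>perms. \<Sum>x\<in>B. \<Sum>y\<in>B. ?g q x y)"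
    unfolding swap_energy_def perms_def[symmetric] by (rule sum_swap3[symmetric])
  also have "\<dots> \<le> (\<Sum>q\<in>perms. 2 * (\<Sum>y\<in>B. ?g q (tag q) y) + (\<Sum>x\<in>B - {tag q}. \<Sum>y\<in>B - {tag q}. ?g q x y))"
    by (intro sum_mono one)
  also have "\<dots> = 2 * (\<Sum>q\<in>perms. \<Sum>y\<in>B. ?g q (tag q) y) + (\<Sum>q\<in>perms. \<Sum>x\<in>B - {tag q}. \<Sum>y\<in>B - {tag q}. ?g q x y)"
    by (simp add: sum.distrib sum_distrib_left)
  also have "(\<Sum>q\<in>perms. \<Sum>x\<in>B - {tag q}. \<Sum>y\<in>B - {tag q}. ?g q x y)
     = (\<Sum>u\<in>B. \<Sum>q | q \<in> perms \<and> tag q = u. \<Sum>x\<in>B - {tag q}. \<Sum>y\<in>B - {tag q}. ?g q x y)"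
    by (rule sum.group[symmetric]) (auto simp: tag_in_B)
  also have "\<dots> = (\<Sum>u\<in>B. \<Sum>q\<in>tag_at u. \<Sum>x\<in>B - {u}. \<Sum>y\<in>B - {u}. ?g q x y)"
    by (intro sum.cong refl) (auto simp: tag_at_eq)
  also have "\<dots> = (\<Sum>u\<in>B. \<Sum>x\<in>B - {u}. \<Sum>y\<in>B - {u}. (swap_norm u x y)\<^sup>2)"
    unfolding swap_norm_square by (rule sum.cong[OF refl], rule sum_swap3)
  finally show ?thesis .
qed

text \<open>
  The swaps that involve the tagged particle and those that do not are bounded separately in the
  random transposition inequality. \<open>4 * 651\<^sup>2 + 6144 * 9 / 2 \<le> 2000000\<close> explains the constant.
\<close>

theorem tagged_gap:
  assumes hole: "card A < card B"
  shows "fact (card B) * (\<Sum>q\<in>perms. (F q)\<^sup>2) - (\<Sum>q\<in>perms. F q)\<^sup>2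
    \<le> fact (card B) * (2000000 * sites_per_hole * (real n)\<^sup>2 * total_energy)"
proof -
  let ?N = "real (card B)" and ?E = total_energy
  have N: "?N = (2 * real n + 1)\<^sup>2" by (simp add: card_square)
  have N0: "?N > 0" unfolding N by (simp add: pos_add_strict)
  have r: "sites_per_hole \<ge> 1" by (rule sites_per_hole_ge_1[OF hole])
  have E: "?E \<ge> 0" by (rule total_energy_nonneg)
  have N9: "?N \<le> 9 * (real n)\<^sup>2"
  proof -
    have "(2 * real n + 1)\<^sup>2 \<le> (3 * real n)\<^sup>2" using n by (intro power_mono) auto
    then show ?thesis by (simp add: N power_mult_distrib)
  qed
  have "(\<Sum>u\<in>B. \<Sum>x\<in>B - {u}. \<Sum>y\<in>B - {u}. (swap_norm u x y)\<^sup>2)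
      \<le> (\<Sum>u\<in>B. 6144 * (2 * n + 1) ^ 4 * energy_at u)"
    by (intro sum_mono sum_swap_norm_untagged)
  also have "\<dots> = 6144 * (2 * n + 1) ^ 4 * ?E"
    by (simp only: total_energy_eq sum_distrib_left)
  also have "6144 * (2 * n + 1) ^ 4 = 6144 * card B * card B"
  proof -
    have "x ^ 4 = x\<^sup>2 * x\<^sup>2" for x :: nat by (simp add: power4_eq_xxxx power2_eq_square)
    then show ?thesis by (simp only: card_square mult.assoc)
  qed
  finally have U: "(\<Sum>u\<in>B. \<Sum>x\<in>B - {u}. \<Sum>y\<in>B - {u}. (swap_norm u x y)\<^sup>2) \<le> 6144 * ?N * ?N * ?E"
    by simp
  have T: "2 * (\<Sum>q\<in>perms. \<Sum>y\<in>B. (F (q \<circ> transpose (tag q) y) - F q)\<^sup>2)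
     \<le> 8 * ?N * (423801 * (real n)\<^sup>2 * sites_per_hole * ?E)"
    using sum_tagged_moves[OF hole] r E by (simp add: power_mult_distrib mult_ac)
  have "(\<Sum>x\<in>B. \<Sum>y\<in>B. swap_energy B F x y) \<le> 8 * ?N * (423801 * (real n)\<^sup>2 * sites_per_hole * ?E) + 6144 * ?N * ?N * ?E"
    using sum_all_swaps T U by linarith
  also have "6144 * ?N * ?N * ?E \<le> 6144 * ?N * (9 * (real n)\<^sup>2 * sites_per_hole) * ?E"
  proof (intro mult_right_mono mult_left_mono E)
    show "?N \<le> 9 * (real n)\<^sup>2 * sites_per_hole"
      using N9 mult_left_mono[OF r, of "9 * (real n)\<^sup>2"] by simp
  qed simp
  also have "8 * ?N * (423801 * (real n)\<^sup>2 * sites_per_hole * ?E) + 6144 * ?N * (9 * (real n)\<^sup>2 * sites_per_hole) * ?E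
     = 3445704 * (?N * (sites_per_hole * (real n)\<^sup>2 * ?E))" by (simp add: algebra_simps)
  also have "\<dots> \<le> 4000000 * (?N * (sites_per_hole * (real n)\<^sup>2 * ?E))"
    using r E by (intro mult_right_mono) auto
  finally have S: "(\<Sum>x\<in>B. \<Sum>y\<in>B. swap_energy B F x y) \<le> 4000000 * (?N * (sites_per_hole * (real n)\<^sup>2 * ?E))" by simp
  have "fact (card B) * (\<Sum>q\<in>perms. (F q)\<^sup>2) - (\<Sum>q\<in>perms. F q)\<^sup>2
      \<le> fact (card B) / (2 * card B) * (\<Sum>x\<in>B. \<Sum>y\<in>B. swap_energy B F x y)"
    unfolding perms_def by (rule random_transposition_gap) (use N0 in auto)
  also have "\<dots> \<le> fact (card B) / (2 * card B) * (4000000 * (?N * (sites_per_hole * (real n)\<^sup>2 * ?E)))"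
    using S by (rule mult_left_mono) simp
  also have "\<dots> = fact (card B) * (2000000 * sites_per_hole * (real n)\<^sup>2 * ?E)"
  proof -
    have "c / (2 * N) * (4000000 * (N * b)) = c * (2000000 * b)" if "N \<noteq> 0" for b c N :: real
      using that by simp
    from this[of ?N "fact (card B)" "sites_per_hole * (real n)\<^sup>2 * ?E"] less_imp_neq[OF N0] show ?thesis
      by (simp only: mult.assoc of_nat_mult of_nat_numeral not_False_eq_True neq_commute simp_thms)
  qed
  finally show ?thesis .
qed

end

section \<open>From labelled particles to one tagged particle\<close>

definition occupied :: "site set \<Rightarrow> site set \<Rightarrow> (site \<Rightarrow> site) \<Rightarrow> site set" where
  "occupied S A q = {x \<in> S. q x \<in> A}"

lemma occupied_eq_image:
  assumes q: "q permutes S" and A: "A \<subseteq> S" shows "occupied S A q = inv q ` A"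
proof (intro set_eqI iffI)
  fix x assume "x \<in> occupied S A q"
  then show "x \<in> inv q ` A" by (intro image_eqI[of _ _ "q x"]) (auto simp: occupied_def permutes_inverses[OF q])
next
  fix x assume "x \<in> inv q ` A"
  then show "x \<in> occupied S A q"
    using A permutes_in_image[OF permutes_inv[OF q]] by (auto simp: occupied_def permutes_inverses[OF q])
qed

lemma inj_on_inv: "q permutes S \<Longrightarrow> inj_on (inv q) A"
  using permutes_inj[OF permutes_inv] inj_on_subset by blast

lemma card_occupied: "q permutes S \<Longrightarrow> A \<subseteq> S \<Longrightarrow> card (occupied S A q) = card A"
  by (simp add: occupied_eq_image card_image inj_on_inv)

lemma sum_occupied:
  "q permutes S \<Longrightarrow> A \<subseteq> S \<Longrightarrow> (\<Sum>x\<in>occupied S A q. h x) = (\<Sum>a\<in>A. h (inv q a))"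
  by (simp add: occupied_eq_image sum.reindex inj_on_inv)

lemma relabel_permutes:
  assumes "a \<in> S" "b \<in> S" "q permutes S" shows "transpose a b \<circ> q permutes S"
  using assms by (intro permutes_compose permutes_swap_id)

lemma inv_relabel:
  assumes q: "q permutes S" shows "inv (transpose a b \<circ> q) = inv q \<circ> transpose a b"
  using permutes_bij[OF q] by (simp add: o_inv_distrib)

lemma occupied_relabel:
  assumes "a \<in> A" "b \<in> A" shows "occupied S A (transpose a b \<circ> q) = occupied S A q"
  using assms by (auto simp: occupied_def Transposition.transpose_def split: if_splits)

text \<open>
  Permuting the labels of the particles preserves the uniform distribution and the set of
  occupied sites; this exchangeability is behind all of the averaging identities below.
\<close>

lemma sum_relabel:
  assumes ab: "a \<in> A" "b \<in> A" "A \<subseteq> S"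
  shows "(\<Sum>q | q permutes S. \<Phi> (inv q) (occupied S A q))
    = (\<Sum>q | q permutes S. \<Phi> (inv q \<circ> transpose a b) (occupied S A q))"
  by (rule sum.reindex_bij_witness[where i = "\<lambda>q. transpose a b \<circ> q" and j = "\<lambda>q. transpose a b \<circ> q"])
     (use ab in \<open>auto simp: inv_relabel occupied_relabel relabel_permutes subsetD o_assoc comp_assoc[of "inv _"]\<close>)

lemma sum_tagged_average:
  fixes \<Phi> :: "site \<Rightarrow> site set \<Rightarrow> real"
  assumes a: "a \<in> A" and A: "A \<subseteq> S" "finite A"
  shows "card A * (\<Sum>q | q permutes S. \<Phi> (inv q a) (occupied S A q))
    = (\<Sum>q | q permutes S. \<Sum>x\<in>occupied S A q. \<Phi> x (occupied S A q) :: real)"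
proof -
  have "(\<Sum>q | q permutes S. \<Phi> (inv q a) (occupied S A q)) = (\<Sum>q | q permutes S. \<Phi> (inv q b) (occupied S A q))"
    if "b \<in> A" for b
    using sum_relabel[OF a that A(1), of "\<lambda>p. \<Phi> (p a)"] by simp
  then have "(\<Sum>b\<in>A. \<Sum>q | q permutes S. \<Phi> (inv q a) (occupied S A q))
     = (\<Sum>b\<in>A. \<Sum>q | q permutes S. \<Phi> (inv q b) (occupied S A q))"
    by (rule sum.cong[OF refl])
  then have "card A * (\<Sum>q | q permutes S. \<Phi> (inv q a) (occupied S A q))
     = (\<Sum>b\<in>A. \<Sum>q | q permutes S. \<Phi> (inv q b) (occupied S A q))" by simp
  also have "\<dots> = (\<Sum>q | q permutes S. \<Sum>b\<in>A. \<Phi> (inv q b) (occupied S A q))" by (rule sum.swap)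
  also have "\<dots> = (\<Sum>q | q permutes S. \<Sum>x\<in>occupied S A q. \<Phi> x (occupied S A q))"
    by (rule sum.cong[OF refl]) (simp add: sum_occupied A(1))
  finally show ?thesis .
qed

lemma sum_two_tags:
  fixes \<Phi> :: "site \<Rightarrow> site \<Rightarrow> site set \<Rightarrow> real"
  assumes a: "a \<in> A" "b \<in> A" "a \<noteq> b" and A: "A \<subseteq> S" "finite A"
  shows "(real (card A) - 1) * (\<Sum>q | q permutes S. \<Phi> (inv q a) (inv q b) (occupied S A q))
    = (\<Sum>q | q permutes S. \<Sum>c\<in>A - {a}. \<Phi> (inv q a) (inv q c) (occupied S A q) :: real)"
proof -
  have "(\<Sum>q | q permutes S. \<Phi> (inv q a) (inv q b) (occupied S A q)) = (\<Sum>q | q permutes S. \<Phi> (inv q a) (inv q c) (occupied S A q))"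
    if "c \<in> A - {a}" for c
  proof -
    have "transpose b c a = a" using that a(3) by (auto simp: Transposition.transpose_def)
    then show ?thesis using sum_relabel[OF a(2) _ A(1), of c "\<lambda>p. \<Phi> (p a) (p b)"] that by simp
  qed
  then have "(\<Sum>c\<in>A - {a}. \<Sum>q | q permutes S. \<Phi> (inv q a) (inv q c) (occupied S A q))
     = (\<Sum>c\<in>A - {a}. \<Sum>q | q permutes S. \<Phi> (inv q a) (inv q b) (occupied S A q))"
    by (rule sum.cong[OF refl, OF sym])
  also have "\<dots> = card (A - {a}) * (\<Sum>q | q permutes S. \<Phi> (inv q a) (inv q b) (occupied S A q))" by simp
  also have "real (card (A - {a})) = real (card A) - 1"
    using a A card_gt_0_iff[of A] by (auto simp: of_nat_diff)
  finally show ?thesis using sum.swap[of "\<lambda>c q. \<Phi> (inv q a) (inv q c) (occupied S A q)" "{q. q permutes S}" "A - {a}"] by simp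
qed

definition centered :: "nat \<Rightarrow> site set \<Rightarrow> site set \<Rightarrow> (site \<Rightarrow> site \<Rightarrow> site set \<Rightarrow> real) \<Rightarrow> bool" where
  "centered k S A g \<longleftrightarrow> (\<forall>R\<subseteq>S. card R = k \<longrightarrow>
     (\<forall>x\<in>R. (\<Sum>a\<in>A. g a x R) = 0) \<and> (\<forall>a\<in>A. (\<Sum>x\<in>R. g a x R) = 0))"

text \<open>
  This is \<open>K / (K - 1)\<close> for \<open>K\<close> particles. For a single particle it is 1, the quotient by zero
  being zero; then a centred function vanishes anyway.
\<close>

definition label_factor :: "site set \<Rightarrow> real" where
  "label_factor A = 1 + 1 / (real (card A) - 1)"

lemma label_factor_nonneg: "label_factor A \<ge> 0"
proof (cases "card A = 0")
  case False
  then have "real (card A) - 1 \<ge> 0" by simp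
  then have "1 / (real (card A) - 1) \<ge> 0" by (rule divide_nonneg_nonneg[OF zero_le_one])
  then show ?thesis unfolding label_factor_def by linarith
qed (simp add: label_factor_def)

text \<open>
  Given the occupied set, the position of a particle is uniform, so the functions \<open>g a\<close> have
  conditional mean zero and are orthogonal to \<open>h\<close>. Given also the position of particle \<open>a\<close>, the
  position of particle \<open>b\<close> is uniform over the remaining occupied sites; centring in the position
  turns the product of \<open>g a\<close> and \<open>g b\<close> into \<open>- 1 / (K - 1)\<close> times their product
  at the same site, and centring in the label sums these products over \<open>b \<noteq> a\<close> to minus the square of \<open>g a\<close>.
\<close>

lemma centered_orthogonality:
  assumes A: "A \<subseteq> S" "finite S" and g: "centered (card A) S A g"
  shows "(\<Sum>q | q permutes S. (h (occupied S A q) + (\<Sum>a\<in>A. g a (inv q a) (occupied S A q)))\<^sup>2)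
    = (\<Sum>q | q permutes S. (h (occupied S A q))\<^sup>2)
    + label_factor A * (\<Sum>a\<in>A. \<Sum>q | q permutes S. (g a (inv q a) (occupied S A q))\<^sup>2)"
proof -
  let ?P = "{q. q permutes S}" and ?O = "occupied S A"
  let ?s = "\<lambda>q. \<Sum>a\<in>A. g a (inv q a) (?O q)"
  have finA: "finite A" using A finite_subset by auto
  have R: "?O q \<subseteq> S" "card (?O q) = card A" if "q \<in> ?P" for q
    using that A(1) card_occupied[of q S A] by (simp_all, simp add: occupied_def)
  have inO: "inv q a \<in> ?O q" if "q \<in> ?P" "a \<in> A" for q a
    using that A(1) by (simp add: occupied_eq_image)
  have g1: "(\<Sum>b\<in>A. g b x (?O q)) = 0" if "q \<in> ?P" "x \<in> ?O q" for q x
    using g R[OF that(1)] that(2) by (simp add: centered_def)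
  have g2: "(\<Sum>x\<in>?O q. g a x (?O q)) = 0" if "q \<in> ?P" "a \<in> A" for q a
    using g R[OF that(1)] that(2) by (simp add: centered_def)
  have cross: "(\<Sum>q\<in>?P. h (?O q) * ?s q) = 0"
  proof -
    have "(\<Sum>q\<in>?P. h (?O q) * g a (inv q a) (?O q)) = 0" if a: "a \<in> A" for a
    proof -
      have "card A * (\<Sum>q\<in>?P. h (?O q) * g a (inv q a) (?O q)) = (\<Sum>q\<in>?P. \<Sum>x\<in>?O q. h (?O q) * g a x (?O q))"
        by (rule sum_tagged_average[OF a A(1) finA, of "\<lambda>x R. h R * g a x R"])
      also have "\<dots> = 0"
        by (rule sum.neutral) (simp add: sum_distrib_left[symmetric] g2 a)
      finally show ?thesis using a finA by auto
    qed
    then have "(\<Sum>a\<in>A. \<Sum>q\<in>?P. h (?O q) * g a (inv q a) (?O q)) = 0" by simp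
    then show ?thesis by (subst (asm) sum.swap) (simp add: sum_distrib_left)
  qed
  have square: "(\<Sum>q\<in>?P. (?s q)\<^sup>2) = label_factor A * (\<Sum>a\<in>A. \<Sum>q\<in>?P. (g a (inv q a) (?O q))\<^sup>2)"
  proof -
    have "(\<Sum>q\<in>?P. g a (inv q a) (?O q) * ?s q) = label_factor A * (\<Sum>q\<in>?P. (g a (inv q a) (?O q))\<^sup>2)"
      if a: "a \<in> A" for a
    proof (cases "card A = 1")
      case True
      then have A1: "A = {a}" using a by (metis card_1_singletonE singletonD)
      then have "g a (inv q a) (?O q) = 0" if "q \<in> ?P" for q using g1[OF that inO[OF that a]] by simp
      then show ?thesis by (simp add: A1)
    next
      case False
      then have k: "real (card A) - 1 \<noteq> 0" by simp
      define Z where "Z = (\<Sum>q\<in>?P. (g a (inv q a) (?O q))\<^sup>2)"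
      have off: "(real (card A) - 1) * (\<Sum>q\<in>?P. g a (inv q a) (?O q) * g b (inv q b) (?O q))
         = - (\<Sum>q\<in>?P. g a (inv q a) (?O q) * g b (inv q a) (?O q))" if b: "b \<in> A - {a}" for b
      proof -
        have "(real (card A) - 1) * (\<Sum>q\<in>?P. g a (inv q a) (?O q) * g b (inv q b) (?O q))
          = (\<Sum>q\<in>?P. \<Sum>c\<in>A - {a}. g a (inv q a) (?O q) * g b (inv q c) (?O q))"
          using sum_two_tags[OF a _ _ A(1) finA, of b "\<lambda>x y R. g a x R * g b y R"] b by auto
        also have "\<dots> = (\<Sum>q\<in>?P. - (g a (inv q a) (?O q) * g b (inv q a) (?O q)))"
        proof (rule sum.cong[OF refl])
          fix q assume q: "q \<in> ?P"
          have "(\<Sum>c\<in>A. g b (inv q c) (?O q)) = 0"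
            using g2[OF q, of b] sum_occupied[of q S A "\<lambda>x. g b x (?O q)"] q A(1) b by simp
          then have "(\<Sum>c\<in>A - {a}. g b (inv q c) (?O q)) = - g b (inv q a) (?O q)"
            using a finA by (simp add: sum_diff1)
          then show "(\<Sum>c\<in>A - {a}. g a (inv q a) (?O q) * g b (inv q c) (?O q)) = - (g a (inv q a) (?O q) * g b (inv q a) (?O q))"
            by (simp add: sum_distrib_left[symmetric])
        qed
        finally show ?thesis by (simp add: sum_negf)
      qed
      have "(real (card A) - 1) * (\<Sum>b\<in>A - {a}. \<Sum>q\<in>?P. g a (inv q a) (?O q) * g b (inv q b) (?O q))
         = (\<Sum>b\<in>A - {a}. - (\<Sum>q\<in>?P. g a (inv q a) (?O q) * g b (inv q a) (?O q)))"
        unfolding sum_distrib_left[of "real (card A) - 1" _ "A - {a}"] by (rule sum.cong[OF refl off])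
      also have "\<dots> = - (\<Sum>q\<in>?P. \<Sum>b\<in>A - {a}. g a (inv q a) (?O q) * g b (inv q a) (?O q))"
        by (subst sum.swap) (simp add: sum_negf)
      also have "(\<Sum>q\<in>?P. \<Sum>b\<in>A - {a}. g a (inv q a) (?O q) * g b (inv q a) (?O q)) = (\<Sum>q\<in>?P. - (g a (inv q a) (?O q))\<^sup>2)"
      proof (rule sum.cong[OF refl])
        fix q assume q: "q \<in> ?P"
        have "(\<Sum>b\<in>A - {a}. g b (inv q a) (?O q)) = - g a (inv q a) (?O q)"
          using g1[OF q inO[OF q a]] a finA by (simp add: sum_diff1)
        then show "(\<Sum>b\<in>A - {a}. g a (inv q a) (?O q) * g b (inv q a) (?O q)) = - (g a (inv q a) (?O q))\<^sup>2"
          by (simp add: sum_distrib_left[symmetric] power2_eq_square)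
      qed
      finally have rest: "(real (card A) - 1) * (\<Sum>b\<in>A - {a}. \<Sum>q\<in>?P. g a (inv q a) (?O q) * g b (inv q b) (?O q)) = Z"
        by (simp add: sum_negf Z_def)
      have "(\<Sum>q\<in>?P. g a (inv q a) (?O q) * ?s q) = (\<Sum>b\<in>A. \<Sum>q\<in>?P. g a (inv q a) (?O q) * g b (inv q b) (?O q))"
        by (subst sum.swap) (simp add: sum_distrib_left)
      also have "\<dots> = Z + (\<Sum>b\<in>A - {a}. \<Sum>q\<in>?P. g a (inv q a) (?O q) * g b (inv q b) (?O q))"
        by (subst sum.remove[OF finA a]) (simp add: Z_def power2_eq_square)
      also have "\<dots> = label_factor A * Z"
        using rest k by (simp add: label_factor_def field_simps)
      finally show ?thesis by (simp add: Z_def)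
    qed
    then have "(\<Sum>a\<in>A. \<Sum>q\<in>?P. g a (inv q a) (?O q) * ?s q)
       = (\<Sum>a\<in>A. label_factor A * (\<Sum>q\<in>?P. (g a (inv q a) (?O q))\<^sup>2))"
      by (rule sum.cong[OF refl])
    moreover have "(\<Sum>q\<in>?P. (?s q)\<^sup>2) = (\<Sum>a\<in>A. \<Sum>q\<in>?P. g a (inv q a) (?O q) * ?s q)"
      by (subst sum.swap) (simp add: power2_eq_square sum_distrib_right)
    ultimately show ?thesis by (simp add: sum_distrib_left)
  qed
  have "(\<Sum>q\<in>?P. (h (?O q) + ?s q)\<^sup>2) = (\<Sum>q\<in>?P. (h (?O q))\<^sup>2 + (?s q)\<^sup>2 + 2 * (h (?O q) * ?s q))"
    by (simp add: power2_sum mult.assoc)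
  also have "\<dots> = (\<Sum>q\<in>?P. (h (?O q))\<^sup>2) + (\<Sum>q\<in>?P. (?s q)\<^sup>2) + 2 * (\<Sum>q\<in>?P. h (?O q) * ?s q)"
    by (simp only: sum.distrib sum_distrib_left)
  finally show ?thesis unfolding cross square by simp
qed

text \<open>
  Double centring, as in a two-way analysis of variance.
\<close>

definition center :: "site set \<Rightarrow> (site \<Rightarrow> site \<Rightarrow> site set \<Rightarrow> real) \<Rightarrow> site \<Rightarrow> site \<Rightarrow> site set \<Rightarrow> real" where
  "center A G a x R = G a x R - (\<Sum>b\<in>A. G b x R) / card A - (\<Sum>y\<in>R. G a y R) / card A
     + (\<Sum>b\<in>A. \<Sum>y\<in>R. G b y R) / (card A)\<^sup>2"

text \<open>
  For an arrangement with occupied set \<open>R\<close> this is what \<open>center\<close> removes, summed over the particles.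
\<close>

definition occupation_part :: "site set \<Rightarrow> (site \<Rightarrow> site \<Rightarrow> site set \<Rightarrow> real) \<Rightarrow> site set \<Rightarrow> real" where
  "occupation_part A G R = (\<Sum>b\<in>A. \<Sum>y\<in>R. G b y R) / card A"

lemma centered_center:
  assumes A: "A \<subseteq> S" "finite S" "A \<noteq> {}" shows "centered (card A) S A (center A G)"
  unfolding centered_def
proof (intro allI impI conjI ballI)
  fix R assume R: "R \<subseteq> S" "card R = card A"
  have k: "real (card A) \<noteq> 0" using A finite_subset by (auto simp: card_eq_0_iff)
  let ?T = "\<Sum>b\<in>A. \<Sum>y\<in>R. G b y R" and ?k = "real (card A)"
  have T: "?k * (?T / ?k\<^sup>2) = ?T / ?k" using k by (simp add: power2_eq_square)
  {
    fix x assume "x \<in> R"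
    have "(\<Sum>a\<in>A. center A G a x R) = (\<Sum>a\<in>A. G a x R) - ?k * ((\<Sum>b\<in>A. G b x R) / ?k) - ?T / ?k + ?k * (?T / ?k\<^sup>2)"
      by (simp add: center_def sum.distrib sum_subtractf sum_divide_distrib)
    then show "(\<Sum>a\<in>A. center A G a x R) = 0" unfolding T using k by simp
  next
    fix a assume "a \<in> A"
    have "(\<Sum>x\<in>R. \<Sum>b\<in>A. G b x R) = ?T" by (rule sum.swap)
    then have "(\<Sum>x\<in>R. center A G a x R) = (\<Sum>x\<in>R. G a x R) - ?T / ?k - ?k * ((\<Sum>y\<in>R. G a y R) / ?k) + ?k * (?T / ?k\<^sup>2)"
      by (simp add: center_def sum.distrib sum_subtractf sum_divide_distrib[symmetric] R(2))
    then show "(\<Sum>x\<in>R. center A G a x R) = 0" unfolding T using k by simp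
  }
qed

lemma center_decomposition:
  assumes A: "A \<subseteq> S" "finite S" "A \<noteq> {}" and q: "q permutes S"
  shows "(\<Sum>a\<in>A. G a (inv q a) (occupied S A q))
    = occupation_part A G (occupied S A q) + (\<Sum>a\<in>A. center A G a (inv q a) (occupied S A q))"
proof -
  let ?O = "occupied S A q" and ?k = "real (card A)"
  have k: "?k \<noteq> 0" using A finite_subset by (auto simp: card_eq_0_iff)
  let ?T = "\<Sum>b\<in>A. \<Sum>y\<in>?O. G b y ?O"
  have "(\<Sum>a\<in>A. \<Sum>b\<in>A. G b (inv q a) ?O) = (\<Sum>b\<in>A. \<Sum>a\<in>A. G b (inv q a) ?O)" by (rule sum.swap)
  also have "\<dots> = ?T" by (simp add: sum_occupied[OF q A(1)])
  finally have 1: "(\<Sum>a\<in>A. \<Sum>b\<in>A. G b (inv q a) ?O) = ?T" .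
  have "(\<Sum>a\<in>A. center A G a (inv q a) ?O)
    = (\<Sum>a\<in>A. G a (inv q a) ?O) - ?T / ?k - ?T / ?k + ?k * (?T / ?k\<^sup>2)"
    by (simp add: center_def sum.distrib sum_subtractf sum_divide_distrib[symmetric] 1)
  also have "?k * (?T / ?k\<^sup>2) = ?T / ?k" using k by (simp add: power2_eq_square)
  finally show ?thesis by (simp add: occupation_part_def)
qed

lemma occupied_swap:
  assumes "x \<in> S" "y \<in> S"
  shows "occupied S A (q \<circ> transpose x y) = transpose x y ` occupied S A q"
proof (intro set_eqI iffI)
  fix z assume "z \<in> occupied S A (q \<circ> transpose x y)"
  then show "z \<in> transpose x y ` occupied S A q"
    using assms by (intro image_eqI[of _ _ "transpose x y z"]) (auto simp: occupied_def Transposition.transpose_def)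
next
  fix z assume "z \<in> transpose x y ` occupied S A q"
  then show "z \<in> occupied S A (q \<circ> transpose x y)"
    using assms by (auto simp: occupied_def) (auto simp: Transposition.transpose_def)
qed

lemma inv_swap: "q permutes S \<Longrightarrow> inv (q \<circ> transpose x y) = transpose x y \<circ> inv q"
  by (simp add: o_inv_distrib permutes_bij)

definition hop_energy :: "nat \<Rightarrow> site set \<Rightarrow> ((site \<Rightarrow> site) \<Rightarrow> real) \<Rightarrow> real" where
  "hop_energy n A F = (\<Sum>q | q permutes square n. \<Sum>(x, y)\<in>bonds n.
     of_bool (q x \<in> A \<and> q y \<notin> A) * (F (q \<circ> transpose x y) - F q)\<^sup>2)"

text \<open>
  Across a bond, the increments of \<open>h\<close> and \<open>g\<close>, multiplied by the indicator that the jump is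
  legal, are again a function of the occupied set and a centred family: a swap of sites acts
  on positions by a bijection and does not touch the labels. So the orthogonality applies to
  increments, bond by bond.
\<close>

lemma hop_energy_decomposition:
  assumes A: "A \<subseteq> square n" and g: "centered (card A) (square n) A g"
  shows "hop_energy n A (\<lambda>q. h (occupied (square n) A q) + (\<Sum>a\<in>A. g a (inv q a) (occupied (square n) A q)))
    = hop_energy n A (\<lambda>q. h (occupied (square n) A q))
      + label_factor A * (\<Sum>a\<in>A. hop_energy n A (\<lambda>q. g a (inv q a) (occupied (square n) A q)))"
proof -
  let ?S = "square n" let ?O = "occupied ?S A"
  define f where "f = (\<lambda>q. h (?O q) + (\<Sum>a\<in>A. g a (inv q a) (?O q)))"
  define E where "E F e = (\<Sum>q | q permutes ?S. case e of (x, y) \<Rightarrow> of_bool (q x \<in> A \<and> q y \<notin> A) * (F (q \<circ> transpose x y) - F q)\<^sup>2)"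
    for F :: "(site \<Rightarrow> site) \<Rightarrow> real" and e :: "site \<times> site"
  have hop: "hop_energy n A F = (\<Sum>e\<in>bonds n. E F e)" for F
    unfolding hop_energy_def E_def by (rule sum.swap)
  have "E f e = E (\<lambda>q. h (?O q)) e + label_factor A * (\<Sum>a\<in>A. E (\<lambda>q. g a (inv q a) (?O q)) e)" if e: "e \<in> bonds n" for e
  proof -
    obtain x y where xy: "e = (x, y)" "x \<in> ?S" "y \<in> ?S" using e by (auto simp: bonds_def)
    let ?t = "transpose x y"
    define w :: "site set \<Rightarrow> real" where "w R = of_bool (x \<in> R \<and> y \<notin> R)" for R
    define h' where "h' R = w R * (h (?t ` R) - h R)" for R
    define g' where "g' a z R = w R * (g a (?t z) (?t ` R) - g a z R)" for a z R
    have w: "of_bool (q x \<in> A \<and> q y \<notin> A) = w (?O q)" for q using xy by (simp add: w_def occupied_def)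
    have w2: "w R * c\<^sup>2 = (w R * c)\<^sup>2" for R c by (simp add: w_def)
    have cent: "centered (card A) ?S A g'"
      unfolding centered_def
    proof (intro allI impI conjI ballI)
      fix R assume R: "R \<subseteq> ?S" "card R = card A"
      have tO: "?t ` R \<subseteq> ?S" "card (?t ` R) = card A"
      proof -
        show "?t ` R \<subseteq> ?S" using R xy by (auto simp: Transposition.transpose_def)
        have "inj_on ?t R" by (rule inj_on_inverseI[of _ ?t]) simp
        then show "card (?t ` R) = card A" using R by (simp add: card_image)
      qed
      {
        fix z assume z: "z \<in> R"
        then have "(\<Sum>a\<in>A. g a (?t z) (?t ` R)) = 0" "(\<Sum>a\<in>A. g a z R) = 0"
          using g R tO by (auto simp: centered_def)
        then show "(\<Sum>a\<in>A. g' a z R) = 0" by (simp add: g'_def sum_distrib_left[symmetric] sum_subtractf)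
      next
        fix a assume a: "a \<in> A"
        have "(\<Sum>z\<in>R. g a (?t z) (?t ` R)) = (\<Sum>z\<in>?t ` R. g a z (?t ` R))"
          by (subst sum.reindex[OF inj_on_inverseI[of _ ?t]]) simp_all
        then have "(\<Sum>z\<in>R. g a (?t z) (?t ` R)) = 0" "(\<Sum>z\<in>R. g a z R) = 0"
          using g R tO a by (auto simp: centered_def)
        then show "(\<Sum>z\<in>R. g' a z R) = 0" by (simp add: g'_def sum_distrib_left[symmetric] sum_subtractf)
      }
    qed
    have Ef: "E f e = (\<Sum>q | q permutes ?S. (h' (?O q) + (\<Sum>a\<in>A. g' a (inv q a) (?O q)))\<^sup>2)"
      unfolding E_def xy prod.case
    proof (rule sum.cong[OF refl])
      fix q assume "q \<in> {q. q permutes ?S}"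
      then have q: "q permutes ?S" by simp
      have "w (?O q) * (f (q \<circ> ?t) - f q) = h' (?O q) + (\<Sum>a\<in>A. g' a (inv q a) (?O q))"
        by (simp add: f_def inv_swap[OF q] occupied_swap[OF xy(2,3)] h'_def g'_def sum_subtractf
            sum_distrib_left[symmetric] algebra_simps)
      then show "of_bool (q x \<in> A \<and> q y \<notin> A) * (f (q \<circ> ?t) - f q)\<^sup>2 = (h' (?O q) + (\<Sum>a\<in>A. g' a (inv q a) (?O q)))\<^sup>2"
        by (simp only: w w2)
    qed
    have Eh: "E (\<lambda>q. h (?O q)) e = (\<Sum>q | q permutes ?S. (h' (?O q))\<^sup>2)"
      unfolding E_def xy prod.case by (simp only: w w2 h'_def occupied_swap[OF xy(2,3)])
    have Eg: "E (\<lambda>q. g a (inv q a) (?O q)) e = (\<Sum>q | q permutes ?S. (g' a (inv q a) (?O q))\<^sup>2)" for a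
      unfolding E_def xy prod.case
    proof (rule sum.cong[OF refl])
      fix q assume "q \<in> {q. q permutes ?S}"
      then have q: "q permutes ?S" by simp
      show "of_bool (q x \<in> A \<and> q y \<notin> A) * (g a (inv (q \<circ> ?t) a) (?O (q \<circ> ?t)) - g a (inv q a) (?O q))\<^sup>2
         = (g' a (inv q a) (?O q))\<^sup>2"
        by (simp only: w w2 g'_def occupied_swap[OF xy(2,3)] inv_swap[OF q] comp_apply)
    qed
    show ?thesis unfolding Ef Eh Eg by (rule centered_orthogonality[OF A finite_square cent])
  qed
  then have "(\<Sum>e\<in>bonds n. E f e) = (\<Sum>e\<in>bonds n. E (\<lambda>q. h (?O q)) e + label_factor A * (\<Sum>a\<in>A. E (\<lambda>q. g a (inv q a) (?O q)) e))"
    by (rule sum.cong[OF refl])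
  also have "\<dots> = (\<Sum>e\<in>bonds n. E (\<lambda>q. h (?O q)) e) + label_factor A * (\<Sum>a\<in>A. \<Sum>e\<in>bonds n. E (\<lambda>q. g a (inv q a) (?O q)) e)"
  proof -
    have sw: "(\<Sum>a\<in>A. \<Sum>e\<in>bonds n. E (\<lambda>q. g a (inv q a) (?O q)) e) = (\<Sum>e\<in>bonds n. \<Sum>a\<in>A. E (\<lambda>q. g a (inv q a) (?O q)) e)"
      by (rule sum.swap)
    show ?thesis unfolding sw by (simp only: sum.distrib sum_distrib_left)
  qed
  finally show ?thesis unfolding hop f_def .
qed

lemma occupied_swap_same:
  assumes "q x \<in> A \<longleftrightarrow> q y \<in> A"
  shows "occupied S A (q \<circ> transpose x y) = occupied S A q"
proof -
  have "(q \<circ> transpose x y) z \<in> A \<longleftrightarrow> q z \<in> A" for z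
    using assms(1) by (cases "z = x"; cases "z = y") simp_all
  then show ?thesis unfolding occupied_def by blast
qed

lemma tagged_exclusion_tag_function:
  assumes n: "1 \<le> n" and A: "A \<subseteq> square n" "a \<in> A"
  shows "tagged_exclusion n A a (\<lambda>q. \<phi> (inv q a) (occupied (square n) A q))"
proof (unfold_locales)
  let ?S = "square n"
  have key: "\<phi> (inv (q \<circ> transpose x y) a) (occupied ?S A (q \<circ> transpose x y)) = \<phi> (inv q a) (occupied ?S A q)"
    if q: "q permutes ?S" and xy: "q x \<in> ?S" "q y \<in> ?S" "q x \<in> A \<longleftrightarrow> q y \<in> A" "q x \<noteq> a" "q y \<noteq> a" for q x y
  proof -
    have "inv q a \<noteq> x" "inv q a \<noteq> y" using xy by (auto simp: permutes_inverses[OF q])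
    then show ?thesis using occupied_swap_same[of q x A y ?S, OF xy(3)] by (simp add: inv_swap[OF q])
  qed
  fix q x y assume q: "q permutes ?S"
  { assume xy: "q x \<in> A - {a}" "q y \<in> A - {a}"
    show "\<phi> (inv (q \<circ> transpose x y) a) (occupied ?S A (q \<circ> transpose x y)) = \<phi> (inv q a) (occupied ?S A q)"
      by (rule key[OF q]) (use A xy in blast)+ }
  { assume xy: "q x \<in> ?S - A" "q y \<in> ?S - A"
    show "\<phi> (inv (q \<circ> transpose x y) a) (occupied ?S A (q \<circ> transpose x y)) = \<phi> (inv q a) (occupied ?S A q)"
      by (rule key[OF q]) (use A xy in blast)+ }
qed (use n A in auto)

lemma tag_function_gap:
  assumes n: "1 \<le> n" and A: "A \<subseteq> square n" "a \<in> A" "card A < card (square n)"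
    and mean: "(\<Sum>q | q permutes square n. \<phi> (inv q a) (occupied (square n) A q)) = 0"
  shows "(\<Sum>q | q permutes square n. (\<phi> (inv q a) (occupied (square n) A q))\<^sup>2)
    \<le> 2000000 * (card (square n) / (real (card (square n)) - card A)) * (real n)\<^sup>2
      * hop_energy n A (\<lambda>q. \<phi> (inv q a) (occupied (square n) A q))"
proof -
  interpret te: tagged_exclusion n A a "\<lambda>q. \<phi> (inv q a) (occupied (square n) A q)"
    by (rule tagged_exclusion_tag_function[OF n A(1,2)])
  have "te.total_energy = hop_energy n A (\<lambda>q. \<phi> (inv q a) (occupied (square n) A q))"
    unfolding te.total_energy_def te.local_energy_def hop_energy_def te.perms_def ..
  then have "fact (card (square n)) * (\<Sum>q | q permutes square n. (\<phi> (inv q a) (occupied (square n) A q))\<^sup>2)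
    \<le> fact (card (square n)) * (2000000 * (card (square n) / (real (card (square n)) - card A)) * (real n)\<^sup>2
      * hop_energy n A (\<lambda>q. \<phi> (inv q a) (occupied (square n) A q)))"
    using te.tagged_gap[OF A(3)] mean by (simp add: te.perms_def te.sites_per_hole_def)
  then show ?thesis by (rule mult_left_le_imp_le) simp
qed

text \<open>
  Both parts of the decomposition are functions of one tagged particle and the occupied set, so the
  tagged gap applies to each; the weights in \<open>L\<^sup>2\<close> and in the Dirichlet form agree.
\<close>

theorem labelled_gap:
  fixes G :: "site \<Rightarrow> site \<Rightarrow> site set \<Rightarrow> real" and f :: "(site \<Rightarrow> site) \<Rightarrow> real"
  assumes A: "A \<subseteq> square n" "card A < card (square n)"
  defines "f \<equiv> \<lambda>q. \<Sum>a\<in>A. G a (inv q a) (occupied (square n) A q)"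
  assumes mean: "(\<Sum>q | q permutes square n. f q) = 0"
  shows "(\<Sum>q | q permutes square n. (f q)\<^sup>2)
    \<le> 2000000 * (card (square n) / (real (card (square n)) - card A)) * (real n)\<^sup>2 * hop_energy n A f"
proof (cases "A = {}")
  case True
  then show ?thesis by (simp add: f_def hop_energy_def)
next
  case False
  let ?S = "square n" let ?O = "occupied ?S A" let ?P = "{q. q permutes ?S}"
  define C where "C = 2000000 * (card ?S / (real (card ?S) - card A)) * (real n)\<^sup>2"
  obtain t where t: "t \<in> A" using False by auto
  have finA: "finite A" using finite_subset[OF A(1)] by simp
  have n: "1 \<le> n"
  proof (rule ccontr)
    assume "\<not> 1 \<le> n"
    then have "n = 0" by simp
    then have "card A < 1" using A(2) by (simp add: card_square)
    then show False using False finA by simp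
  qed
  define g where "g = center A G"
  define h where "h = occupation_part A G"
  have g: "centered (card A) ?S A g" unfolding g_def by (rule centered_center[OF A(1) finite_square False])
  have f: "f q = h (?O q) + (\<Sum>a\<in>A. g a (inv q a) (?O q))" if "q permutes ?S" for q
    unfolding f_def g_def h_def by (rule center_decomposition[OF A(1) finite_square False that])
  have mg: "(\<Sum>q\<in>?P. g a (inv q a) (?O q)) = 0" if a: "a \<in> A" for a
  proof -
    have "card A * (\<Sum>q\<in>?P. g a (inv q a) (?O q)) = (\<Sum>q\<in>?P. \<Sum>x\<in>?O q. g a x (?O q))"
      by (rule sum_tagged_average[OF a A(1) finA])
    also have "\<dots> = 0"
      using g a card_occupied[OF _ A(1)] by (intro sum.neutral) (auto simp: centered_def occupied_def)
    finally show ?thesis using False finA by simp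
  qed
  have mh: "(\<Sum>q\<in>?P. h (?O q)) = 0"
  proof -
    have "(\<Sum>q\<in>?P. \<Sum>a\<in>A. g a (inv q a) (?O q)) = 0"
      by (subst sum.swap) (simp add: mg)
    moreover have "(\<Sum>q\<in>?P. h (?O q) + (\<Sum>a\<in>A. g a (inv q a) (?O q))) = 0"
      using mean f by simp
    ultimately show ?thesis by (simp add: sum.distrib)
  qed
  have Gh: "(\<Sum>q\<in>?P. (h (?O q))\<^sup>2) \<le> C * hop_energy n A (\<lambda>q. h (?O q))"
    \<comment> \<open>a function of the occupied set may be regarded as a function of any tagged particle\<close>
    unfolding C_def by (rule tag_function_gap[OF n A(1) t A(2), of "\<lambda>x. h"]) (rule mh)
  have Gg: "(\<Sum>q\<in>?P. (g a (inv q a) (?O q))\<^sup>2) \<le> C * hop_energy n A (\<lambda>q. g a (inv q a) (?O q))" if "a \<in> A" for a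
    unfolding C_def by (rule tag_function_gap[OF n A(1) that A(2)]) (rule mg[OF that])
  have "(\<Sum>q\<in>?P. (f q)\<^sup>2) = (\<Sum>q\<in>?P. (h (?O q) + (\<Sum>a\<in>A. g a (inv q a) (?O q)))\<^sup>2)"
    by (rule sum.cong[OF refl]) (simp add: f)
  also have "\<dots> = (\<Sum>q\<in>?P. (h (?O q))\<^sup>2) + label_factor A * (\<Sum>a\<in>A. \<Sum>q\<in>?P. (g a (inv q a) (?O q))\<^sup>2)"
    by (rule centered_orthogonality[OF A(1) finite_square g])
  also have "\<dots> \<le> C * hop_energy n A (\<lambda>q. h (?O q))
      + label_factor A * (\<Sum>a\<in>A. C * hop_energy n A (\<lambda>q. g a (inv q a) (?O q)))"
    using label_factor_nonneg[of A] by (intro add_mono mult_left_mono sum_mono Gh Gg) auto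
  also have "\<dots> = C * (hop_energy n A (\<lambda>q. h (?O q))
      + label_factor A * (\<Sum>a\<in>A. hop_energy n A (\<lambda>q. g a (inv q a) (?O q))))"
    by (simp add: sum_distrib_left algebra_simps)
  also have "\<dots> = C * hop_energy n A (\<lambda>q. h (?O q) + (\<Sum>a\<in>A. g a (inv q a) (?O q)))"
    by (simp only: hop_energy_decomposition[OF A(1) g])
  also have "hop_energy n A (\<lambda>q. h (?O q) + (\<Sum>a\<in>A. g a (inv q a) (?O q))) = hop_energy n A f"
    unfolding hop_energy_def
  proof (rule sum.cong[OF refl], rule sum.cong[OF refl])
    fix q e assume q: "q \<in> ?P" and e: "e \<in> bonds n"
    obtain x y where xy: "e = (x, y)" "x \<in> ?S" "y \<in> ?S" using e by (auto simp: bonds_def)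
    have "(q \<circ> transpose x y) permutes ?S" using q xy by (intro permutes_compose permutes_swap_id) auto
    then show "(case e of (x, y) \<Rightarrow> of_bool (q x \<in> A \<and> q y \<notin> A) *
        (h (?O (q \<circ> transpose x y)) + (\<Sum>a\<in>A. g a (inv (q \<circ> transpose x y) a) (?O (q \<circ> transpose x y)))
          - (h (?O q) + (\<Sum>a\<in>A. g a (inv q a) (?O q))))\<^sup>2)
      = (case e of (x, y) \<Rightarrow> of_bool (q x \<in> A \<and> q y \<notin> A) * (f (q \<circ> transpose x y) - f q)\<^sup>2)"
      using q by (simp only: xy(1) prod.case f mem_Collect_eq)
  qed
  finally show ?thesis by (simp only: C_def)
qed

section \<open>The canonical measure as a uniform arrangement of labels\<close>

lemma ex_permutes_map:
  assumes S: "finite S" and ls: "distinct ls" "set ls \<subseteq> S" and xs: "distinct xs" "set xs \<subseteq> S" and len: "length xs = length ls"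
  shows "\<exists>q. q permutes S \<and> map q ls = xs"
proof -
  have b: "bij_betw ((!) ls) {..<length ls} (set ls)" "bij_betw ((!) xs) {..<length ls} (set xs)"
    using ls xs len by (simp_all add: bij_betw_nth)
  define f where "f = (!) xs \<circ> inv_into {..<length ls} ((!) ls)"
  have f: "bij_betw f (set ls) (set xs)"
    unfolding f_def by (rule bij_betw_trans[OF bij_betw_inv_into[OF b(1)] b(2)])
  have fl: "f (ls ! i) = xs ! i" if "i < length ls" for i
    using that b(1) by (simp add: f_def bij_betw_inv_into_left)
  have "card (S - set ls) = card (S - set xs)"
    using S ls xs len by (simp add: card_Diff_subset distinct_card)
  then obtain g where g: "bij_betw g (S - set ls) (S - set xs)"
    using S finite_same_card_bij[of "S - set ls" "S - set xs"] by auto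
  define q where "q x = (if x \<in> set ls then f x else if x \<in> S then g x else x)" for x
  have "bij_betw q (set ls \<union> (S - set ls)) (set xs \<union> (S - set xs))"
  proof (rule bij_betw_combine)
    show "bij_betw q (set ls) (set xs)" using f by (subst bij_betw_cong[of _ q f]) (auto simp: q_def)
    show "bij_betw q (S - set ls) (S - set xs)" using g by (subst bij_betw_cong[of _ q g]) (auto simp: q_def)
  qed auto
  then have "bij_betw q S S" using ls xs by (simp add: Un_absorb1)
  then have "q permutes S" by (rule bij_imp_permutes) (use ls in \<open>auto simp: q_def\<close>)
  moreover have "map q ls = xs" using len by (intro nth_equalityI) (auto simp: q_def fl)
  ultimately show ?thesis by blast
qed

text \<open>
  The permutations of \<open>S\<close> act transitively on these lists, so averaging over the orbit of \<open>ls\<close> is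
  averaging over all of them.
\<close>

lemma sum_injective_lists:
  fixes g :: "'a list \<Rightarrow> real"
  assumes S: "finite S" and ls: "distinct ls" "set ls \<subseteq> S"
  defines "X \<equiv> {xs. length xs = length ls \<and> distinct xs \<and> set xs \<subseteq> S}"
  shows "fact (card S) * (\<Sum>xs\<in>X. g xs) = card X * (\<Sum>p | p permutes S. g (map p ls))"
proof -
  let ?P = "{p. p permutes S}"
  have inX: "map p xs \<in> X" if "p permutes S" "xs \<in> X" for p xs
    using that permutes_inj_on[OF that(1)] by (auto simp: X_def distinct_map permutes_in_image)
  have shift: "(\<Sum>xs\<in>X. g (map p xs)) = (\<Sum>xs\<in>X. g xs)" if p: "p permutes S" for p
  proof (rule sum.reindex_bij_witness[where i = "map (inv p)" and j = "map p"])
    fix xs assume xs: "xs \<in> X"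
    show "map (inv p) (map p xs) = xs" "map p (map (inv p) xs) = xs"
      using permutes_inv_o[OF p] by simp_all
    show "map p xs \<in> X" by (rule inX[OF p xs])
    show "map (inv p) xs \<in> X" by (rule inX[OF permutes_inv[OF p] xs])
  qed simp_all
  have base: "(\<Sum>p\<in>?P. g (map p xs)) = (\<Sum>p\<in>?P. g (map p ls))" if xs: "xs \<in> X" for xs
  proof -
    obtain q where q: "q permutes S" "map q ls = xs"
      using ex_permutes_map[OF S ls, of xs] xs by (auto simp: X_def)
    have "(\<Sum>p\<in>?P. g (map p ls)) = (\<Sum>p\<in>?P. g (map (p \<circ> q) ls))"
      by (rule sum_permutations_compose_right[OF q(1)])
    also have "\<dots> = (\<Sum>p\<in>?P. g (map p xs))" by (simp flip: q(2))
    finally show ?thesis by simp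
  qed
  have "fact (card S) * (\<Sum>xs\<in>X. g xs) = (\<Sum>p\<in>?P. \<Sum>xs\<in>X. g xs)"
    using S by (simp add: card_permutations)
  also have "\<dots> = (\<Sum>p\<in>?P. \<Sum>xs\<in>X. g (map p xs))"
    by (rule sum.cong[OF refl]) (simp add: shift)
  also have "\<dots> = (\<Sum>xs\<in>X. \<Sum>p\<in>?P. g (map p xs))" by (rule sum.swap)
  also have "\<dots> = (\<Sum>xs\<in>X. \<Sum>p\<in>?P. g (map p ls))"
    by (rule sum.cong[OF refl base])
  finally show ?thesis by simp
qed

lemma map_of_zip_map:
  assumes p: "p permutes S" and len: "length ls = length ps"
  shows "map_of (zip (map p ls) ps) = map_of (zip ls ps) \<circ> inv p"
proof
  fix x show "map_of (zip (map p ls) ps) x = (map_of (zip ls ps) \<circ> inv p) x"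
    using len by (induction ls ps rule: list_induct2) (auto simp: permutes_inverses[OF p])
qed

text \<open>
  The labels are the sites themselves; \<open>\<kappa>\<close> places the particles on the first sites of some
  enumeration of the square, and the permutation spreads them.
\<close>

lemma canonical_expectation_permutations:
  assumes "(Ka, \<Theta>a, Kp, \<Theta>p) \<in> canonical_states n"
  obtains A :: "site set" and \<kappa> :: "site \<Rightarrow> particle option"
    where "A \<subseteq> square n" "card A = Ka + Kp" "dom \<kappa> = A"
    "\<And>g. canonical_expectation n (Ka, \<Theta>a, Kp, \<Theta>p) g = (\<Sum>q | q permutes square n. g (\<kappa> \<circ> q)) / fact (card (square n))"
proof -
  let ?B = "square n" let ?K = "(Ka, \<Theta>a, Kp, \<Theta>p)"
  define ps where "ps = (SOME ps. mset ps = particles ?K)"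
  have "mset ps = particles ?K" unfolding ps_def by (rule someI_ex) (rule ex_mset)
  then have "length ps = size (particles ?K)" by (metis size_mset)
  then have len: "length ps = Ka + Kp" using assms by (simp add: canonical_states_def)
  obtain bs where bs: "set bs = ?B" "distinct bs" using finite_distinct_list[OF finite_square] by blast
  define ls where "ls = take (Ka + Kp) bs"
  have "Ka + Kp \<le> length bs" using assms bs distinct_card[of bs] by (simp add: canonical_states_def)
  then have ls: "length ls = length ps" "distinct ls" "set ls \<subseteq> ?B"
    using bs len by (auto simp: ls_def dest: in_set_takeD)
  define X where "X = {xs. length xs = length ls \<and> distinct xs \<and> set xs \<subseteq> ?B}"
  have X: "finite X" "X \<noteq> {}"
  proof -
    show "finite X" unfolding X_def
      by (rule finite_subset[OF _ finite_lists_length_eq[OF finite_square, of n "length ls"]]) auto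
    show "X \<noteq> {}" using ls by (auto simp: X_def)
  qed
  define \<kappa> where "\<kappa> = map_of (zip ls ps)"
  have "canonical_expectation n ?K g = (\<Sum>q | q permutes ?B. g (\<kappa> \<circ> q)) / fact (card ?B)" for g
  proof -
    have "canonical_expectation n ?K g = (\<Sum>xs\<in>X. g (map_of (zip xs ps))) / card X"
      unfolding canonical_expectation_def canonical_measure_def Let_def ps_def[symmetric]
      using X ls(1) by (simp add: X_def integral_pmf_of_set)
    also have "\<dots> = (\<Sum>p | p permutes ?B. g (map_of (zip (map p ls) ps))) / fact (card ?B)"
      using sum_injective_lists[OF finite_square ls(2,3), of "\<lambda>xs. g (map_of (zip xs ps))"] X
      by (simp add: X_def[symmetric] field_simps)
    also have "(\<Sum>p | p permutes ?B. g (map_of (zip (map p ls) ps))) = (\<Sum>p | p permutes ?B. g (\<kappa> \<circ> inv p))"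
      by (rule sum.cong[OF refl]) (simp add: \<kappa>_def map_of_zip_map[OF _ ls(1)])
    also have "\<dots> = (\<Sum>q | q permutes ?B. g (\<kappa> \<circ> q))"
      by (rule sum_permutations_inverse[symmetric])
    finally show ?thesis .
  qed
  moreover have "dom \<kappa> = set ls" unfolding \<kappa>_def using ls(1) by simp
  moreover have "card (set ls) = Ka + Kp" using ls len by (simp add: distinct_card)
  ultimately show ?thesis using that[of "set ls" \<kappa>] ls(3) by blast
qed

lemma eta_eq: "eta \<xi> x = of_bool (\<xi> x \<noteq> None)"
proof (cases "\<xi> x")
  case (Some p)
  then show ?thesis by (cases p; cases "fst p") (auto simp: eta_def eta_type_def)
qed (simp add: eta_def eta_type_def)

lemma swap_sites_comp: "swap_sites x y (\<kappa> \<circ> q) = \<kappa> \<circ> (q \<circ> transpose x y)"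
  by (auto simp: swap_sites_def fun_eq_iff Transposition.transpose_def)

lemma generator_permutation:
  assumes "dom \<kappa> = A"
  shows "generator n f (\<kappa> \<circ> q) = (\<Sum>(x, y)\<in>bonds n. of_bool (q x \<in> A \<and> q y \<notin> A)
     * (f (\<kappa> \<circ> (q \<circ> transpose x y)) - f (\<kappa> \<circ> q)))"
  unfolding generator_def
proof (rule sum.reindex_bij_witness[where i = "\<lambda>(x, y). (x, y - x)" and j = "\<lambda>(x, z). (x, x + z)"])
  have *: "\<kappa> v \<noteq> None \<longleftrightarrow> v \<in> A" for v using assms by auto
  fix e assume "e \<in> {(x, z). x \<in> square n \<and> x + z \<in> square n \<and> l1_norm z = 1}"
  then show "(case case e of (x, z) \<Rightarrow> (x, x + z) of (x, y) \<Rightarrow> of_bool (q x \<in> A \<and> q y \<notin> A)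
     * (f (\<kappa> \<circ> (q \<circ> transpose x y)) - f (\<kappa> \<circ> q)))
    = (case e of (x, z) \<Rightarrow> eta (\<kappa> \<circ> q) x * (1 - eta (\<kappa> \<circ> q) (x + z)) * (f (swap_sites x (x + z) (\<kappa> \<circ> q)) - f (\<kappa> \<circ> q)))"
    unfolding eta_eq swap_sites_comp comp_apply * by (cases e) (auto simp: comp_assoc)
qed (auto simp: bonds_def)

text \<open>
  Reversibility: exchanging the roles of \<open>q\<close> and the swapped arrangement reverses the orientation
  of the bond, and the sum of both expressions is a complete square.
\<close>

lemma sum_reversible:
  fixes \<Phi> :: "(site \<Rightarrow> site) \<Rightarrow> real"
  shows "(\<Sum>q | q permutes square n. \<Phi> q * - (\<Sum>(x, y)\<in>bonds n. of_bool (q x \<in> A \<and> q y \<notin> A)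
     * (\<Phi> (q \<circ> transpose x y) - \<Phi> q))) = hop_energy n A \<Phi> / 2"
proof -
  let ?P = "{q. q permutes square n}"
  define w where "w q x y = (of_bool (q x \<in> A \<and> q y \<notin> A) :: real)" for q :: "site \<Rightarrow> site" and x y
  define T where "T = (\<lambda>(x, y). \<Sum>q\<in>?P. w q x y * (\<Phi> q * (\<Phi> q - \<Phi> (q \<circ> transpose x y))))"
  define R where "R = (\<lambda>(x, y). \<Sum>q\<in>?P. w q x y * (\<Phi> (q \<circ> transpose x y) - \<Phi> q)\<^sup>2)"
  have pair: "T (x, y) + T (y, x) = R (x, y)" if xy: "x \<in> square n" "y \<in> square n" for x y
  proof -
    have "T (y, x) = (\<Sum>q\<in>?P. w q x y * (\<Phi> (q \<circ> transpose x y) * (\<Phi> (q \<circ> transpose x y) - \<Phi> q)))"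
      unfolding T_def prod.case
    proof (rule sum.reindex_bij_witness[where i = "\<lambda>q. q \<circ> transpose x y" and j = "\<lambda>q. q \<circ> transpose x y"])
      fix q assume q: "q \<in> ?P"
      show 1: "q \<circ> transpose x y \<in> ?P" using q xy by (auto intro: permutes_compose permutes_swap_id)
      show 2: "q \<circ> transpose x y \<circ> transpose x y = q" by (simp add: comp_assoc)
      show "w (q \<circ> transpose x y) x y * (\<Phi> (q \<circ> transpose x y \<circ> transpose x y) * (\<Phi> (q \<circ> transpose x y \<circ> transpose x y) - \<Phi> (q \<circ> transpose x y)))
        = w q y x * (\<Phi> q * (\<Phi> q - \<Phi> (q \<circ> transpose y x)))"
        unfolding 2 by (simp add: w_def transpose_commute[of y x])
    next
      fix q assume q: "q \<in> ?P"
      show "q \<circ> transpose x y \<in> ?P" using q xy by (auto intro: permutes_compose permutes_swap_id)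
      show "q \<circ> transpose x y \<circ> transpose x y = q" by (simp add: comp_assoc)
    qed
    then show ?thesis
      by (simp add: T_def R_def sum.distrib[symmetric] distrib_left[symmetric] power2_eq_square)
         (simp add: algebra_simps)
  qed
  have "(\<Sum>q\<in>?P. \<Phi> q * - (\<Sum>(x, y)\<in>bonds n. of_bool (q x \<in> A \<and> q y \<notin> A) * (\<Phi> (q \<circ> transpose x y) - \<Phi> q)))
      = (\<Sum>q\<in>?P. \<Sum>e\<in>bonds n. case e of (x, y) \<Rightarrow> w q x y * (\<Phi> q * (\<Phi> q - \<Phi> (q \<circ> transpose x y))))"
    by (rule sum.cong[OF refl])
       (simp add: w_def sum_distrib_left sum_negf[symmetric] case_prod_unfold algebra_simps)
  also have "\<dots> = (\<Sum>e\<in>bonds n. T e)"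
    by (subst sum.swap) (simp add: T_def case_prod_unfold)
  finally have 1: "(\<Sum>q\<in>?P. \<Phi> q * - (\<Sum>(x, y)\<in>bonds n. of_bool (q x \<in> A \<and> q y \<notin> A) * (\<Phi> (q \<circ> transpose x y) - \<Phi> q)))
      = (\<Sum>e\<in>bonds n. T e)" .
  have 2: "(\<Sum>e\<in>bonds n. T e) = (\<Sum>e\<in>bonds n. T (prod.swap e))"
    by (rule sum.reindex_bij_witness[where i = prod.swap and j = prod.swap]) (auto simp: bonds_sym)
  have "(\<Sum>e\<in>bonds n. T e) + (\<Sum>e\<in>bonds n. T (prod.swap e)) = (\<Sum>e\<in>bonds n. T e + T (prod.swap e))"
    by (rule sum.distrib[symmetric])
  also have "\<dots> = (\<Sum>e\<in>bonds n. R e)"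
    by (rule sum.cong[OF refl]) (auto simp: pair bonds_def)
  also have "\<dots> = hop_energy n A \<Phi>"
    unfolding hop_energy_def R_def w_def by (subst sum.swap) (simp add: case_prod_unfold)
  finally show ?thesis using 1 2 by simp
qed

text \<open>
  At an empty site the bracket of the defining sum vanishes, so the unconditional sum is a finite
  sum over the occupied sites; the bracket depends on the label found there only.
\<close>

lemma T_gen_labelled:
  assumes g: "g \<in> T_gen \<omega>" and \<kappa>: "dom \<kappa> = A" and A: "A \<subseteq> square n"
  shows "\<exists>G. \<forall>q. q permutes square n \<longrightarrow> g (\<kappa> \<circ> q) = (\<Sum>a\<in>A. G a (inv q a) (occupied (square n) A q))"
proof -
  obtain a b c d F where F: "\<And>\<xi>. ((\<lambda>x. (a * eta_type Active \<xi> x + b * eta_type Passive \<xi> x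
      + c * eta_ang Active \<omega> \<xi> x + d * eta_ang Passive \<omega> \<xi> x) * F x (eta \<xi>)) has_sum g \<xi>) UNIV"
    using g unfolding T_gen_def by blast
  define wt where "wt l = a * eta_type Active (\<lambda>_. \<kappa> l) 0 + b * eta_type Passive (\<lambda>_. \<kappa> l) 0
      + c * eta_ang Active \<omega> (\<lambda>_. \<kappa> l) 0 + d * eta_ang Passive \<omega> (\<lambda>_. \<kappa> l) (0 :: site)" for l
  define G where "G l x R = wt l * F x (\<lambda>y. of_bool (y \<in> R))" for l x R
  have "g (\<kappa> \<circ> q) = (\<Sum>l\<in>A. G l (inv q l) (occupied (square n) A q))" if q: "q permutes square n" for q
  proof -
    let ?O = "occupied (square n) A q"
    have mem: "x \<in> ?O \<longleftrightarrow> q x \<in> A" for x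
      using A permutes_in_image[OF q, of x] by (auto simp: occupied_def)
    have k: "\<kappa> l = None \<longleftrightarrow> l \<notin> A" for l using \<kappa> by auto
    have e: "eta (\<kappa> \<circ> q) = (\<lambda>y. of_bool (y \<in> ?O))"
      by (rule ext) (simp add: eta_eq mem k)
    have w: "a * eta_type Active (\<kappa> \<circ> q) x + b * eta_type Passive (\<kappa> \<circ> q) x
      + c * eta_ang Active \<omega> (\<kappa> \<circ> q) x + d * eta_ang Passive \<omega> (\<kappa> \<circ> q) x = wt (q x)" for x
      by (simp add: wt_def eta_type_def eta_ang_def theta_def)
    have "((\<lambda>x. G (q x) x ?O) has_sum g (\<kappa> \<circ> q)) UNIV"
      using F[of "\<kappa> \<circ> q"] unfolding w e G_def .
    moreover have "((\<lambda>x. G (q x) x ?O) has_sum g (\<kappa> \<circ> q)) UNIV \<longleftrightarrow> ((\<lambda>x. G (q x) x ?O) has_sum g (\<kappa> \<circ> q)) ?O"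
    proof (rule has_sum_cong_neutral)
      fix x assume "x \<in> UNIV - ?O"
      then have "\<kappa> (q x) = None" by (simp add: mem k)
      then show "G (q x) x ?O = 0" by (simp add: G_def wt_def eta_type_def eta_ang_def)
    qed auto
    ultimately have "((\<lambda>x. G (q x) x ?O) has_sum g (\<kappa> \<circ> q)) ?O" by blast
    moreover have "finite ?O" by (simp add: occupied_def)
    ultimately have "g (\<kappa> \<circ> q) = (\<Sum>x\<in>?O. G (q x) x ?O)"
      using has_sum_finite has_sum_unique by blast
    also have "\<dots> = (\<Sum>l\<in>A. G l (inv q l) ?O)"
      by (simp add: sum_occupied[OF q A] permutes_inverses[OF q])
    finally show ?thesis .
  qed
  then show ?thesis by blast
qed

lemma T_box_labelled:
  assumes f: "f \<in> T_box \<omega> n" and \<kappa>: "dom \<kappa> = A" and A: "A \<subseteq> square n"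
  obtains G where "\<And>q. q permutes square n \<Longrightarrow> f (\<kappa> \<circ> q) = (\<Sum>a\<in>A. G a (inv q a) (occupied (square n) A q))"
proof -
  obtain m :: nat and r :: "nat \<Rightarrow> real" and g where g: "\<forall>i<m. g i \<in> T_gen \<omega>" and feq: "f = (\<lambda>\<xi>. \<Sum>i<m. r i * g i \<xi>)"
    using f unfolding T_box_def T_space_def by blast
  have "\<forall>i. \<exists>G. i < m \<longrightarrow> (\<forall>q. q permutes square n \<longrightarrow> g i (\<kappa> \<circ> q) = (\<Sum>a\<in>A. G a (inv q a) (occupied (square n) A q)))"
    using g T_gen_labelled[OF _ \<kappa> A] by blast
  then obtain G where G: "\<And>i q. i < m \<Longrightarrow> q permutes square n \<Longrightarrow> g i (\<kappa> \<circ> q) = (\<Sum>a\<in>A. G i a (inv q a) (occupied (square n) A q))"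
    by metis
  have "f (\<kappa> \<circ> q) = (\<Sum>a\<in>A. \<Sum>i<m. r i * G i a (inv q a) (occupied (square n) A q))" if "q permutes square n" for q
  proof -
    have "f (\<kappa> \<circ> q) = (\<Sum>i<m. \<Sum>a\<in>A. r i * G i a (inv q a) (occupied (square n) A q))"
      unfolding feq by (rule sum.cong[OF refl]) (simp add: G that sum_distrib_left)
    then show ?thesis by (subst (asm) sum.swap)
  qed
  then show ?thesis by (rule that[of "\<lambda>a x R. \<Sum>i<m. r i * G i a x R"])
qed

theorem proposition5p9:
  fixes \<alpha>' :: real
  assumes "0 \<le> \<alpha>'" and "\<alpha>' < 1"
  shows "\<exists>C::real. \<forall>(n::nat) (\<omega> :: angle \<Rightarrow> real) Ka \<Theta>a Kp \<Theta>p.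
    \<forall>f \<in> T_box \<omega> n.
      (Ka, \<Theta>a, Kp, \<Theta>p) \<in> canonical_states n \<longrightarrow>
      real Ka / real (card (square n)) + real Kp / real (card (square n)) \<le> \<alpha>' \<longrightarrow>
      canonical_expectation n (Ka, \<Theta>a, Kp, \<Theta>p) f = 0 \<longrightarrow>
      canonical_expectation n (Ka, \<Theta>a, Kp, \<Theta>p) (\<lambda>\<xi>. (f \<xi>)\<^sup>2)
        \<le> C * (real n)\<^sup>2 * dirichlet_form n (Ka, \<Theta>a, Kp, \<Theta>p) f"
proof (intro exI[of _ "4000000 / (1 - \<alpha>')"] allI ballI impI)
  fix n Ka Kp :: nat and \<omega> :: "angle \<Rightarrow> real" and \<Theta>a \<Theta>p :: "angle multiset" and f
  let ?B = "square n" let ?K = "(Ka, \<Theta>a, Kp, \<Theta>p)" let ?P = "{q. q permutes square n}" let ?N = "real (card (square n))"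
  assume f: "f \<in> T_box \<omega> n" and K: "?K \<in> canonical_states n"
    and dens: "real Ka / ?N + real Kp / ?N \<le> \<alpha>'" and mean: "canonical_expectation n ?K f = 0"
  obtain A \<kappa> where A: "A \<subseteq> ?B" "card A = Ka + Kp" and \<kappa>: "dom \<kappa> = A"
    and E: "\<And>g. canonical_expectation n ?K g = (\<Sum>q\<in>?P. g (\<kappa> \<circ> q)) / fact (card ?B)"
    using canonical_expectation_permutations[OF K] by metis
  obtain G where G: "\<And>q. q permutes ?B \<Longrightarrow> f (\<kappa> \<circ> q) = (\<Sum>a\<in>A. G a (inv q a) (occupied ?B A q))"
    using T_box_labelled[OF f \<kappa> A(1)] by metis
  define \<Phi> where "\<Phi> q = f (\<kappa> \<circ> q)" for q :: "site \<Rightarrow> site"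
  define \<Psi> where "\<Psi> q = (\<Sum>a\<in>A. G a (inv q a) (occupied ?B A q))" for q
  have N: "?N > 0" by (simp add: card_square)
  have "real (card A) / ?N \<le> \<alpha>'" using dens A(2) by (simp add: add_divide_distrib)
  then have cA: "real (card A) \<le> \<alpha>' * ?N" using N by (simp add: field_simps)
  then have gap: "(1 - \<alpha>') * ?N \<le> ?N - card A" by (simp add: algebra_simps)
  have pos: "(1 - \<alpha>') * ?N > 0" using N assms by simp
  have lt: "card A < card ?B" using gap pos by linarith
  have \<rho>: "?N / (?N - card A) \<le> 1 / (1 - \<alpha>')"
  proof -
    have "?N / (?N - card A) \<le> ?N / ((1 - \<alpha>') * ?N)" using gap pos N by (intro divide_left_mono) auto
    also have "\<dots> = 1 / (1 - \<alpha>')"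
      by (rule nonzero_divide_mult_cancel_right) (use N in linarith)
    finally show ?thesis .
  qed
  have \<Phi>\<Psi>: "\<Phi> q = \<Psi> q" if "q permutes ?B" for q using G[OF that] by (simp add: \<Phi>_def \<Psi>_def)
  have "(\<Sum>q\<in>?P. \<Phi> q) = 0" using mean by (simp add: E \<Phi>_def)
  then have m0: "(\<Sum>q\<in>?P. \<Psi> q) = 0" using \<Phi>\<Psi> by simp
  have hopeq: "hop_energy n A \<Psi> = hop_energy n A \<Phi>"
    unfolding hop_energy_def
  proof (rule sum.cong[OF refl], rule sum.cong[OF refl])
    fix q e assume q: "q \<in> ?P" and e: "e \<in> bonds n"
    obtain x y where xy: "e = (x, y)" "x \<in> ?B" "y \<in> ?B" using e by (auto simp: bonds_def)
    have "(q \<circ> transpose x y) permutes ?B" using q xy by (intro permutes_compose permutes_swap_id) auto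
    then show "(case e of (x, y) \<Rightarrow> of_bool (q x \<in> A \<and> q y \<notin> A) * (\<Psi> (q \<circ> transpose x y) - \<Psi> q)\<^sup>2)
      = (case e of (x, y) \<Rightarrow> of_bool (q x \<in> A \<and> q y \<notin> A) * (\<Phi> (q \<circ> transpose x y) - \<Phi> q)\<^sup>2)"
      using q by (simp only: xy(1) prod.case \<Phi>\<Psi> mem_Collect_eq)
  qed
  have D: "dirichlet_form n ?K f = hop_energy n A \<Phi> / 2 / fact (card ?B)"
    unfolding dirichlet_form_def canonical_inner_def E generator_permutation[OF \<kappa>] \<Phi>_def[symmetric]
    by (simp only: sum_reversible)
  have h0: "hop_energy n A \<Phi> \<ge> 0" unfolding hop_energy_def by (intro sum_nonneg) auto
  have "(\<Sum>q\<in>?P. (\<Psi> q)\<^sup>2) \<le> 2000000 * (?N / (?N - card A)) * (real n)\<^sup>2 * hop_energy n A \<Psi>"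
    unfolding \<Psi>_def by (rule labelled_gap[OF A(1) lt]) (use m0 in \<open>simp add: \<Psi>_def\<close>)
  also have "\<dots> \<le> 2000000 * (1 / (1 - \<alpha>')) * (real n)\<^sup>2 * hop_energy n A \<Phi>"
    unfolding hopeq by (intro mult_right_mono mult_left_mono \<rho> h0) auto
  also have "(\<Sum>q\<in>?P. (\<Psi> q)\<^sup>2) = (\<Sum>q\<in>?P. (f (\<kappa> \<circ> q))\<^sup>2)"
    by (rule sum.cong[OF refl]) (simp add: \<Phi>\<Psi>[symmetric] \<Phi>_def)
  finally have "(\<Sum>q\<in>?P. (f (\<kappa> \<circ> q))\<^sup>2) / fact (card ?B)
     \<le> 2000000 * (1 / (1 - \<alpha>')) * (real n)\<^sup>2 * hop_energy n A \<Phi> / fact (card ?B)"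
    by (rule divide_right_mono) simp
  then show "canonical_expectation n ?K (\<lambda>\<xi>. (f \<xi>)\<^sup>2) \<le> 4000000 / (1 - \<alpha>') * (real n)\<^sup>2 * dirichlet_form n ?K f"
    unfolding D E by (simp add: mult_ac)
qed

end
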